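(* Let $\mathcal{C}$ be any connected component of the queer crystal of words $\mathcal{B}^{\otimes\ell}$ (with respect to the edges $b\to f_i(b)$, $i\in I_0\cup\{-1\}$). Then $\mathcal{C}$ satisfies the connectivity axioms C0, C1, C2: for every $I_0$-lowest weight element $v\in\mathcal{C}$, with $u=\uparrow v$ and $g_{j,k}=(e_1\cdots e_j)(e_1\cdots e_k)v$ for $1\le j\le k\le n$: (C0) $\varphi_{-1}(g_{j,k})=0$ implies $\varphi_{-1}(e_1\cdots e_kv)=0$; (C1) if $G(\mathcal{C})$ has an edge from the type $A$ component of $u$ to the type $A$ component of an $I_0$-highest weight element $u'$ with $\operatorname{wt}(u')=\operatorname{wt}(u)-\epsilon_{n+1-k}+\epsilon_{n+1-h}$ for some $h<k$, then for all $h<j\le k$ with $g_{j,k}\neq0$ we have $f_{-1}g_{j,k}\ne0$ and $f_{-1}g_{j,k}=(e_2\cdots e_j)(e_1\cdots e_h)v'$, where $v'$ is the $I_0$-lowest weight element with $\uparrow v'=u'$; (C2) for fixed $k$, suppose either (a) such an edge as in (C1) exists (for this $k$ and some $h<k$), or (b) no such edge exists; then for all $1\le j\le h$ in case (a), resp. all $1\le j\le k$ in case (b), such that $g_{j,k}\ne0$ and $f_{-1}g_{j,k}\ne0$, we have $f_{-1}g_{j,k}=(e_2\cdots e_k)(e_1\cdots e_j)v$.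
   Context: Fix $n\ge1$, $\ell\ge1$, $I_0=\{1,\dots,n\}$; $\epsilon_a$ is the $a$-th standard basis vector of $\mathbb{Z}^{n+1}$. $\mathcal{B}^{\otimes\ell}$ is the set of words $b=b_1\cdots b_\ell$ with letters in $\{1,\dots,n+1\}$, with $\operatorname{wt}(b)_a$ the number of letters equal to $a$. Operators map to $\mathcal{B}^{\otimes\ell}\sqcup\{0\}$, send $0$ to $0$; products denote composition (rightmost first), empty products are the identity. For $i\in I_0$: in the subsequence of letters equal to $i$ or $i+1$, repeatedly pair an $i+1$ with an $i$ immediately to its right in the current subsequence and remove the pair (these letters are bracketed); $f_i$ changes the rightmost unbracketed $i$ to $i+1$, $e_i$ the leftmost unbracketed $i+1$ to $i$ ($0$ if none). $f_{-1}(b)$: if the leftmost letter of $b$ lying in $\{1,2\}$ is $1$, change it to $2$; otherwise $0$. $e_{-1}(b)$: if that letter is $2$, change it to $1$; otherwise $0$. $\varphi_{-1}(b)=\max\{k\ge0:f_{-1}^kb\ne0\}$. An element is $I_0$-highest (resp. lowest) weight if all $e_i$ (resp. $f_i$), $i\in I_0$, kill it. A type $A$ component is a connected component of the graph with edges $b\to f_ib$, $i\in I_0$; it has a unique $I_0$-highest weight element; $\uparrow b$ denotes the $I_0$-highest weight element of the type $A$ component of $b$. The component graph $G(\mathcal{C})$ has as vertices the type $A$ components contained in $\mathcal{C}$, with a directed edge $C_1\to C_2$ if some $b_1\in C_1$ has $f_{-1}b_1\in C_2$. *)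

theory Defs
  imports Main
begin

text \<open>
  Words are lists of letters, with positions counted from 0. The set of words together with an
  extra element 0 is rendered by the option type: \<^const>\<open>None\<close> is the element 0.
\<close>

definition words :: "nat \<Rightarrow> nat \<Rightarrow> nat list set" where
  "words n l = {b. set b \<subseteq> {1..n+1} \<and> length b = l}"

definition wt :: "nat list \<Rightarrow> nat \<Rightarrow> int" where
  "wt b a = int (count_list b a)"

definition eps :: "nat \<Rightarrow> nat \<Rightarrow> int" where
  "eps a c = (if c = a then 1 else 0)"

subsection \<open>The bracketing rule\<close>

text \<open>A subsequence of a word is represented by the increasing list of its positions.\<close>

definition letter_positions :: "nat \<Rightarrow> nat list \<Rightarrow> nat list" where
  "letter_positions i b = filter (\<lambda>p. b ! p = i \<or> b ! p = i + 1) [0..<length b]"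

inductive bracket_step :: "nat \<Rightarrow> nat list \<Rightarrow> nat list \<Rightarrow> nat list \<Rightarrow> bool"
  for i :: nat and b :: "nat list" where
  "b ! p = i + 1 \<Longrightarrow> b ! q = i \<Longrightarrow> bracket_step i b (ps @ p # q # qs) (ps @ qs)"

definition unbracketed :: "nat \<Rightarrow> nat list \<Rightarrow> nat list" where
  "unbracketed i b = (THE ps. (bracket_step i b)\<^sup>*\<^sup>* (letter_positions i b) ps
      \<and> (\<nexists>qs. bracket_step i b ps qs))"

text \<open>
  The result does not depend on the order in which pairs are removed: it is computed by a scan
  from left to right with a stack (lemma \<open>unbracketed_eq\<close> below), so the description above is proper.
\<close>

fun bracket_push :: "nat \<Rightarrow> nat list \<Rightarrow> nat \<Rightarrow> nat list \<Rightarrow> nat list" where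
  "bracket_push i b q [] = [q]"
| "bracket_push i b q (p # st) = (if b ! p = i + 1 \<and> b ! q = i then st else q # p # st)"

lemma fold_bracket_push_step:
  assumes "bracket_step i b ps qs"
  shows "fold (bracket_push i b) ps st = fold (bracket_push i b) qs st"
  using assms
proof cases
  case (1 p q xs ys)
  have "bracket_push i b q (bracket_push i b p s) = s" for s
    using 1 by (cases s) auto
  then show ?thesis using 1 by simp
qed

lemma fold_bracket_push_steps:
  assumes "(bracket_step i b)\<^sup>*\<^sup>* ps qs"
  shows "fold (bracket_push i b) ps st = fold (bracket_push i b) qs st"
  using assms by (induction rule: rtranclp_induct) (auto dest: fold_bracket_push_step)

lemma fold_bracket_push_normal:
  assumes "\<nexists>qs. bracket_step i b (rev st @ ps) qs"
  shows "fold (bracket_push i b) ps st = rev (rev st @ ps)"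
  using assms
proof (induction ps arbitrary: st)
  case (Cons q ps)
  have "bracket_push i b q st = q # st"
  proof (cases st)
    case (Cons p st')
    have "\<not> (b ! p = i + 1 \<and> b ! q = i)"
      using Cons.prems bracket_step.intros[of b p i q "rev st'" ps] Cons by auto
    then show ?thesis using Cons by auto
  qed simp
  then show ?case using Cons.IH[of "q # st"] Cons.prems by simp
qed simp

lemma fold_bracket_push_reach:
  "(bracket_step i b)\<^sup>*\<^sup>* (rev st @ ps) (rev (fold (bracket_push i b) ps st))"
proof (induction ps arbitrary: st)
  case (Cons q ps)
  have "(bracket_step i b)\<^sup>*\<^sup>* (rev st @ q # ps) (rev (bracket_push i b q st) @ ps)"
    using bracket_step.intros[of b "hd st" i q "rev (tl st)" ps]
    by (cases st) auto
  then show ?case using Cons.IH[of "bracket_push i b q st"] by (auto intro: rtranclp_trans)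
qed simp

lemma bracket_step_length: "bracket_step i b ps qs \<Longrightarrow> length qs < length ps"
  by (auto elim: bracket_step.cases)

lemma bracket_normal_exists:
  "\<exists>qs. (bracket_step i b)\<^sup>*\<^sup>* ps qs \<and> (\<nexists>rs. bracket_step i b qs rs)"
proof (induction ps rule: length_induct)
  case (1 ps)
  show ?case
    using 1 bracket_step_length[of i b ps] by (meson converse_rtranclp_into_rtranclp rtranclp.rtrancl_refl)
qed

lemma bracket_normal_iff:
  "(bracket_step i b)\<^sup>*\<^sup>* ps qs \<and> (\<nexists>rs. bracket_step i b qs rs)
     \<longleftrightarrow> qs = rev (fold (bracket_push i b) ps [])"
proof -
  have *: "qs = rev (fold (bracket_push i b) ps [])"
    if "(bracket_step i b)\<^sup>*\<^sup>* ps qs" "\<nexists>rs. bracket_step i b qs rs" for qs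
    using fold_bracket_push_steps[OF that(1), of "[]"] fold_bracket_push_normal[of i b "[]" qs] that(2)
    by simp
  then show ?thesis using bracket_normal_exists[of i b ps] by metis
qed

lemma unbracketed_eq:
  "unbracketed i b = rev (fold (bracket_push i b) (letter_positions i b) [])"
  unfolding unbracketed_def bracket_normal_iff by simp

subsection \<open>Crystal operators\<close>

definition f_op :: "nat \<Rightarrow> nat list \<Rightarrow> nat list option" where
  "f_op i b = (let ps = filter (\<lambda>p. b ! p = i) (unbracketed i b) in
     if ps = [] then None else Some (b[last ps := i + 1]))"

definition e_op :: "nat \<Rightarrow> nat list \<Rightarrow> nat list option" where
  "e_op i b = (let ps = filter (\<lambda>p. b ! p = i + 1) (unbracketed i b) in
     if ps = [] then None else Some (b[hd ps := i]))"

text \<open>The odd operator $f_{-1}$.\<close>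

fun f_neg :: "nat list \<Rightarrow> nat list option" where
  "f_neg [] = None"
| "f_neg (x # b) = (if x = 1 then Some (2 # b) else if x = 2 then None
     else map_option ((#) x) (f_neg b))"

definition phi_neg :: "nat list \<Rightarrow> nat" where
  "phi_neg b = Max {k. ((\<lambda>x. Option.bind x f_neg) ^^ k) (Some b) \<noteq> None}"

text \<open>$e_a e_{a+1} \cdots e_c$, applied with $e_c$ first; the identity if $c < a$.\<close>

definition e_prod :: "nat \<Rightarrow> nat \<Rightarrow> nat list option \<Rightarrow> nat list option" where
  "e_prod a c x = foldr (\<lambda>i y. Option.bind y (e_op i)) [a..<Suc c] x"

definition highest :: "nat \<Rightarrow> nat list \<Rightarrow> bool" where
  "highest n b \<longleftrightarrow> (\<forall>i\<in>{1..n}. e_op i b = None)"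

definition lowest :: "nat \<Rightarrow> nat list \<Rightarrow> bool" where
  "lowest n b \<longleftrightarrow> (\<forall>i\<in>{1..n}. f_op i b = None)"

subsection \<open>Connected components\<close>

definition connected_comp :: "('a \<times> 'a) set \<Rightarrow> 'a \<Rightarrow> 'a set" where
  "connected_comp E b = (E \<union> E\<inverse>)\<^sup>* `` {b}"

definition typeA_edges :: "nat \<Rightarrow> nat \<Rightarrow> (nat list \<times> nat list) set" where
  "typeA_edges n l = {(b, b'). b \<in> words n l \<and> (\<exists>i\<in>{1..n}. f_op i b = Some b')}"

definition queer_edges :: "nat \<Rightarrow> nat \<Rightarrow> (nat list \<times> nat list) set" where
  "queer_edges n l = typeA_edges n l \<union> {(b, b'). b \<in> words n l \<and> f_neg b = Some b'}"

definition queer_components :: "nat \<Rightarrow> nat \<Rightarrow> nat list set set" where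
  "queer_components n l = connected_comp (queer_edges n l) ` words n l"

definition typeA_comp :: "nat \<Rightarrow> nat \<Rightarrow> nat list \<Rightarrow> nat list set" where
  "typeA_comp n l b = connected_comp (typeA_edges n l) b"

definition up :: "nat \<Rightarrow> nat \<Rightarrow> nat list \<Rightarrow> nat list" where
  "up n l b = (THE u. u \<in> typeA_comp n l b \<and> highest n u)"

definition lowest_of :: "nat \<Rightarrow> nat \<Rightarrow> nat list \<Rightarrow> nat list" where
  "lowest_of n l u = (THE v. v \<in> words n l \<and> lowest n v \<and> up n l v = u)"

definition comp_graph_vertices :: "nat \<Rightarrow> nat \<Rightarrow> nat list set \<Rightarrow> nat list set set" where
  "comp_graph_vertices n l C = {A \<in> typeA_comp n l ` words n l. A \<subseteq> C}"

definition comp_graph_edges ::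
    "nat \<Rightarrow> nat \<Rightarrow> nat list set \<Rightarrow> (nat list set \<times> nat list set) set" where
  "comp_graph_edges n l C = {(A1, A2). A1 \<in> comp_graph_vertices n l C \<and>
     A2 \<in> comp_graph_vertices n l C \<and> (\<exists>b1\<in>A1. \<exists>b2\<in>A2. f_neg b1 = Some b2)}"

subsection \<open>The connectivity axioms\<close>

definition g_elt :: "nat list \<Rightarrow> nat \<Rightarrow> nat \<Rightarrow> nat list option" where
  "g_elt v j k = e_prod 1 j (e_prod 1 k (Some v))"

text \<open>
  The component graph has an edge from the component of \<open>u\<close> to that of the highest weight
  element \<open>u'\<close>, and \<open>u'\<close> has the weight of \<open>u\<close> with one box moved from row
  \<open>n + 1 - k\<close> to row \<open>n + 1 - h\<close>.
\<close>

definition moving_edge ::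
    "nat \<Rightarrow> nat \<Rightarrow> nat list set \<Rightarrow> nat list \<Rightarrow> nat \<Rightarrow> nat \<Rightarrow> nat list \<Rightarrow> bool" where
  "moving_edge n l C u k h u' \<longleftrightarrow>
     u' \<in> C \<and> highest n u' \<and>
     (typeA_comp n l u, typeA_comp n l u') \<in> comp_graph_edges n l C \<and>
     (\<forall>a\<in>{1..n+1}. wt u' a = wt u a - eps (n + 1 - k) a + eps (n + 1 - h) a)"

text \<open>
  Here \<open>phi_neg\<close> is only defined on words, so the axiom concerns nonzero $g_{j,k}$ only (with
  $\varphi_{-1}(0) = 0$ it would already fail for the word 2 with $n = 1$).
\<close>

definition axiom_C0 :: "nat \<Rightarrow> nat list set \<Rightarrow> bool" where
  "axiom_C0 n C \<longleftrightarrow> (\<forall>v\<in>C. lowest n v \<longrightarrow>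
     (\<forall>j k g. 1 \<le> j \<and> j \<le> k \<and> k \<le> n \<and> g_elt v j k = Some g \<and> phi_neg g = 0 \<longrightarrow>
        (\<exists>w. e_prod 1 k (Some v) = Some w \<and> phi_neg w = 0)))"

definition axiom_C1 :: "nat \<Rightarrow> nat \<Rightarrow> nat list set \<Rightarrow> bool" where
  "axiom_C1 n l C \<longleftrightarrow> (\<forall>v\<in>C. lowest n v \<longrightarrow>
     (\<forall>k h u'. 1 \<le> k \<and> k \<le> n \<and> h < k \<and> moving_edge n l C (up n l v) k h u' \<longrightarrow>
        (\<forall>j g. h < j \<and> j \<le> k \<and> g_elt v j k = Some g \<longrightarrow>
           f_neg g \<noteq> None \<and>
           f_neg g = e_prod 2 j (e_prod 1 h (Some (lowest_of n l u'))))))"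

definition axiom_C2 :: "nat \<Rightarrow> nat \<Rightarrow> nat list set \<Rightarrow> bool" where
  "axiom_C2 n l C \<longleftrightarrow> (\<forall>v\<in>C. lowest n v \<longrightarrow>
     (\<forall>k. 1 \<le> k \<and> k \<le> n \<longrightarrow>
        (\<forall>h u'. h < k \<and> moving_edge n l C (up n l v) k h u' \<longrightarrow>
           (\<forall>j g. 1 \<le> j \<and> j \<le> h \<and> g_elt v j k = Some g \<and> f_neg g \<noteq> None \<longrightarrow>
              f_neg g = e_prod 2 k (e_prod 1 j (Some v)))) \<and>
        ((\<nexists>h u'. h < k \<and> moving_edge n l C (up n l v) k h u') \<longrightarrow>
           (\<forall>j g. 1 \<le> j \<and> j \<le> k \<and> g_elt v j k = Some g \<and> f_neg g \<noteq> None \<longrightarrow>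
              f_neg g = e_prod 2 k (e_prod 1 j (Some v))))))"

end

theory Submission
  imports Defs
begin

text \<open>
  A word is encoded by its height functions: the \<open>i\<close>-th height of a prefix is the number of letters
  \<open>i + 1\<close> minus the number of letters \<open>i\<close> in it. The operator \<open>e\<^sub>i\<close> acts at the last minimum of the
  \<open>i\<close>-th height, \<open>f\<^sub>i\<close> at the step into the first minimum, and such a flip changes the heights by a
  Cartan integer beyond its position; so all statements become statements about integer functions.

  Let \<open>v\<close> be lowest, let \<open>p\<^sub>k \<ge> \<dots> \<ge> p\<^sub>1\<close> be the positions flipped by \<open>e\<^sub>1 \<dots> e\<^sub>k\<close> on \<open>v\<close> and
  \<open>q\<^sub>j \<ge> \<dots> \<ge> q\<^sub>1\<close> those flipped by \<open>e\<^sub>1 \<dots> e\<^sub>j\<close> afterwards. Then \<open>p\<^sub>i < q\<^sub>i\<close>, and if \<open>f\<^sub>-\<^sub>1\<close> does not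
  kill \<open>g\<close> (or, equivalently, \<open>e\<^sub>1 \<dots> e\<^sub>k v\<close>), it undoes the flip at \<open>p\<^sub>1\<close>. If \<open>q\<^sub>i\<close> lies beyond \<open>p\<^sub>i\<^sub>+\<^sub>1\<close> for
  all \<open>i \<le> j < k\<close>, the two chains can be performed in the other order, which is the formula of C2.
  Otherwise let \<open>m\<close> be the least index where this fails. Then the word \<open>Y\<close> got from \<open>v\<close> by the flips
  \<open>q\<^sub>1, \<dots>, q\<^sub>m, p\<^sub>m\<^sub>+\<^sub>1, \<dots>, p\<^sub>k\<close> does not depend on \<open>j\<close>, and \<open>f\<^sub>-\<^sub>1 g = e\<^sub>2 \<dots> e\<^sub>j Y\<close>. Going down from \<open>Y\<close> as far as
  possible yields \<open>Y = e\<^sub>1 \<dots> e\<^sub>h v'\<close> with \<open>v'\<close> lowest, and \<open>h\<close> separates the two cases: the second one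
  occurs exactly for \<open>j > h\<close>. Conversely, applying \<open>f\<^sub>i\<close> to both ends of an arbitrary edge of the component
  graph reduces it to one starting in some \<open>g\<close>, and the weights then identify \<open>k\<close> and \<open>h\<close>.
\<close>

section \<open>Words as height functions\<close>

definition ht :: "nat \<Rightarrow> nat list \<Rightarrow> nat \<Rightarrow> int" where
  "ht i b t = int (count_list (take t b) (i + 1)) - int (count_list (take t b) i)"

text \<open>All natural numbers \<open>t\<close> are compared, and heights are constant past the end
  of a word. So \<open>lastmin (ht i b)\<close> holds nowhere exactly when the minimum is still
  attained at the end, which is when \<open>e_i\<close> kills \<open>b\<close>.\<close>

definition lastmin :: "(nat \<Rightarrow> int) \<Rightarrow> nat \<Rightarrow> bool" where
  "lastmin F p \<longleftrightarrow> (\<forall>t\<le>p. F p \<le> F t) \<and> (\<forall>t>p. F p < F t)"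

text \<open>The letter at \<open>p\<close> leads into the first minimum \<open>Suc p\<close>; a
  minimum attained already at 0 gives no such letter, and then \<open>f_i\<close> kills the
  word.\<close>

definition firstmin :: "(nat \<Rightarrow> int) \<Rightarrow> nat \<Rightarrow> bool" where
  "firstmin F p \<longleftrightarrow> (\<forall>t\<le>p. F (Suc p) < F t) \<and> (\<forall>t>p. F (Suc p) \<le> F t)"

definition step :: "nat \<Rightarrow> nat \<Rightarrow> int" where
  "step p t = (if p < t then 1 else 0)"

text \<open>Minus the Cartan matrix of type A, with an extra node 0, so that height 0, which counts
  the letters 1 of a word, obeys the same rule as the others.\<close>

definition cartan :: "nat \<Rightarrow> nat \<Rightarrow> int" where
  "cartan i j = (if j = i then -2 else if j = i + 1 \<or> i = j + 1 then 1 else 0)"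

lemma ht_0 [simp]: "ht i b 0 = 0"
  by (simp add: ht_def)

lemma ht_Suc:
  "ht i b (Suc t) = ht i b t +
     (if t < length b then if b ! t = i + 1 then 1 else if b ! t = i then -1 else 0 else 0)"
  by (auto simp: ht_def take_Suc_conv_app_nth)

lemma ht_ge_length: "length b \<le> t \<Longrightarrow> ht i b t = ht i b (length b)"
  by (simp add: ht_def)

lemma ht_append: "ht i (b @ c) t = ht i b t + ht i c (t - length b)"
  by (simp add: ht_def)

lemma lastmin_unique: "lastmin F p \<Longrightarrow> lastmin F q \<Longrightarrow> p = q"
  unfolding lastmin_def by (metis linorder_neqE_nat less_imp_le not_less)

lemma firstmin_unique:
  assumes "firstmin F p" "firstmin F q"
  shows "p = q"
proof -
  have False if "firstmin F p" "firstmin F q" "p < q" for p q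
  proof -
    have "F (Suc q) < F (Suc p)" "F (Suc p) \<le> F (Suc q)" using that by (simp_all add: firstmin_def)
    then show False by simp
  qed
  then show ?thesis using assms by (meson linorder_neqE_nat)
qed

subsection \<open>Crystal operators in terms of heights\<close>

text \<open>Positions below \<open>length b\<close> carry the same letters in \<open>b @ c\<close>,
  so the scan can be followed letter by letter.\<close>

lemma fold_bracket_push_append:
  assumes "set ps \<union> set st \<subseteq> {..<length b}"
  shows "fold (bracket_push i (b @ c)) ps st = fold (bracket_push i b) ps st \<and>
    set (fold (bracket_push i b) ps st) \<subseteq> {..<length b}"
  using assms
proof (induction ps arbitrary: st)
  case (Cons q ps)
  have "bracket_push i (b @ c) q st = bracket_push i b q st"
    using Cons.prems by (cases st) (auto simp: nth_append)
  moreover have "set (bracket_push i b q st) \<subseteq> {..<length b}"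
    using Cons.prems by (cases st) auto
  ultimately show ?case using Cons.IH[of "bracket_push i b q st"] Cons.prems by simp
qed simp

definition bracket_stack :: "nat \<Rightarrow> nat list \<Rightarrow> nat list" where
  "bracket_stack i b = fold (bracket_push i b) (letter_positions i b) []"

lemma bracket_stack_snoc:
  "bracket_stack i (b @ [x]) =
     (if x = i \<or> x = i + 1 then bracket_push i (b @ [x]) (length b) (bracket_stack i b)
      else bracket_stack i b)"
proof -
  have lp: "letter_positions i (b @ [x]) =
      letter_positions i b @ (if x = i \<or> x = i + 1 then [length b] else [])"
    unfolding letter_positions_def by (auto simp: nth_append intro: filter_cong)
  have "set (letter_positions i b) \<union> set [] \<subseteq> {..<length b}"
    by (auto simp: letter_positions_def)
  from fold_bracket_push_append[OF this, of i "[x]"] show ?thesis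
    unfolding bracket_stack_def lp by simp
qed

text \<open>Invariant of the scan. Read from the top, the stack holds the unbracketed letters
  \<open>i + 1\<close> and then the unbracketed letters \<open>i\<close>. The minimal height is
  minus the number of the latter; it is first reached just after the rightmost unbracketed
  \<open>i\<close> (\<open>hd D\<close>) and last reached just before the leftmost unbracketed
  \<open>i + 1\<close> (\<open>last U\<close>).\<close>

lemma bracket_stack_split:
  "\<exists>U D. bracket_stack i b = U @ D \<and> (\<forall>p\<in>set U. p < length b \<and> b ! p = i + 1) \<and>
     (\<forall>p\<in>set D. p < length b \<and> b ! p = i) \<and>
     ht i b (length b) = int (length U) - int (length D) \<and>
     (\<forall>t. - int (length D) \<le> ht i b t) \<and>
     (U \<noteq> [] \<longrightarrow> lastmin (ht i b) (last U) \<and> ht i b (last U) = - int (length D)) \<and>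
     (D \<noteq> [] \<longrightarrow> firstmin (ht i b) (hd D) \<and> ht i b (Suc (hd D)) = - int (length D))"
proof (induction b rule: rev_induct)
  case Nil
  have "bracket_stack i [] = [] @ []" by (simp add: bracket_stack_def letter_positions_def)
  moreover have "ht i [] t = 0" for t by (simp add: ht_def)
  ultimately show ?case by (intro exI[of _ "[]"]) auto
next
  case (snoc x b)
  then obtain U D where S: "bracket_stack i b = U @ D"
    and U: "\<forall>p\<in>set U. p < length b \<and> b ! p = i + 1"
    and D: "\<forall>p\<in>set D. p < length b \<and> b ! p = i"
    and e: "ht i b (length b) = int (length U) - int (length D)"
    and m: "\<forall>t. - int (length D) \<le> ht i b t"
    and lU: "U \<noteq> [] \<longrightarrow> lastmin (ht i b) (last U) \<and> ht i b (last U) = - int (length D)"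
    and hD: "D \<noteq> [] \<longrightarrow> firstmin (ht i b) (hd D) \<and> ht i b (Suc (hd D)) = - int (length D)"
    by blast
  let ?c = "b @ [x]"
  let ?d = "if x = i + 1 then 1 else if x = i then - 1 else 0 :: int"
  have h1: "ht i ?c t = ht i b t" if "t \<le> length b" for t
    using that by (simp add: ht_append)
  have h2: "ht i ?c t = int (length U) - int (length D) + ?d" if "t > length b" for t
    using that ht_ge_length[of b t i] e by (cases "t - length b") (auto simp: ht_append ht_Suc ht_def)
  have h2': "ht i b t = int (length U) - int (length D)" if "t > length b" for t
    using that ht_ge_length[of b t i] e by simp
  define G where "G = ht i ?c"
  have h: "G t = (if t \<le> length b then ht i b t else int (length U) - int (length D) + ?d)" for t
    using h1 h2 by (simp add: G_def)
  have Ul: "last U < length b" if "U \<noteq> []" using U that by simp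
  have Dl: "hd D < length b" if "D \<noteq> []" using D that by simp
  have Uc: "\<forall>p\<in>set U. p < length ?c \<and> ?c ! p = i + 1" using U by (auto simp: nth_append)
  have Dc: "\<forall>p\<in>set D. p < length ?c \<and> ?c ! p = i" using D by (auto simp: nth_append)
  have ex: "?case" if "bracket_stack i ?c = U' @ D'" "\<forall>p\<in>set U'. p < length ?c \<and> ?c ! p = i + 1"
      "\<forall>p\<in>set D'. p < length ?c \<and> ?c ! p = i"
      "G (length ?c) = int (length U') - int (length D')" "\<forall>t. - int (length D') \<le> G t"
      "U' \<noteq> [] \<longrightarrow> lastmin G (last U') \<and> G (last U') = - int (length D')"
      "D' \<noteq> [] \<longrightarrow> firstmin G (hd D') \<and> G (Suc (hd D')) = - int (length D')" for U' D'
    using that unfolding G_def by blast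
  consider (up) "x = i + 1" | (pop) "x = i" "U \<noteq> []" | (down) "x = i" "U = []" | (other) "x \<noteq> i" "x \<noteq> i + 1"
    by blast
  then show ?case
  proof cases
    case up
    have "bracket_stack i ?c = (length b # U) @ D"
      using up S by (cases "U @ D") (auto simp: bracket_stack_snoc)
    moreover have "lastmin G (last (length b # U)) \<and> G (last (length b # U)) = - int (length D)"
    proof (cases "U = []")
      case True
      then show ?thesis using m e by (auto simp: lastmin_def h up)
    next
      case False
      then show ?thesis using lU Ul h2' by (auto simp: lastmin_def h up)
    qed
    moreover have "D \<noteq> [] \<longrightarrow> firstmin G (hd D) \<and> G (Suc (hd D)) = - int (length D)"
      using hD Dl by (auto simp: firstmin_def h up Suc_le_eq)
    moreover have "\<forall>t. - int (length D) \<le> G t" using m by (auto simp: h up)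
    moreover have "G (length ?c) = int (length (length b # U)) - int (length D)" by (simp add: h up)
    ultimately show ?thesis using Uc Dc up
      by (intro ex[of "length b # U" D]) auto
  next
    case pop
    then obtain p U' where U': "U = p # U'" by (cases U) auto
    have st: "bracket_stack i ?c = U' @ D"
      using pop S U U' by (auto simp: bracket_stack_snoc nth_append)
    \<comment> \<open>The letter popped is the rightmost unbracketed \<open>i + 1\<close>, so the
      leftmost one is unchanged, and while \<open>U'\<close> is nonempty the final height stays
      strictly above the minimum.\<close>
    have "lastmin G (last U') \<and> G (last U') = - int (length D)" if "U' \<noteq> []"
      using lU Ul h2' U' that by (auto simp: lastmin_def h pop neq_Nil_conv)
    moreover have "D \<noteq> [] \<longrightarrow> firstmin G (hd D) \<and> G (Suc (hd D)) = - int (length D)"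
      using hD Dl U' by (auto simp: firstmin_def h pop Suc_le_eq)
    moreover have "\<forall>t. - int (length D) \<le> G t" using m U' by (auto simp: h pop)
    moreover have "G (length ?c) = int (length U') - int (length D)" using U' by (simp add: h pop)
    ultimately show ?thesis using Uc Dc st U'
      by (intro ex[of U' D]) auto
  next
    case down
    have st: "bracket_stack i ?c = [] @ (length b # D)"
      using down S D by (cases D) (auto simp: bracket_stack_snoc nth_append)
    \<comment> \<open>With no \<open>i + 1\<close> left to pair, the new letter leads to a height
      smaller than all earlier ones.\<close>
    have "firstmin G (length b) \<and> G (Suc (length b)) = - int (length (length b # D))"
      using m down by (auto simp: firstmin_def h intro: less_le_trans[of _ "- int (length D)"])
    moreover have "\<forall>t. - int (length (length b # D)) \<le> G t"
    proof
      fix t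
      have "- int (length D) \<le> ht i b t" using m by blast
      then show "- int (length (length b # D)) \<le> G t" using down by (simp add: h)
    qed
    moreover have "G (length ?c) = int (length []) - int (length (length b # D))" using down by (simp add: h)
    moreover have "\<forall>p\<in>set (length b # D). p < length ?c \<and> ?c ! p = i" using Dc down by auto
    ultimately show ?thesis using st
      by (intro ex[of "[]" "length b # D"]) auto
  next
    case other
    then have st: "bracket_stack i ?c = U @ D" using S by (simp add: bracket_stack_snoc)
    have "G t = ht i b t" for t using other h h2' by auto
    then have heq: "G = ht i b" by blast
    show ?thesis
      using Uc Dc st m lU hD e h[of "length ?c"] other by (intro ex[of U D]) (auto simp: heq)
  qed
qed

lemma unbracketed_split:
  obtains U D where "unbracketed i b = rev D @ rev U"
    and "\<And>p. p \<in> set U \<Longrightarrow> b ! p = i + 1" and "\<And>p. p \<in> set D \<Longrightarrow> b ! p = i"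
    and "\<And>t. U = [] \<Longrightarrow> ht i b (length b) \<le> ht i b t"
    and "U \<noteq> [] \<Longrightarrow> lastmin (ht i b) (last U)"
    and "\<And>t. D = [] \<Longrightarrow> 0 \<le> ht i b t"
    and "D \<noteq> [] \<Longrightarrow> firstmin (ht i b) (hd D)"
proof -
  obtain U D where S: "bracket_stack i b = U @ D"
    and U: "\<forall>p\<in>set U. p < length b \<and> b ! p = i + 1"
    and D: "\<forall>p\<in>set D. p < length b \<and> b ! p = i"
    and e: "ht i b (length b) = int (length U) - int (length D)"
    and m: "\<forall>t. - int (length D) \<le> ht i b t"
    and lU: "U \<noteq> [] \<longrightarrow> lastmin (ht i b) (last U)"
    and hD: "D \<noteq> [] \<longrightarrow> firstmin (ht i b) (hd D)"
    using bracket_stack_split[of i b] by blast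
  have "unbracketed i b = rev D @ rev U"
    using S by (simp add: unbracketed_eq bracket_stack_def)
  moreover have "U = [] \<Longrightarrow> ht i b (length b) \<le> ht i b t" for t using e m by simp
  moreover have "D = [] \<Longrightarrow> 0 \<le> ht i b t" for t using m by simp
  ultimately show ?thesis using that U D lU hD by blast
qed

lemma lastmin_ht:
  assumes "lastmin (ht i b) p"
  shows "p < length b" "b ! p = i + 1" "ht i b (Suc p) = ht i b p + 1"
proof -
  have "ht i b p < ht i b (Suc p)" using assms by (simp add: lastmin_def)
  then show "p < length b" "b ! p = i + 1" "ht i b (Suc p) = ht i b p + 1"
    by (auto simp: ht_Suc split: if_splits)
qed

lemma firstmin_ht:
  assumes "firstmin (ht i b) p"
  shows "p < length b" "b ! p = i" "ht i b p = ht i b (Suc p) + 1"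
proof -
  have "ht i b (Suc p) < ht i b p" using assms by (simp add: firstmin_def)
  then show "p < length b" "b ! p = i" "ht i b p = ht i b (Suc p) + 1"
    by (auto simp: ht_Suc split: if_splits)
qed

text \<open>If no letter \<open>i + 1\<close> is unbracketed, the minimum persists to the end and
  \<open>lastmin\<close> fails everywhere; otherwise \<open>last U\<close> is the unique last
  minimum. The two cases exclude each other, which gives both equivalences.\<close>

lemma e_op_iff: "e_op i b = Some c \<longleftrightarrow> (\<exists>p. lastmin (ht i b) p \<and> c = b[p := i])"
  and e_op_None_iff: "e_op i b = None \<longleftrightarrow> (\<forall>t. ht i b (length b) \<le> ht i b t)"
proof -
  have no: "\<not> lastmin (ht i b) p" if "\<And>t. ht i b (length b) \<le> ht i b t" for p
    using that[of p] lastmin_ht(1)[of i b p] unfolding lastmin_def by (meson leD)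
  obtain U D where S: "unbracketed i b = rev D @ rev U"
    "\<And>p. p \<in> set U \<Longrightarrow> b ! p = i + 1" "\<And>p. p \<in> set D \<Longrightarrow> b ! p = i"
    "\<And>t. U = [] \<Longrightarrow> ht i b (length b) \<le> ht i b t" "U \<noteq> [] \<Longrightarrow> lastmin (ht i b) (last U)"
    by (rule unbracketed_split[of i b]) blast
  have "filter (\<lambda>p. b ! p = i + 1) (unbracketed i b) = rev U"
    using S by (simp add: filter_empty_conv cong: filter_cong)
  then have e: "e_op i b = (if U = [] then None else Some (b[last U := i]))"
    by (simp add: e_op_def hd_rev)
  then show "e_op i b = Some c \<longleftrightarrow> (\<exists>p. lastmin (ht i b) p \<and> c = b[p := i])"
    using S(4,5) no lastmin_unique by (cases "U = []") auto
  have "U = [] \<longleftrightarrow> (\<forall>t. ht i b (length b) \<le> ht i b t)"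
    using S(4,5) no by blast
  then show "e_op i b = None \<longleftrightarrow> (\<forall>t. ht i b (length b) \<le> ht i b t)" using e by simp
qed

lemma f_op_iff: "f_op i b = Some c \<longleftrightarrow> (\<exists>p. firstmin (ht i b) p \<and> c = b[p := i + 1])"
  and f_op_None_iff: "f_op i b = None \<longleftrightarrow> (\<forall>t. 0 \<le> ht i b t)"
proof -
  have no: "\<not> firstmin (ht i b) p" if "\<And>t. 0 \<le> ht i b t" for p
    using that[of "Suc p"] by (auto simp: firstmin_def dest: spec[of _ 0])
  obtain U D where S: "unbracketed i b = rev D @ rev U"
    "\<And>p. p \<in> set U \<Longrightarrow> b ! p = i + 1" "\<And>p. p \<in> set D \<Longrightarrow> b ! p = i"
    "\<And>t. D = [] \<Longrightarrow> 0 \<le> ht i b t" "D \<noteq> [] \<Longrightarrow> firstmin (ht i b) (hd D)"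
    by (rule unbracketed_split[of i b]) blast
  have "filter (\<lambda>p. b ! p = i) (unbracketed i b) = rev D"
    using S by (simp add: filter_empty_conv cong: filter_cong)
  then have f: "f_op i b = (if D = [] then None else Some (b[hd D := i + 1]))"
    by (simp add: f_op_def last_rev)
  then show "f_op i b = Some c \<longleftrightarrow> (\<exists>p. firstmin (ht i b) p \<and> c = b[p := i + 1])"
    using S(4,5) no firstmin_unique by (cases "D = []") auto
  have "D = [] \<longleftrightarrow> (\<forall>t. 0 \<le> ht i b t)"
    using S(4,5) no by blast
  then show "f_op i b = None \<longleftrightarrow> (\<forall>t. 0 \<le> ht i b t)" using f by simp
qed

text \<open>A letter \<open>i + 1\<close> counts positively in height \<open>i\<close> and
  negatively in height \<open>i + 1\<close>, a letter \<open>i\<close> positively in height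
  \<open>i - 1\<close> and negatively in height \<open>i\<close>. The differences are the Cartan
  integers.\<close>

lemma ht_update:
  assumes "p < length b" "b ! p = i + 1"
  shows "ht j (b[p := i]) t = ht j b t + cartan i j * step p t"
proof (induction t)
  case (Suc t)
  show ?case
    using assms Suc by (cases "t = p") (auto simp: ht_Suc cartan_def step_def)
qed (simp add: step_def)

lemma words_update: "b \<in> words n l \<Longrightarrow> x \<in> {1..n+1} \<Longrightarrow> b[p := x] \<in> words n l"
  using set_update_subset_insert[of b p x] by (auto simp: words_def)

lemma e_opI:
  assumes "lastmin (ht i b) p" "b \<in> words n l" "1 \<le> i" "i \<le> n"
  obtains c where "e_op i b = Some c" "c \<in> words n l"
    "\<And>j t. ht j c t = ht j b t + cartan i j * step p t"
proof
  show "e_op i b = Some (b[p := i])" using assms(1) e_op_iff by blast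
  show "b[p := i] \<in> words n l" using assms words_update by simp
  show "ht j (b[p := i]) t = ht j b t + cartan i j * step p t" for j t
    using ht_update lastmin_ht[OF assms(1)] by simp
qed

lemma e_opD:
  assumes "e_op i b = Some c" "b \<in> words n l" "1 \<le> i" "i \<le> n"
  obtains p where "lastmin (ht i b) p" "c \<in> words n l"
    "\<And>j t. ht j c t = ht j b t + cartan i j * step p t"
  using assms by (metis e_opI e_op_iff option.inject)

text \<open>Flipping at the last minimum \<open>p\<close> lowers height \<open>i\<close> by 2 beyond
  \<open>p\<close>, so the step at \<open>p\<close> becomes the one into the first minimum; the
  reverse flip restores the old picture.\<close>

lemma e_op_iff_f_op:
  assumes "b \<in> words n l" "c \<in> words n l"
  shows "e_op i b = Some c \<longleftrightarrow> f_op i c = Some b"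
proof
  assume "e_op i b = Some c"
  then obtain p where p: "lastmin (ht i b) p" "c = b[p := i]" using e_op_iff by blast
  note h = lastmin_ht[OF p(1)]
  have "ht i c t = ht i b t - 2 * step p t" for t
    using ht_update[OF h(1,2), of i t] p(2) by (simp add: cartan_def)
  then have "firstmin (ht i c) p"
    using p(1) h(3) by (auto simp: firstmin_def lastmin_def step_def)
  moreover have "b = c[p := i + 1]" using p(2) h by (metis list_update_id list_update_overwrite)
  ultimately show "f_op i c = Some b" using f_op_iff by blast
next
  assume "f_op i c = Some b"
  then obtain p where p: "firstmin (ht i c) p" "b = c[p := i + 1]" using f_op_iff by blast
  note h = firstmin_ht[OF p(1)]
  have c: "c = b[p := i]" using p(2) h by (metis list_update_id list_update_overwrite)
  have bp: "p < length b" "b ! p = i + 1" using p(2) h by simp_all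
  have b: "ht i b t = ht i c t + 2 * step p t" for t
    unfolding c using ht_update[OF bp, of i t] by (simp add: cartan_def)
  have "ht i c (Suc p) < ht i c t" if "t \<le> p" for t using p(1) that by (simp add: firstmin_def)
  moreover have "ht i c (Suc p) \<le> ht i c t" if "t > p" for t using p(1) that by (simp add: firstmin_def)
  ultimately have "lastmin (ht i b) p"
    using h(3) by (auto simp: lastmin_def step_def b) fastforce+
  then show "e_op i b = Some c" using c e_op_iff by blast
qed

lemma f_opI:
  assumes "firstmin (ht i b) p" "b \<in> words n l" "1 \<le> i" "i \<le> n"
  obtains c where "f_op i b = Some c" "c \<in> words n l"
    "\<And>j t. ht j c t = ht j b t - cartan i j * step p t"
proof -
  define c where "c = b[p := i + 1]"
  note h = firstmin_ht[OF assms(1)]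
  have f: "f_op i b = Some c" using assms(1) f_op_iff c_def by blast
  have c: "c \<in> words n l" using assms words_update c_def by simp
  have "b = c[p := i]" using h c_def by (metis list_update_id list_update_overwrite)
  then have "ht j b t = ht j c t + cartan i j * step p t" for j t
    using ht_update[of p c i j t] h c_def by simp
  then show ?thesis using that[OF f c] by simp
qed

lemma f_opD:
  assumes "f_op i b = Some c" "b \<in> words n l" "1 \<le> i" "i \<le> n"
  obtains p where "firstmin (ht i b) p" "c \<in> words n l"
    "\<And>j t. ht j c t = ht j b t - cartan i j * step p t"
  using assms by (metis f_opI f_op_iff option.inject)

lemma words_letter_pos:
  assumes "b \<in> words n l" "p < length b"
  shows "b ! p \<noteq> 0"
proof -
  have "b ! p \<in> {1..n+1}" using assms nth_mem[of p b] unfolding words_def by blast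
  then show ?thesis by simp
qed

text \<open>The letter at a position is \<open>x + 1\<close> for the index \<open>x\<close> whose
  height rises there; such an \<open>x\<close> exists because letters are positive. Later identities
  of words reduce to identities of heights.\<close>

lemma words_eqI:
  assumes "b \<in> words n l" "c \<in> words n l" "\<And>j t. ht j b t = ht j c t"
  shows "b = c"
proof (rule nth_equalityI)
  show l: "length b = length c" using assms by (simp add: words_def)
  fix p assume p: "p < length b"
  then obtain x where x: "b ! p = x + 1"
    using words_letter_pos[OF assms(1)] by (metis Suc_eq_plus1 not0_implies_Suc)
  have "ht x b (Suc p) = ht x b p + 1" using p x by (simp add: ht_Suc)
  then have "ht x c (Suc p) = ht x c p + 1" using assms(3) by simp
  then show "b ! p = c ! p" using x by (auto simp: ht_Suc split: if_splits)
qed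

subsection \<open>The odd operator\<close>

lemma f_neg_iff_nth:
  "f_neg b = Some c \<longleftrightarrow>
     (\<exists>s<length b. b ! s = 1 \<and> (\<forall>t<s. b ! t \<noteq> 1 \<and> b ! t \<noteq> 2) \<and> c = b[s := 2])"
proof (induction b arbitrary: c)
  case (Cons x b)
  consider "x = 1" | "x = 2" | "x \<noteq> 1" "x \<noteq> 2" by blast
  then show ?case
  proof cases
    case 3
    then have "f_neg (x # b) = Some c \<longleftrightarrow> (\<exists>c'. f_neg b = Some c' \<and> c = x # c')" by auto
    also have "\<dots> \<longleftrightarrow> (\<exists>s<length (x # b). (x # b) ! s = 1 \<and>
        (\<forall>t<s. (x # b) ! t \<noteq> 1 \<and> (x # b) ! t \<noteq> 2) \<and> c = (x # b)[s := 2])"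
      unfolding Cons.IH using 3
      by (simp add: Ex_less_Suc2 All_less_Suc2) blast
    finally show ?thesis .
  qed (auto simp: Ex_less_Suc2 All_less_Suc2)
qed simp

text \<open>Words have no letter 0, so height 0 counts the letters 1, and while it vanishes height 1
  counts the letters 2. Vanishing of both up to \<open>s\<close> thus says that no 1 or 2 precedes
  position \<open>s\<close>.\<close>

lemma f_neg_iff:
  assumes "b \<in> words n l"
  shows "f_neg b = Some c \<longleftrightarrow>
     (\<exists>s. (\<forall>t\<le>s. ht 0 b t = 0 \<and> ht 1 b t = 0) \<and> ht 0 b (Suc s) = 1 \<and> c = b[s := 2])"
proof -
  have "(s < length b \<and> b ! s = 1 \<and> (\<forall>t<s. b ! t \<noteq> 1 \<and> b ! t \<noteq> 2)) \<longleftrightarrow>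
     ((\<forall>t\<le>s. ht 0 b t = 0 \<and> ht 1 b t = 0) \<and> ht 0 b (Suc s) = 1)" (is "?L \<longleftrightarrow> ?R") for s
  proof
    assume L: ?L
    have "t \<le> s \<longrightarrow> ht 0 b t = 0 \<and> ht 1 b t = 0" for t
    proof (induction t)
      case (Suc t)
      then show ?case using L words_letter_pos[OF assms, of t]
        by (auto simp: ht_Suc Suc_le_eq dest: spec[of _ t])
    qed simp
    then show ?R using L by (auto simp: ht_Suc)
  next
    assume R: ?R
    then have s: "s < length b" "b ! s = 1" by (auto simp: ht_Suc split: if_splits)
    have "b ! t \<noteq> 1 \<and> b ! t \<noteq> 2" if "t < s" for t
    proof -
      have "ht 0 b (Suc t) = ht 0 b t" "ht 1 b (Suc t) = ht 1 b t" using R that by auto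
      then show ?thesis using that s by (auto simp: ht_Suc split: if_splits)
    qed
    then show ?L using s by blast
  qed
  then show ?thesis unfolding f_neg_iff_nth by blast
qed

lemma ht_f_neg:
  assumes "b \<in> words n l" "ht 0 b s = 0" "ht 0 b (Suc s) = 1" "n \<ge> 1"
  shows "b[s := 2] \<in> words n l" "ht j (b[s := 2]) t = ht j b t - cartan 1 j * step s t"
proof -
  have s: "s < length b" "b ! s = 1" using assms by (auto simp: ht_Suc split: if_splits)
  show "b[s := 2] \<in> words n l" using assms words_update by simp
  have "(b[s := 2])[s := 1] = b" using s by (metis list_update_id list_update_overwrite)
  then show "ht j (b[s := 2]) t = ht j b t - cartan 1 j * step s t"
    using ht_update[of s "b[s := 2]" 1 j t] s by simp
qed

lemma f_neg_D:
  assumes "f_neg b = Some c" "b \<in> words n l" "n \<ge> 1"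
  obtains s where "\<And>t. t \<le> s \<Longrightarrow> ht 0 b t = 0 \<and> ht 1 b t = 0" "ht 0 b (Suc s) = 1"
    "c \<in> words n l" "\<And>j t. ht j c t = ht j b t - cartan 1 j * step s t"
proof -
  obtain s where s: "\<forall>t\<le>s. ht 0 b t = 0 \<and> ht 1 b t = 0" "ht 0 b (Suc s) = 1" "c = b[s := 2]"
    using assms f_neg_iff by blast
  show ?thesis using s ht_f_neg[OF assms(2) _ s(2) assms(3)] by (intro that[of s]) auto
qed

lemma f_neg_I:
  assumes "b \<in> words n l" "n \<ge> 1" "\<And>t. t \<le> s \<Longrightarrow> ht 0 b t = 0 \<and> ht 1 b t = 0" "ht 0 b (Suc s) = 1"
  obtains c where "f_neg b = Some c" "c \<in> words n l"
    "\<And>j t. ht j c t = ht j b t - cartan 1 j * step s t"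
proof
  show "f_neg b = Some (b[s := 2])" using assms f_neg_iff by blast
  show "b[s := 2] \<in> words n l" "ht j (b[s := 2]) t = ht j b t - cartan 1 j * step s t" for j t
    using ht_f_neg[of b n l s] assms by auto
qed

lemma f_neg_f_neg: "f_neg b = Some c \<Longrightarrow> f_neg c = None"
proof (rule ccontr)
  assume b: "f_neg b = Some c" and "f_neg c \<noteq> None"
  then obtain d where c: "f_neg c = Some d" by blast
  obtain s where s: "s < length b" "\<forall>t<s. b ! t \<noteq> 1 \<and> b ! t \<noteq> 2" "c = b[s := 2]"
    using b f_neg_iff_nth by metis
  obtain t where t: "c ! t = 1" "\<forall>r<t. c ! r \<noteq> 1 \<and> c ! r \<noteq> 2"
    using c f_neg_iff_nth by metis
  show False using s t by (cases t s rule: linorder_cases) auto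
qed

text \<open>Since \<open>f_neg\<close> squares to zero, the maximum is taken over \<open>{0}\<close>
  or \<open>{0, 1}\<close>.\<close>

lemma phi_neg_eq_0_iff: "phi_neg b = 0 \<longleftrightarrow> f_neg b = None"
proof (cases "f_neg b")
  case None
  have "((\<lambda>x. Option.bind x f_neg) ^^ Suc k) (Some b) = None" for k
    using None by (induction k) auto
  then have "((\<lambda>x. Option.bind x f_neg) ^^ k) (Some b) \<noteq> None \<longleftrightarrow> k = 0" for k
    by (cases k) (auto simp del: funpow.simps)
  then show ?thesis using None by (simp add: phi_neg_def)
next
  case (Some c)
  have 2: "((\<lambda>x. Option.bind x f_neg) ^^ Suc (Suc k)) (Some b) = None" for k
    using Some f_neg_f_neg[OF Some] by (induction k) auto
  have 1: "((\<lambda>x. Option.bind x f_neg) ^^ Suc 0) (Some b) = Some c" using Some by simp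
  have "((\<lambda>x. Option.bind x f_neg) ^^ k) (Some b) \<noteq> None \<longleftrightarrow> k \<in> {0, 1}" for k
  proof (cases k)
    case (Suc k')
    then show ?thesis using 1 2 by (cases k') (auto simp del: funpow.simps)
  qed simp
  then have "{k. ((\<lambda>x. Option.bind x f_neg) ^^ k) (Some b) \<noteq> None} = {0, 1}" by blast
  then show ?thesis using Some by (simp add: phi_neg_def)
qed

section \<open>Products of raising operators\<close>

text \<open>The flips made by one product of raising operators, one at \<open>P i\<close> for each
  index in the range. Indices outside contribute 0, which takes care of the missing neighbours at
  both ends.\<close>

definition flips :: "nat \<Rightarrow> nat \<Rightarrow> (nat \<Rightarrow> nat) \<Rightarrow> nat \<Rightarrow> nat \<Rightarrow> int" where
  "flips a c P i t = (if a \<le> i \<and> i \<le> c then step (P i) t else 0)"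

text \<open>The change of the \<open>j\<close>-th height caused by flips \<open>i + 1\<close> to \<open>i\<close>, recorded for each \<open>i\<close> by \<open>D i\<close>.\<close>

definition shift :: "(nat \<Rightarrow> nat \<Rightarrow> int) \<Rightarrow> nat \<Rightarrow> nat \<Rightarrow> int" where
  "shift D j t = (if j = 0 then 0 else D (j - 1) t) - 2 * D j t + D (j + 1) t"

lemma e_prod_empty: "c < a \<Longrightarrow> e_prod a c x = x"
  by (simp add: e_prod_def)

lemma e_prod_step: "a \<le> c \<Longrightarrow> e_prod a c x = Option.bind (e_prod (Suc a) c x) (e_op a)"
  by (simp add: e_prod_def upt_conv_Cons del: upt_Suc)

lemma e_prod_step_right: "a \<le> Suc c \<Longrightarrow> e_prod a (Suc c) x = e_prod a c (Option.bind x (e_op (Suc c)))"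
  by (simp add: e_prod_def)

lemma flips_Suc_lower:
  "a \<le> c \<Longrightarrow> flips a c P i t = flips (Suc a) c P i t + (if i = a then step (P a) t else 0)"
  by (auto simp: flips_def)

lemma flips_Suc_upper:
  "a \<le> Suc c \<Longrightarrow> flips a (Suc c) P i t = flips a c P i t + (if i = Suc c then step (P (Suc c)) t else 0)"
  by (auto simp: flips_def)

lemma shift_Suc_lower:
  "a \<le> c \<Longrightarrow> shift (flips a c P) j t = shift (flips (Suc a) c P) j t + cartan a j * step (P a) t"
  by (auto simp: shift_def flips_Suc_lower cartan_def)

lemma shift_Suc_upper:
  "a \<le> Suc c \<Longrightarrow> shift (flips a (Suc c) P) j t =
     shift (flips a c P) j t + cartan (Suc c) j * step (P (Suc c)) t"
  by (auto simp: shift_def flips_Suc_upper cartan_def)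

lemma shift_empty: "c < a \<Longrightarrow> shift (flips a c P) j t = 0"
  by (auto simp: shift_def flips_def)

text \<open>When \<open>e_i\<close> is applied, exactly the flips of index \<open>i + 1\<close> to
  \<open>c\<close> have been made, and of these only the one of index \<open>i + 1\<close> affects
  height \<open>i\<close>. So each condition involves a single earlier flip.\<close>

lemma e_prodI:
  assumes "b \<in> words n l" "1 \<le> a" "c \<le> n"
    and "\<And>i. a \<le> i \<Longrightarrow> i \<le> c \<Longrightarrow> lastmin (\<lambda>t. ht i b t + flips a c P (i + 1) t) (P i)"
  shows "\<exists>d. d \<in> words n l \<and> e_prod a c (Some b) = Some d \<and>
     (\<forall>j t. ht j d t = ht j b t + shift (flips a c P) j t)"
  using assms(2,4)
proof (induction "Suc c - a" arbitrary: a)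
  case 0
  then show ?case using assms(1) by (auto simp: e_prod_empty shift_empty)
next
  case (Suc k)
  then have ac: "a \<le> c" by simp
  have "lastmin (\<lambda>t. ht i b t + flips (Suc a) c P (i + 1) t) (P i)" if "Suc a \<le> i" "i \<le> c" for i
    using Suc.prems(2)[of i] that by (simp add: flips_def)
  then obtain d where d: "d \<in> words n l" "e_prod (Suc a) c (Some b) = Some d"
    "\<And>j t. ht j d t = ht j b t + shift (flips (Suc a) c P) j t"
    using Suc.hyps(1)[of "Suc a"] Suc.hyps(2) Suc.prems(1) by fastforce
  have "ht a d = (\<lambda>t. ht a b t + flips a c P (a + 1) t)"
    by (auto simp: fun_eq_iff d(3) shift_def flips_def)
  then have "lastmin (ht a d) (P a)" using Suc.prems(2)[of a] ac by simp
  then obtain d' where d': "e_op a d = Some d'" "d' \<in> words n l"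
    "\<And>j t. ht j d' t = ht j d t + cartan a j * step (P a) t"
    using e_opI[of a d "P a" n l] d(1) Suc.prems(1) ac assms(3) by auto
  then show ?case using d ac by (auto simp: e_prod_step shift_Suc_lower)
qed

text \<open>Converse of \<open>e_prodI\<close>. It also records that the height rises by exactly 1
  at a flip: this is true for words, whereas \<open>lastmin\<close> alone only gives a rise of at
  least 1.\<close>

lemma e_prodD:
  assumes "b \<in> words n l" "1 \<le> a" "c \<le> n" "e_prod a c (Some b) = Some d"
  shows "d \<in> words n l \<and> (\<exists>P. (\<forall>j t. ht j d t = ht j b t + shift (flips a c P) j t) \<and>
     (\<forall>i. a \<le> i \<and> i \<le> c \<longrightarrow> lastmin (\<lambda>t. ht i b t + flips a c P (i + 1) t) (P i) \<and>
        ht i b (Suc (P i)) + flips a c P (i + 1) (Suc (P i)) =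
          ht i b (P i) + flips a c P (i + 1) (P i) + 1))"
  using assms(2,4)
proof (induction "Suc c - a" arbitrary: a d)
  case 0
  then show ?case using assms(1) by (auto simp: e_prod_empty shift_empty)
next
  case (Suc k)
  then have ac: "a \<le> c" by simp
  obtain d0 where d0: "e_prod (Suc a) c (Some b) = Some d0" "e_op a d0 = Some d"
    using Suc.prems(2) ac by (auto simp: e_prod_step bind_eq_Some_conv)
  then obtain P0 where P0: "d0 \<in> words n l"
    "\<And>j t. ht j d0 t = ht j b t + shift (flips (Suc a) c P0) j t"
    "\<And>i. Suc a \<le> i \<Longrightarrow> i \<le> c \<Longrightarrow> lastmin (\<lambda>t. ht i b t + flips (Suc a) c P0 (i + 1) t) (P0 i) \<and>
        ht i b (Suc (P0 i)) + flips (Suc a) c P0 (i + 1) (Suc (P0 i)) =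
          ht i b (P0 i) + flips (Suc a) c P0 (i + 1) (P0 i) + 1"
    using Suc.hyps(1)[of "Suc a" d0] Suc.hyps(2) Suc.prems(1) by fastforce
  obtain p where p: "lastmin (ht a d0) p" "d \<in> words n l"
    "\<And>j t. ht j d t = ht j d0 t + cartan a j * step p t"
    using e_opD[OF d0(2) P0(1)] Suc.prems(1) ac assms(3) by auto
  define P where "P = P0(a := p)"
  have f: "flips (Suc a) c P = flips (Suc a) c P0" by (auto simp: P_def flips_def fun_eq_iff)
  have fu: "flips a c P i = flips (Suc a) c P0 i" if "i > a" for i
    using that by (auto simp: P_def flips_def fun_eq_iff)
  have h: "ht a d0 = (\<lambda>t. ht a b t + flips a c P (a + 1) t)"
    by (auto simp: fun_eq_iff P0(2) shift_def flips_def P_def)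
  have "ht j d t = ht j b t + shift (flips a c P) j t" for j t
    by (simp add: p(3) P0(2) shift_Suc_lower[OF ac] f) (simp add: P_def)
  moreover have "lastmin (\<lambda>t. ht i b t + flips a c P (i + 1) t) (P i) \<and>
        ht i b (Suc (P i)) + flips a c P (i + 1) (Suc (P i)) =
          ht i b (P i) + flips a c P (i + 1) (P i) + 1" if "a \<le> i" "i \<le> c" for i
  proof (cases "i = a")
    case True
    have "lastmin (ht a d0) p \<and> ht a d0 (Suc p) = ht a d0 p + 1"
      using p(1) lastmin_ht by blast
    then show ?thesis unfolding h True by (simp add: P_def)
  next
    case False
    then show ?thesis using P0(3)[of i] that fu[of "i + 1"] by (simp add: P_def)
  qed
  ultimately show ?case using p(2) by blast
qed

text \<open>The product is inverted by lowering with \<open>f_a\<close> first and \<open>f_c\<close>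
  last. When \<open>f_i\<close> acts, only the flip of index \<open>i - 1\<close> has touched height
  \<open>i\<close>.\<close>

lemma f_runI:
  assumes "b \<in> words n l" "1 \<le> a" "c \<le> n"
    and "\<And>i. a \<le> i \<Longrightarrow> i \<le> c \<Longrightarrow>
      firstmin (\<lambda>t. ht i b t - (if i = a then 0 else step (P (i - 1)) t)) (P i)"
  shows "\<exists>d. d \<in> words n l \<and> e_prod a c (Some d) = Some b \<and>
     (\<forall>j t. ht j d t = ht j b t - shift (flips a c P) j t) \<and>
     (\<forall>i. a \<le> i \<and> i \<le> c \<longrightarrow> ht i b (P i) - (if i = a then 0 else step (P (i - 1)) (P i)) =
        ht i b (Suc (P i)) - (if i = a then 0 else step (P (i - 1)) (Suc (P i))) + 1)"
  using assms(3,4)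
proof (induction c)
  case 0
  then show ?case using assms(1,2) by (auto simp: e_prod_empty shift_empty)
next
  case (Suc c)
  show ?case
  proof (cases "a \<le> Suc c")
    case False
    then show ?thesis using assms(1) by (auto simp: e_prod_empty shift_empty)
  next
    case True
    obtain d where d: "d \<in> words n l" "e_prod a c (Some d) = Some b"
      "\<And>j t. ht j d t = ht j b t - shift (flips a c P) j t"
      and st: "\<And>i. a \<le> i \<Longrightarrow> i \<le> c \<Longrightarrow> ht i b (P i) - (if i = a then 0 else step (P (i - 1)) (P i)) =
        ht i b (Suc (P i)) - (if i = a then 0 else step (P (i - 1)) (Suc (P i))) + 1"
      using Suc by fastforce
    have h: "ht (Suc c) d = (\<lambda>t. ht (Suc c) b t - (if Suc c = a then 0 else step (P (Suc c - 1)) t))"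
      using True by (auto simp: fun_eq_iff d(3) shift_def flips_def)
    then have f: "firstmin (ht (Suc c) d) (P (Suc c))" using Suc.prems(2)[of "Suc c"] True by simp
    then obtain d' where d': "f_op (Suc c) d = Some d'" "d' \<in> words n l"
      "\<And>j t. ht j d' t = ht j d t - cartan (Suc c) j * step (P (Suc c)) t"
      using f_opI[of "Suc c" d "P (Suc c)" n l] d(1) Suc.prems(1) by auto
    have "e_op (Suc c) d' = Some d" using e_op_iff_f_op[OF d'(2) d(1)] d'(1) by simp
    then have "e_prod a (Suc c) (Some d') = Some b" using d(2) by (simp add: e_prod_step_right[OF True])
    moreover have "ht i b (P i) - (if i = a then 0 else step (P (i - 1)) (P i)) =
        ht i b (Suc (P i)) - (if i = a then 0 else step (P (i - 1)) (Suc (P i))) + 1"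
      if "a \<le> i" "i \<le> Suc c" for i
      using firstmin_ht(3)[OF f] st[of i] that unfolding h by (cases "i = Suc c") auto
    ultimately show ?thesis using d'(2,3) d(3) by (auto simp: shift_Suc_upper[OF True])
  qed
qed

lemma step_nonneg: "0 \<le> step p t"
  by (simp add: step_def)

lemma flips_nonneg: "0 \<le> flips a c P i t"
  by (simp add: flips_def step_nonneg)

lemma flips_0: "(a \<le> i \<Longrightarrow> i \<le> c \<Longrightarrow> t \<le> P i) \<Longrightarrow> flips a c P i t = 0"
  by (auto simp: flips_def step_def)

lemma flips_1: "a \<le> i \<Longrightarrow> i \<le> c \<Longrightarrow> P i < t \<Longrightarrow> flips a c P i t = 1"
  by (auto simp: flips_def step_def)

lemma flips_at_0 [simp]: "flips (Suc a) c P 0 t = 0"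
  by (simp add: flips_def)

lemma shift_pos: "1 \<le> i \<Longrightarrow> shift D i t = D (i - 1) t - 2 * D i t + D (i + 1) t"
  by (simp add: shift_def)

lemma lastmin_le: "lastmin F p \<Longrightarrow> F p \<le> F t"
  by (meson lastmin_def less_imp_le not_le)

lemma lastmin_less: "lastmin F p \<Longrightarrow> p < t \<Longrightarrow> F p < F t"
  by (simp add: lastmin_def)

lemma ht_0_nonneg: "b \<in> words n l \<Longrightarrow> 0 \<le> ht 0 b t"
proof (induction t)
  case (Suc t)
  then show ?case using words_letter_pos[of b n l t] by (auto simp: ht_Suc)
qed simp

section \<open>Two consecutive chains of flips\<close>

locale first_chain =
  fixes n l :: nat and v :: "nat list" and k :: nat and w :: "nat list" and p :: "nat \<Rightarrow> nat"
  assumes v_words: "v \<in> words n l"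
    and v_lowest: "1 \<le> i \<Longrightarrow> i \<le> n \<Longrightarrow> 0 \<le> ht i v t"
    and k: "1 \<le> k" "k \<le> n"
    and w_words: "w \<in> words n l"
    and w: "e_prod 1 k (Some v) = Some w"
    and ht_w: "ht j w t = ht j v t + shift (flips 1 k p) j t"
    and p_min: "1 \<le> i \<Longrightarrow> i \<le> k \<Longrightarrow> lastmin (\<lambda>t. ht i v t + flips 1 k p (i + 1) t) (p i)"
    and p_step: "1 \<le> i \<Longrightarrow> i \<le> k \<Longrightarrow> ht i v (Suc (p i)) + flips 1 k p (i + 1) (Suc (p i)) =
      ht i v (p i) + flips 1 k p (i + 1) (p i) + 1"
begin

abbreviation "H i t \<equiv> ht i v t"
abbreviation "Pf \<equiv> flips 1 k p"

text \<open>As \<open>v\<close> is lowest, both summands are nonnegative, and their sum starts at 0.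
  Hence its minimum is 0 and both vanish there.\<close>

lemma p_zero:
  assumes "1 \<le> i" "i \<le> k"
  shows "H i (p i) = 0" "Pf (i + 1) (p i) = 0"
proof -
  have "H i (p i) + Pf (i + 1) (p i) \<le> H i 0 + Pf (i + 1) 0"
    using lastmin_le[OF p_min[OF assms]] .
  also have "\<dots> = 0" by (simp add: flips_0)
  finally have "H i (p i) + Pf (i + 1) (p i) \<le> 0" .
  moreover have "0 \<le> H i (p i)" "0 \<le> Pf (i + 1) (p i)" using v_lowest assms k by (auto simp: flips_nonneg)
  ultimately show "H i (p i) = 0" "Pf (i + 1) (p i) = 0" by linarith+
qed

lemma p_after:
  assumes "1 \<le> i" "i \<le> k" "p i < t"
  shows "1 \<le> H i t + Pf (i + 1) t"
  using lastmin_less[OF p_min[OF assms(1,2)] assms(3)] p_zero[OF assms(1,2)] by simp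

lemma p_Suc:
  assumes "1 \<le> i" "i \<le> k"
  shows "H i (Suc (p i)) + Pf (i + 1) (Suc (p i)) = 1"
  using p_step[OF assms] p_zero[OF assms] by simp

text \<open>A flip of index \<open>i + 1\<close> before \<open>p i\<close> would make the indicator
  in \<open>p_zero\<close> equal to 1.\<close>

lemma p_le:
  assumes "1 \<le> i" "i < k"
  shows "p i \<le> p (i + 1)"
  using p_zero(2)[of i] assms flips_1[of 1 "i + 1" k p "p i"] by (cases "p (i + 1) < p i") auto

lemma p_mono:
  assumes "1 \<le> i" "i \<le> i'" "i' \<le> k"
  shows "p i \<le> p i'"
  using assms(2,3)
proof (induction i' rule: dec_induct)
  case (step i')
  then show ?case using p_le[of i'] assms(1) by simp
qed simp

text \<open>In words: \<open>v\<close> has no letter 1 or 2 before position \<open>p 1\<close>. This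
  one condition decides whether \<open>f_neg\<close> is nonzero, for \<open>w\<close> as well as for
  every \<open>g\<close>.\<close>

abbreviation odd_free :: bool where
  "odd_free \<equiv> \<forall>t\<le>p 1. H 0 t = 0 \<and> H 1 t = 0"

text \<open>Here \<open>D\<close> stands for flips beyond \<open>p 1\<close>: none for
  \<open>w\<close>, the second chain for \<open>g\<close>. The flip at \<open>p 1\<close> creates a
  letter 1. An earlier 1 with no 1 or 2 before it would make height 1 of \<open>v\<close> negative,
  so \<open>f_neg\<close> can act only at \<open>p 1\<close>, where it undoes that flip.\<close>

lemma f_neg_shifted:
  assumes x: "x \<in> words n l" "\<And>j t. ht j x t = H j t + shift Pf j t + shift D j t"
    and D: "\<And>i t. 0 \<le> D i t" "\<And>i t. t \<le> Suc (p 1) \<Longrightarrow> D i t = 0" "\<And>t. D 0 t = 0"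
  shows "f_neg x \<noteq> None \<longleftrightarrow> odd_free"
    and "f_neg x = Some y \<Longrightarrow> y \<in> words n l \<and>
      (\<forall>j t. ht j y t = H j t + shift (flips 2 k p) j t + shift D j t)"
proof -
  have n: "n \<ge> 1" using k by simp
  have Pz: "Pf i t = 0" if "t \<le> p 1" for i t
    using that p_mono[of 1 i] by (intro flips_0) auto
  have P2: "shift Pf j t = shift (flips 2 k p) j t + cartan 1 j * step (p 1) t" for j t
    using shift_Suc_lower[of 1 k p j t] k by (simp add: numeral_2_eq_2)
  have x0: "ht 0 x t = H 0 t" "ht 1 x t = H 1 t" if "t \<le> p 1" for t
    using that Pz D(2) by (simp_all add: x(2) shift_def)
  have x0': "ht 0 x (Suc (p 1)) = H 0 (Suc (p 1)) + 1"
    using k D(2) by (simp add: x(2) shift_def flips_1)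
  \<comment> \<open>A letter 1 read at height 0 would bring height 1 of \<open>v\<close> to -1,
    against lowest weight.\<close>
  have letter: "H 0 (Suc s) = H 0 s" if "H 1 s = 0" for s
  proof -
    have "0 \<le> H 1 (Suc s)" using v_lowest n by simp
    then show ?thesis using that words_letter_pos[OF v_words, of s] by (auto simp: ht_Suc split: if_splits)
  qed
  have char: "s = p 1 \<and> odd_free"
    if s: "\<And>t. t \<le> s \<Longrightarrow> ht 0 x t = 0 \<and> ht 1 x t = 0" "ht 0 x (Suc s) = 1" for s
  proof -
    have "s \<le> p 1"
    proof (rule ccontr)
      assume "\<not> s \<le> p 1"
      then have "ht 0 x (Suc (p 1)) = 0" using s(1) by simp
      then show False using x0' ht_0_nonneg[OF v_words, of "Suc (p 1)"] by simp
    qed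
    moreover have "\<not> s < p 1"
    proof
      assume "s < p 1"
      then have "H 0 (Suc s) = 1" "H 0 s = 0" "H 1 s = 0" using x0[of "Suc s"] x0[of s] s by auto
      then show False using letter[of s] by simp
    qed
    ultimately have "s = p 1" by simp
    then show ?thesis using s x0 by auto
  qed
  show "f_neg x \<noteq> None \<longleftrightarrow> odd_free"
  proof
    assume "f_neg x \<noteq> None"
    then obtain y where y: "f_neg x = Some y" by blast
    show odd_free
    proof (rule f_neg_D[OF y x(1) n])
      fix s assume "\<And>t. t \<le> s \<Longrightarrow> ht 0 x t = 0 \<and> ht 1 x t = 0" "ht 0 x (Suc s) = 1"
      then show odd_free using char by blast
    qed
  next
    assume o: odd_free
    have "ht 0 x (Suc (p 1)) = 1" using x0' letter[of "p 1"] o by simp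
    moreover have "ht 0 x t = 0 \<and> ht 1 x t = 0" if "t \<le> p 1" for t using o x0 that by simp
    ultimately show "f_neg x \<noteq> None" using f_neg_I[OF x(1) n, of "p 1"] by (metis option.discI)
  qed
  show "y \<in> words n l \<and> (\<forall>j t. ht j y t = H j t + shift (flips 2 k p) j t + shift D j t)"
    if y: "f_neg x = Some y"
  proof (rule f_neg_D[OF y x(1) n])
    fix s assume "\<And>t. t \<le> s \<Longrightarrow> ht 0 x t = 0 \<and> ht 1 x t = 0" "ht 0 x (Suc s) = 1"
      and y: "y \<in> words n l" "\<And>j t. ht j y t = ht j x t - cartan 1 j * step s t"
    then have "s = p 1" using char by blast
    then show ?thesis using y P2 by (simp add: x(2))
  qed
qed

lemma f_neg_w: "f_neg w \<noteq> None \<longleftrightarrow> odd_free"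
  using f_neg_shifted(1)[OF w_words, of "\<lambda>_ _. 0"] by (simp add: ht_w shift_def)

end

locale second_chain = first_chain +
  fixes j :: nat and g :: "nat list" and q :: "nat \<Rightarrow> nat"
  assumes j: "1 \<le> j" "j \<le> k"
    and g_words: "g \<in> words n l"
    and g: "e_prod 1 j (Some w) = Some g"
    and ht_g: "ht i g t = ht i w t + shift (flips 1 j q) i t"
    and q_min: "1 \<le> i \<Longrightarrow> i \<le> j \<Longrightarrow> lastmin (\<lambda>t. ht i w t + flips 1 j q (i + 1) t) (q i)"
    and q_step: "1 \<le> i \<Longrightarrow> i \<le> j \<Longrightarrow> ht i w (Suc (q i)) + flips 1 j q (i + 1) (Suc (q i)) =
      ht i w (q i) + flips 1 j q (i + 1) (q i) + 1"
begin

abbreviation "Qf \<equiv> flips 1 j q"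

text \<open>Induction down from \<open>j\<close>. The height minimised by \<open>e_i\<close> is
  nonnegative up to \<open>p i\<close>, and beyond \<open>p i\<close> it is bounded below by a
  constant that is attained at \<open>Suc (p i)\<close>. So the last minimum lies strictly beyond
  \<open>p i\<close> and has this value, from which the equations follow.\<close>

lemma q_facts:
  assumes "1 \<le> i" "i \<le> j"
  shows "p i < q i \<and> H i (q i) + Pf (i + 1) (q i) = 1 \<and> Qf (i + 1) (q i) = 0 \<and>
    (\<forall>t>q i. 2 \<le> H i t + Pf (i + 1) t + Qf (i + 1) t) \<and>
    H i (Suc (q i)) + Pf (i + 1) (Suc (q i)) + Qf (i + 1) (Suc (q i)) = 2" (is "?P i")
proof -
  have level: "?P i" if i: "1 \<le> i" "i \<le> j" and q1: "i < j \<Longrightarrow> p (i + 1) < q (i + 1)" for i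
  proof -
    define G where "G t = ht i w t + Qf (i + 1) t" for t
    \<comment> \<open>Beyond \<open>p i\<close>, height \<open>i\<close> has lost 2 by its own flip
      and regained 1 by the flip at \<open>p (i - 1)\<close>; for \<open>i = 1\<close> there is no
      such flip, hence the additional -1.\<close>
    define \<beta> :: int where "\<beta> = (if i = 1 then -1 else 0)"
    have ik: "i \<le> k" using i j by simp
    have G: "G t = H i t + Pf (i + 1) t + Qf (i + 1) t - 2 * Pf i t + Pf (i - 1) t" for t
      using i by (simp add: G_def ht_w shift_pos)
    have before: "0 \<le> G t" if "t \<le> p i" for t
    proof -
      have "Pf i t = 0" using that by (intro flips_0) auto
      then show ?thesis using v_lowest[of i t] i ik k flips_nonneg[of 1 k p "i + 1" t]
          flips_nonneg[of 1 j q "i + 1" t] flips_nonneg[of 1 k p "i - 1" t] by (simp add: G)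
    qed
    have after: "G t = H i t + Pf (i + 1) t + Qf (i + 1) t - 1 + \<beta>" if "p i < t" for t
    proof -
      have "Pf i t = 1" using that i ik by (intro flips_1) auto
      moreover have "Pf (i - 1) t = 1" if "i \<noteq> 1"
      proof -
        have "1 \<le> i - 1" using that i by arith
        then show ?thesis using \<open>p i < t\<close> ik p_mono[of "i - 1" i] by (intro flips_1) auto
      qed
      ultimately show ?thesis by (cases "i = 1") (auto simp: G \<beta>_def)
    qed
    \<comment> \<open>For \<open>i < j\<close> the flip at \<open>q (i + 1)\<close> lies beyond
      \<open>p (i + 1)\<close>, hence beyond \<open>p i\<close>; for \<open>i = j\<close> there is
      none.\<close>
    have "Qf (i + 1) (Suc (p i)) = 0"
      using q1 p_mono[of i "i + 1"] i j by (intro flips_0) auto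
    then have "G (Suc (p i)) = \<beta>" using after[of "Suc (p i)"] p_Suc[OF i(1) ik] by simp
    moreover have ge: "\<beta> \<le> G t" for t
      using before[of t] after[of t] p_after[OF i(1) ik, of t] flips_nonneg[of 1 j q "i + 1" t]
      by (cases "t \<le> p i") (auto simp: \<beta>_def)
    moreover have G': "G = (\<lambda>t. ht i w t + Qf (i + 1) t)" by (auto simp: G_def)
    moreover have "lastmin G (q i)" unfolding G' by (rule q_min[OF i])
    moreover have less: "G (q i) < G t" if "q i < t" for t
      using lastmin_less q_min[OF i] that unfolding G' by blast
    ultimately have "G (q i) \<le> \<beta>" "Suc (p i) \<le> q i"
      using lastmin_le[of G "q i" "Suc (p i)"] by (simp, metis not_less leD)
    then have b: "G (q i) = \<beta>" and pq: "p i < q i" using ge[of "q i"] by auto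
    have e: "H i (q i) + Pf (i + 1) (q i) + Qf (i + 1) (q i) = 1" using b after[OF pq] by simp
    moreover have "Qf (i + 1) (q i) = 0"
      using e p_after[OF i(1) ik pq] flips_nonneg[of 1 j q "i + 1" "q i"] by linarith
    moreover have "2 \<le> H i t + Pf (i + 1) t + Qf (i + 1) t" if "q i < t" for t
      using less[OF that] b after[of t] pq that by simp
    moreover have "G (Suc (q i)) = G (q i) + 1" using q_step[OF i] by (simp add: G_def)
    then have "H i (Suc (q i)) + Pf (i + 1) (Suc (q i)) + Qf (i + 1) (Suc (q i)) = 2"
      using b after[of "Suc (q i)"] pq by simp
    ultimately show ?thesis using pq by simp
  qed
  show ?thesis
    using assms(2,1)
  proof (induction i rule: inc_induct)
    case base
    then show ?case using level[of j] by simp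
  next
    case (step i)
    then show ?case using level[of i] by simp
  qed
qed

lemma p_less_q: "1 \<le> i \<Longrightarrow> i \<le> j \<Longrightarrow> p i < q i"
  and q_one: "1 \<le> i \<Longrightarrow> i \<le> j \<Longrightarrow> H i (q i) + Pf (i + 1) (q i) = 1"
  and q_after: "1 \<le> i \<Longrightarrow> i \<le> j \<Longrightarrow> q i < t \<Longrightarrow> 2 \<le> H i t + Pf (i + 1) t + Qf (i + 1) t"
  and q_Suc: "1 \<le> i \<Longrightarrow> i \<le> j \<Longrightarrow> H i (Suc (q i)) + Pf (i + 1) (Suc (q i)) + Qf (i + 1) (Suc (q i)) = 2"
  using q_facts by blast+

lemma q_le:
  assumes "1 \<le> i" "i < j"
  shows "q i \<le> q (i + 1)"
  using q_facts[of i] assms flips_1[of 1 "i + 1" j q "q i"] by (cases "q (i + 1) < q i") auto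

lemma q_mono:
  assumes "1 \<le> i" "i \<le> i'" "i' \<le> j"
  shows "q i \<le> q i'"
  using assms(2,3)
proof (induction i' rule: dec_induct)
  case (step i')
  then show ?case using q_le[of i'] assms(1) by simp
qed simp

text \<open>Each \<open>q i\<close> lies beyond \<open>p i\<close>, hence beyond \<open>p 1\<close>,
  so the second chain is an admissible \<open>D\<close> in \<open>f_neg_shifted\<close>.\<close>

lemma
  shows f_neg_g: "f_neg g \<noteq> None \<longleftrightarrow> odd_free"
    and ht_f_neg_g: "f_neg g = Some y \<Longrightarrow> y \<in> words n l \<and>
      (\<forall>i t. ht i y t = H i t + shift (flips 2 k p) i t + shift Qf i t)"
proof -
  have 1: "ht i g t = H i t + shift Pf i t + shift Qf i t" for i t by (simp add: ht_g ht_w)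
  have 2: "Qf i t = 0" if "t \<le> Suc (p 1)" for i t
  proof (rule flips_0)
    assume "1 \<le> i" "i \<le> j"
    then show "t \<le> q i" using that p_less_q[of i] p_mono[of 1 i] j by simp
  qed
  have 3: "Qf 0 t = 0" for t by (simp add: flips_def)
  show "f_neg g \<noteq> None \<longleftrightarrow> odd_free"
    by (rule f_neg_shifted(1)[OF g_words 1 flips_nonneg 2 3])
  show "f_neg g = Some y \<Longrightarrow> y \<in> words n l \<and>
      (\<forall>i t. ht i y t = H i t + shift (flips 2 k p) i t + shift Qf i t)"
    by (rule f_neg_shifted(2)[OF g_words 1 flips_nonneg 2 3])
qed

end

lemma lastminI: "(\<And>t. t \<le> p \<Longrightarrow> F p \<le> F t) \<Longrightarrow> (\<And>t. p < t \<Longrightarrow> F p < F t) \<Longrightarrow> lastmin F p"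
  by (simp add: lastmin_def)

lemma firstminI:
  "(\<And>t. t \<le> p \<Longrightarrow> F (Suc p) < F t) \<Longrightarrow> (\<And>t. p < t \<Longrightarrow> F (Suc p) \<le> F t) \<Longrightarrow> firstmin F p"
  by (simp add: firstmin_def)

lemma flips_le_1: "flips a c P i t \<le> 1"
  by (simp add: flips_def step_def)

section \<open>The image of \<open>g\<close> under the odd operator: transversal chains and
  turns\<close>

context second_chain
begin

abbreviation "P2f \<equiv> flips 2 k p"

lemma P2f: "P2f i t = (if i = 1 then 0 else Pf i t)"
  by (auto simp: flips_def)

lemma v_nonneg: "1 \<le> i \<Longrightarrow> i \<le> k \<Longrightarrow> 0 \<le> H i t"
  using v_lowest k by simp

text \<open>With \<open>q i\<close> beyond \<open>p (i + 1)\<close>, \<open>q_one\<close> becomes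
  \<open>H i (q i) = 0\<close>, so the flips \<open>q i\<close> sit at last minima already in
  \<open>v\<close>; afterwards the flips \<open>p 2\<close> to \<open>p k\<close> are still
  available. Both orders make the same flips and so give the same heights.\<close>

lemma f_neg_g_transversal:
  assumes y: "f_neg g = Some y"
    and B: "\<And>i. 1 \<le> i \<Longrightarrow> i \<le> j \<Longrightarrow> i < k \<and> p (i + 1) < q i"
  shows "e_prod 2 k (e_prod 1 j (Some v)) = Some y"
proof -
  note y = ht_f_neg_g[OF y]
  have H0: "H i (q i) = 0" if i: "1 \<le> i" "i \<le> j" for i
    using q_one[OF i] B[OF i] flips_1[of 1 "i + 1" k p "q i"] by simp
  have Hpos: "1 \<le> H i t + Qf (i + 1) t" if i: "1 \<le> i" "i \<le> j" "q i < t" for i t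
    using q_after[OF i] flips_le_1[of 1 k p "i + 1" t] by linarith
  have "lastmin (\<lambda>t. H i t + Qf (i + 1) t) (q i)" if i: "1 \<le> i" "i \<le> j" for i
  proof (rule lastminI)
    have 0: "H i (q i) + Qf (i + 1) (q i) = 0" using H0[OF i] q_facts[OF i] by simp
    show "H i (q i) + Qf (i + 1) (q i) \<le> H i t + Qf (i + 1) t" for t
      unfolding 0 using v_nonneg[of i t] flips_nonneg[of 1 j q "i + 1" t] i j by linarith
    show "H i (q i) + Qf (i + 1) (q i) < H i t + Qf (i + 1) t" if "q i < t" for t
      unfolding 0 using Hpos[OF i that] by linarith
  qed
  then obtain d where d: "d \<in> words n l" "e_prod 1 j (Some v) = Some d"
    "\<And>i t. ht i d t = H i t + shift Qf i t"
    using e_prodI[OF v_words, of 1 j q] j k by auto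
  have "lastmin (\<lambda>t. ht i d t + P2f (i + 1) t) (p i)" if i: "2 \<le> i" "i \<le> k" for i
  proof -
    have i1: "1 \<le> i" "1 \<le> i - 1" using i by auto
    have G: "ht i d t + P2f (i + 1) t = H i t + Pf (i + 1) t + Qf (i - 1) t - 2 * Qf i t + Qf (i + 1) t" for t
      using i by (simp add: d(3) shift_pos P2f)
    have Q0: "Qf i' t = 0" if "t \<le> p i" "i' \<in> {i - 1, i, i + 1}" for i' t
    proof (rule flips_0)
      assume i': "1 \<le> i'" "i' \<le> j"
      have "p i \<le> q i'"
      proof (cases "i' = i - 1")
        case True
        then show ?thesis using B[OF i'] i1 by simp
      next
        case False
        then show ?thesis using p_less_q[OF i'] p_mono[of i i'] that(2) i1(1) i' j by auto
      qed
      then show "t \<le> q i'" using that by simp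
    qed
    show ?thesis
    proof (rule lastminI)
      have 0: "ht i d (p i) + P2f (i + 1) (p i) = 0"
        unfolding G using Q0[of "p i"] p_zero[OF i1(1) i(2)] by simp
      show "ht i d (p i) + P2f (i + 1) (p i) \<le> ht i d t + P2f (i + 1) t" if "t \<le> p i" for t
        unfolding 0 unfolding G using Q0[OF that] v_nonneg[OF i1(1) i(2), of t] flips_nonneg[of 1 k p "i + 1" t] by simp
      show "ht i d (p i) + P2f (i + 1) (p i) < ht i d t + P2f (i + 1) t" if "p i < t" for t
      \<comment> \<open>Beyond \<open>q i\<close> the loss of 2 is made up by
        \<open>q_after\<close>, and the flip at \<open>q (i - 1)\<close> adds 1, so the value is
        positive.\<close>
      proof (cases "i \<le> j \<and> q i < t")
        case True
        then have "Qf (i - 1) t = 1" using q_mono[of "i - 1" i] i1 by (intro flips_1) auto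
        then show ?thesis unfolding 0 unfolding G
          using q_after[OF i1(1), of t] True flips_le_1[of 1 j q i t] by simp
      next
        case False
        then have "Qf i t = 0" by (intro flips_0) auto
        then show ?thesis unfolding 0 unfolding G
          using p_after[OF i1(1) i(2) that] flips_nonneg[of 1 j q "i - 1" t] flips_nonneg[of 1 j q "i + 1" t] by simp
      qed
    qed
  qed
  then obtain y' where y': "y' \<in> words n l" "e_prod 2 k (Some d) = Some y'"
    "\<And>i t. ht i y' t = ht i d t + shift P2f i t"
    using e_prodI[OF d(1), of 2 k p] k by auto
  have "y' = y" using y' y d(3) by (intro words_eqI[of _ n l]) auto
  then show ?thesis using y' d by simp
qed

text \<open>With the flip at \<open>p 1\<close> undone, only the one at \<open>q 1\<close> lowers
  height 1, and \<open>q_after\<close> provides the 2 units lost. This is the contradiction aimed at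
  in \<open>descent_less\<close>.\<close>

lemma ht_1_f_neg_g:
  assumes "f_neg g = Some y"
  shows "0 \<le> ht 1 y t"
proof -
  have e: "ht 1 y t = H 1 t + Pf 2 t + Qf 2 t - 2 * Qf 1 t"
    using ht_f_neg_g[OF assms] by (simp add: shift_pos P2f flips_def numeral_2_eq_2)
  show ?thesis
  proof (cases "q 1 < t")
    case True
    then show ?thesis using q_after[of 1 t] j flips_le_1[of 1 j q 1 t] e by (simp add: numeral_2_eq_2)
  next
    case False
    then have "Qf 1 t = 0" by (intro flips_0) auto
    then show ?thesis unfolding e
      using v_nonneg[of 1 t] k flips_nonneg[of 1 k p 2 t] flips_nonneg[of 1 j q 2 t] by simp
  qed
qed

definition spliced :: "nat \<Rightarrow> nat \<Rightarrow> nat" where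
  "spliced m i = (if i \<le> m then q i else p i)"

abbreviation "Sf m \<equiv> flips 1 k (spliced m)"

lemma Sf: "m \<le> j \<Longrightarrow> Sf m i t = (if i \<le> m then Qf i t else Pf i t)"
  using j by (auto simp: flips_def spliced_def)

text \<open>The least index \<open>m\<close> such that \<open>q m\<close> does not lie beyond \<open>p (m + 1)\<close>, where \<open>p (k + 1)\<close> counts as infinite.\<close>

definition turn :: "nat \<Rightarrow> bool" where
  "turn m \<longleftrightarrow> 1 \<le> m \<and> m \<le> j \<and> (m = k \<or> q m \<le> p (m + 1)) \<and> (\<forall>i. 1 \<le> i \<and> i < m \<longrightarrow> p (i + 1) < q i)"

text \<open>The flips leading to \<open>y\<close> are those at \<open>p 2\<close> to
  \<open>p k\<close> and \<open>q 1\<close> to \<open>q j\<close>. Lowering with \<open>f_2\<close>,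
  ..., \<open>f_j\<close> undoes the ones at \<open>p 2\<close> to \<open>p m\<close> and
  \<open>q (m + 1)\<close> to \<open>q j\<close>, given by \<open>b\<close>, and leaves the spliced
  ones.\<close>

lemma f_neg_g_turn:
  assumes y: "f_neg g = Some y" and m: "turn m"
  shows "\<exists>Y. Y \<in> words n l \<and> e_prod 2 j (Some Y) = Some y \<and>
    (\<forall>i t. ht i Y t = H i t + shift (Sf m) i t)"
proof -
  note y = ht_f_neg_g[OF y]
  have m1: "1 \<le> m" "m \<le> j" and A: "m = k \<or> q m \<le> p (m + 1)"
    and B: "\<And>i. 1 \<le> i \<Longrightarrow> i < m \<Longrightarrow> p (i + 1) < q i"
    using m by (auto simp: turn_def)
  define b where "b i = (if i \<le> m then p i else q i)" for i
  have "firstmin (\<lambda>t. ht i y t - (if i = 2 then 0 else step (b (i - 1)) t)) (b i)" if i: "2 \<le> i" "i \<le> j" for i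
  proof -
    have i1: "1 \<le> i" "1 \<le> i - 1" "i - 1 \<le> j" "i \<le> k" using i j by auto
    define K where "K t = ht i y t - (if i = 2 then 0 else step (b (i - 1)) t)" for t
    have bb: "(if i = 2 then 0 else step (b (i - 1)) t) =
      (if i = 2 then 0 else if i - 1 \<le> m then Pf (i - 1) t else Qf (i - 1) t)" for t
      using i i1 j by (auto simp: b_def flips_def)
    have K: "K t = H i t + Pf (i + 1) t + Qf (i + 1) t - 2 * Pf i t - 2 * Qf i t +
      (if i - 1 \<le> m then Qf (i - 1) t else Pf (i - 1) t)" for t
      unfolding K_def bb using y i m1 by (auto simp: shift_pos P2f)
    have P0: "Pf i t = 0" if "t \<le> p i" for t using that by (intro flips_0) auto
    have P1: "Pf i t = 1" if "p i < t" for t using that i1 by (intro flips_1) auto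
    have Q0: "Qf i t = 0" if "t \<le> q i" for t using that by (intro flips_0) auto
    have Q1: "Qf i t = 1" if "q i < t" for t using that i i1 by (intro flips_1) auto
    have pq: "p i < q i" using p_less_q i1 i by simp
    have nn: "0 \<le> H i t" "0 \<le> Pf i' t" "0 \<le> Qf i' t" for t i'
      using v_nonneg i1 flips_nonneg by auto
    have before: "0 \<le> K t" if "t \<le> p i" for t
      unfolding K using that P0[of t] Q0[of t] pq nn(1)[of t] nn(2)[of "i + 1" t] nn(3)[of "i + 1" t]
        nn(2)[of "i - 1" t] nn(3)[of "i - 1" t] by auto
    \<comment> \<open>The condition on \<open>q m\<close> in \<open>turn\<close> enters here: for
      \<open>i = m + 1\<close> the flip at \<open>q m\<close> already counts beyond
      \<open>p i\<close>.\<close>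
    have prev: "(if i - 1 \<le> m then Qf (i - 1) t else Pf (i - 1) t) = 1" if "q i < t \<or> (m < i \<and> p i < t)" for t
    proof (cases "i - 1 \<le> m")
      case True
      have "q (i - 1) < t"
      proof (cases "q i < t")
        case False
        then have "i = m + 1" "p i < t" using True that by auto
        then show ?thesis using A i1 by auto
      qed (use q_mono[of "i - 1" i] i1 i in simp)
      then show ?thesis using True i1 by (auto intro: flips_1)
    next
      case False
      have "p (i - 1) < t" using that p_mono[of "i - 1" i] i1 pq by auto
      then show ?thesis using False i1 j by (auto intro: flips_1)
    qed
    have last: "-1 \<le> K t" if "q i < t" for t
      unfolding K using prev[of t] that q_after[OF i1(1) i(2) that] P1[of t] Q1[of t] pq by auto
    show ?thesis unfolding K_def[symmetric]
    proof (cases "i \<le> m")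
      case True
      have prev0: "(if i - 1 \<le> m then Qf (i - 1) t else Pf (i - 1) t) = Qf (i - 1) t" for t
        using True by simp
      \<comment> \<open>For \<open>i \<le> m\<close> the flip at \<open>q (i - 1)\<close> lies
        beyond \<open>p i\<close> and does not yet compensate, so the value -1 is reached right
        after \<open>p i\<close>.\<close>
      have "Qf (i + 1) (Suc (p i)) = 0"
        using p_less_q[of "i + 1"] p_mono[of i "i + 1"] i1 j by (intro flips_0) auto
      moreover have "Qf (i - 1) (Suc (p i)) = 0"
      proof (rule flips_0)
        have "i - 1 < m" using True i1 by arith
        then show "Suc (p i) \<le> q (i - 1)" using B[of "i - 1"] i1 by simp
      qed
      ultimately have K1: "K (Suc (p i)) = -1"
        unfolding K prev0 using P1[of "Suc (p i)"] Q0[of "Suc (p i)"] pq p_Suc[OF i1(1) i1(4)] by auto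
      show "firstmin K (b i)"
      proof (rule firstminI)
        show "K (Suc (b i)) < K t" if "t \<le> b i" for t
          using before[of t] that K1 True by (simp add: b_def)
        show "K (Suc (b i)) \<le> K t" if "b i < t" for t
        proof (cases "q i < t")
          case False
          then show ?thesis using K1 True that P1[of t] Q0[of t] p_after[OF i1(1) i1(4), of t]
              nn(3)[of "i + 1" t] nn(3)[of "i - 1" t] unfolding b_def K prev0 by simp
        qed (use last K1 True in \<open>simp add: b_def\<close>)
      qed
    next
      case False
      \<comment> \<open>For \<open>i > m\<close> the term in \<open>prev\<close> compensates between
        \<open>p i\<close> and \<open>q i\<close>, so -1 first occurs right after
        \<open>q i\<close>.\<close>
      have K1: "K (Suc (q i)) = -1"
        unfolding K using prev[of "Suc (q i)"] q_Suc[OF i1(1) i(2)] P1[of "Suc (q i)"] Q1[of "Suc (q i)"] pq by simp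
      show "firstmin K (b i)"
      proof (rule firstminI)
        show "K (Suc (b i)) < K t" if "t \<le> b i" for t
        proof (cases "t \<le> p i")
          case True
          then show ?thesis using before[of t] K1 False by (simp add: b_def)
        next
          case t: False
          have "0 \<le> K t" unfolding K
            using t that False prev[of t] P1[of t] Q0[of t] p_after[OF i1(1) i1(4), of t] nn(3)[of "i + 1" t]
            by (simp add: b_def)
          then show ?thesis using K1 False by (simp add: b_def)
        qed
        show "K (Suc (b i)) \<le> K t" if "b i < t" for t
          using last[of t] that K1 False by (simp add: b_def)
      qed
    qed
  qed
  then obtain Y where Y: "Y \<in> words n l" "e_prod 2 j (Some Y) = Some y"
    "\<And>i t. ht i Y t = ht i y t - shift (flips 2 j b) i t"
    using f_runI[of y n l 2 j b] y j k by auto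
  have "P2f i t + Qf i t = Sf m i t + flips 2 j b i t" for i t
    using m1 j by (auto simp: flips_def b_def spliced_def)
  then have Pe: "P2f i t = Sf m i t + flips 2 j b i t - Qf i t" for i t by (simp add: algebra_simps)
  have "ht i Y t = H i t + shift (Sf m) i t" for i t
    using y by (simp add: Y(3) shift_def Pe)
  then show ?thesis using Y by blast
qed

lemma splice_le:
  assumes m: "turn m" and i: "1 \<le> i" "i < k"
  shows "spliced m i \<le> spliced m (i + 1)"
proof -
  have m1: "m \<le> j" and A: "m = k \<or> q m \<le> p (m + 1)"
    using m by (auto simp: turn_def)
  consider "i < m" | "i = m" | "m < i" by linarith
  then show ?thesis
  proof cases
    case 1
    then show ?thesis using q_le[of i] i m1 by (simp add: spliced_def)
  next
    case 2
    then show ?thesis using A i by (auto simp: spliced_def)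
  next
    case 3
    then show ?thesis using p_le[of i] i by (simp add: spliced_def)
  qed
qed

text \<open>Beyond a spliced flip, its loss of 2 is covered by the preceding flip, absent for
  \<open>i = 1\<close>, together with \<open>q_after\<close> or \<open>p_after\<close>. Hence on the
  spliced word only \<open>f_1\<close> can act, and at most once.\<close>

lemma splice_nonneg:
  assumes m: "turn m" and i: "1 \<le> i" "i \<le> n"
  shows "(if i = 1 then -1 else 0) \<le> H i t + shift (Sf m) i t"
proof -
  have m1: "m \<le> j" and B: "\<And>i. 1 \<le> i \<Longrightarrow> i < m \<Longrightarrow> p (i + 1) < q i"
    using m by (auto simp: turn_def)
  have e: "H i t + shift (Sf m) i t = H i t + Sf m (i - 1) t - 2 * Sf m i t + Sf m (i + 1) t"
    using i by (simp add: shift_pos)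
  have S0: "0 \<le> Sf m i' t" for i' by (rule flips_nonneg)
  show ?thesis
  proof (cases "Sf m i t = 0")
    case True
    then have "0 \<le> H i t + shift (Sf m) i t" unfolding e using v_lowest[OF i, of t] S0[of "i - 1"] S0[of "i + 1"] by simp
    then show ?thesis by (rule order_trans[rotated]) simp
  next
    case False
    then have ik: "i \<le> k" and lt: "spliced m i < t" by (auto simp: flips_def step_def split: if_splits)
    have Si: "Sf m i t = 1" using ik lt i by (intro flips_1) auto
    have prev: "Sf m (i - 1) t = (if i = 1 then 0 else 1)"
    proof (cases "i = 1")
      case False
      then have i1: "1 \<le> i - 1" using i by arith
      have "spliced m (i - 1) \<le> spliced m i" using splice_le[OF m, of "i - 1"] i1 ik by simp
      then show ?thesis using False i1 ik lt by (auto intro: flips_1)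
    qed (simp add: flips_def)
    have "1 \<le> H i t + Sf m (i + 1) t"
    proof (cases "i < m")
      case True
      then have qi: "q i < t" and ij: "i \<le> j" using lt m1 by (auto simp: spliced_def)
      have "Pf (i + 1) t = 1" using B[OF i(1) True] qi True m1 j by (intro flips_1) auto
      then show ?thesis using q_after[OF i(1) ij qi] True Sf[OF m1, of "i + 1" t] by simp
    next
      case False
      have "p i < t" using lt p_less_q[OF i(1)] False m1 by (cases "i \<le> m") (auto simp: spliced_def)
      then show ?thesis using p_after[OF i(1) ik] False Sf[OF m1, of "i + 1" t] by simp
    qed
    then show ?thesis unfolding e Si prev by (cases "i = 1") simp_all
  qed
qed

end

section \<open>Descending to a lowest weight element\<close>

text \<open>
  The positions \<open>c 1 \<le> \<dots> \<le> c h\<close> at which \<open>f\<^sub>1, f\<^sub>2, \<dots>\<close> act successively on \<open>b\<close>, continued as long as possible.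
\<close>

definition descent :: "nat \<Rightarrow> nat list \<Rightarrow> nat \<Rightarrow> (nat \<Rightarrow> nat) \<Rightarrow> bool" where
  "descent n b h c \<longleftrightarrow> 1 \<le> h \<and> h \<le> n \<and> firstmin (ht 1 b) (c 1) \<and>
     (\<forall>i. 2 \<le> i \<and> i \<le> h \<longrightarrow> firstmin (\<lambda>t. ht i b t - step (c (i - 1)) t) (c i) \<and>
        ht i b (Suc (c i)) = 0 \<and> c (i - 1) \<le> c i) \<and>
     (h < n \<longrightarrow> (\<forall>t>c h. 1 \<le> ht (h + 1) b t))"

text \<open>\<open>M\<close> is the depth of height 1, equal to 1 or 2 in the applications. Lowering
  with \<open>f_h\<close> at \<open>c h\<close> turns a zero of height \<open>h + 1\<close> beyond
  \<open>c h\<close> into -1, so the next position is the letter before the first such zero; if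
  there is none, the descent ends at \<open>h\<close>.\<close>

lemma descent_exists:
  assumes b: "\<And>i t. 2 \<le> i \<Longrightarrow> i \<le> n \<Longrightarrow> 0 \<le> ht i b t"
    and M: "1 \<le> M" "\<And>t. - M \<le> ht 1 b t" "\<exists>t. ht 1 b t = - M" and n: "1 \<le> n"
  shows "\<exists>h c. descent n b h c \<and> ht 1 b (Suc (c 1)) = - M"
proof -
  define t0 where "t0 = (LEAST t. ht 1 b t = - M)"
  have t0: "ht 1 b t0 = - M" unfolding t0_def using M(3) by (rule LeastI_ex)
  have t0': "- M < ht 1 b t" if "t < t0" for t
    using not_less_Least[OF that[unfolded t0_def]] M(2)[of t] by linarith
  have "t0 \<noteq> 0" using t0 M(1) by (intro notI) simp
  then obtain c1 where c1: "t0 = Suc c1" by (cases t0) auto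
  have f1: "firstmin (ht 1 b) c1" "ht 1 b (Suc c1) = - M"
    using t0 t0' M(2) c1 by (auto intro!: firstminI)
  \<comment> \<open>Induction on the number \<open>m\<close> of levels examined; the descent may
    have stopped below \<open>m\<close>.\<close>
  have "\<exists>h c. 1 \<le> h \<and> h \<le> m \<and> c 1 = c1 \<and>
     (\<forall>i. 2 \<le> i \<and> i \<le> h \<longrightarrow> firstmin (\<lambda>t. ht i b t - step (c (i - 1)) t) (c i) \<and>
        ht i b (Suc (c i)) = 0 \<and> c (i - 1) \<le> c i) \<and>
     (h < m \<longrightarrow> (\<forall>t>c h. 1 \<le> ht (h + 1) b t))" if "1 \<le> m" "m \<le> n" for m
    using that
  proof (induction m rule: dec_induct)
    case base
    then show ?case by (intro exI[of _ 1] exI[of _ "\<lambda>_. c1"]) auto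
  next
    case (step m)
    then obtain h c where h: "1 \<le> h" "h \<le> m" "c 1 = c1"
      and c: "\<And>i. 2 \<le> i \<Longrightarrow> i \<le> h \<Longrightarrow> firstmin (\<lambda>t. ht i b t - step (c (i - 1)) t) (c i) \<and>
        ht i b (Suc (c i)) = 0 \<and> c (i - 1) \<le> c i"
      and s: "h < m \<longrightarrow> (\<forall>t>c h. 1 \<le> ht (h + 1) b t)" by fastforce
    have pos: "0 \<le> ht (h + 1) b t" for t using b[of "h + 1" t] h step by simp
    show ?case
    proof (cases "\<forall>t>c h. 1 \<le> ht (h + 1) b t")
      case True
      then show ?thesis using h c by (intro exI[of _ h] exI[of _ c]) auto
    next
      case False
      then have hm: "h = m" using s h by auto
      define u where "u = (LEAST t. c h < t \<and> ht (h + 1) b t = 0)"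
      obtain t where "c h < t" "\<not> 1 \<le> ht (h + 1) b t" using False by blast
      then have "c h < t \<and> ht (h + 1) b t = 0" using pos[of t] by linarith
      then have u: "c h < u \<and> ht (h + 1) b u = 0" unfolding u_def by (rule LeastI)
      have u': "0 < ht (h + 1) b t" if "c h < t" "t < u" for t
        using not_less_Least[of t "\<lambda>t. c h < t \<and> ht (h + 1) b t = 0"] that pos[of t] unfolding u_def
        by (metis order_le_less)
      obtain x where x: "u = Suc x" using u by (cases u) auto
      have f: "firstmin (\<lambda>t. ht (h + 1) b t - step (c h) t) x"
        using u u' x pos by (intro firstminI) (auto simp: step_def intro: less_le_trans[of "- 1" 0])
      define c' where "c' = c(h + 1 := x)"
      have "firstmin (\<lambda>t. ht i b t - step (c' (i - 1)) t) (c' i) \<and> ht i b (Suc (c' i)) = 0 \<and> c' (i - 1) \<le> c' i"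
        if "2 \<le> i" "i \<le> h + 1" for i
        using c[of i] f u x that by (cases "i = h + 1") (auto simp: c'_def)
      then show ?thesis using h hm by (intro exI[of _ "h + 1"] exI[of _ c']) (auto simp: c'_def)
    qed
  qed
  from this[OF n order_refl] obtain h c where "1 \<le> h" "h \<le> n" "c 1 = c1"
     "\<forall>i. 2 \<le> i \<and> i \<le> h \<longrightarrow> firstmin (\<lambda>t. ht i b t - step (c (i - 1)) t) (c i) \<and>
        ht i b (Suc (c i)) = 0 \<and> c (i - 1) \<le> c i"
     "h < n \<longrightarrow> (\<forall>t>c h. 1 \<le> ht (h + 1) b t)" by blast
  then show ?thesis using f1 unfolding descent_def
    by (intro exI[of _ h] exI[of _ c]) simp
qed

text \<open>One descent makes all heights of index at least 2 nonnegative again and raises the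
  minimum of height 1 by 1. So depth 1 needs one descent to reach a lowest weight element and depth
  2 needs two. The values at \<open>c i\<close> are kept for \<open>descent_twice\<close>.\<close>

lemma descent_run:
  assumes b: "b \<in> words n l" "\<And>i t. 2 \<le> i \<Longrightarrow> i \<le> n \<Longrightarrow> 0 \<le> ht i b t" and d: "descent n b h c"
  obtains b' where "b' \<in> words n l" "e_prod 1 h (Some b') = Some b"
    "\<And>j t. ht j b' t = ht j b t - shift (flips 1 h c) j t"
    "\<And>i t. 2 \<le> i \<Longrightarrow> i \<le> n \<Longrightarrow> 0 \<le> ht i b' t"
    "\<And>t. ht 1 b (Suc (c 1)) < ht 1 b' t"
    "\<And>i. 2 \<le> i \<Longrightarrow> i \<le> h \<Longrightarrow> ht i b' (c i) = 0"
    "ht 1 b' (c 1) = ht 1 b (Suc (c 1)) + 1"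
proof -
  have h: "1 \<le> h" "h \<le> n" and f1: "firstmin (ht 1 b) (c 1)"
    and c: "\<And>i. 2 \<le> i \<Longrightarrow> i \<le> h \<Longrightarrow> firstmin (\<lambda>t. ht i b t - step (c (i - 1)) t) (c i) \<and>
        ht i b (Suc (c i)) = 0 \<and> c (i - 1) \<le> c i"
    and s: "h < n \<Longrightarrow> \<forall>t>c h. 1 \<le> ht (h + 1) b t"
    using d unfolding descent_def by blast+
  have "firstmin (\<lambda>t. ht i b t - (if i = 1 then 0 else step (c (i - 1)) t)) (c i)" if "1 \<le> i" "i \<le> h" for i
    using f1 c[of i] that by (cases "i = 1") auto
  then obtain b' where b': "b' \<in> words n l" "e_prod 1 h (Some b') = Some b"
    "\<And>j t. ht j b' t = ht j b t - shift (flips 1 h c) j t"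
    and st: "\<And>i. 1 \<le> i \<Longrightarrow> i \<le> h \<Longrightarrow> ht i b (c i) - (if i = 1 then 0 else step (c (i - 1)) (c i)) =
        ht i b (Suc (c i)) - (if i = 1 then 0 else step (c (i - 1)) (Suc (c i))) + 1"
    using f_runI[OF b(1), of 1 h c] h(2) by auto
  have cm: "c i \<le> c (i + 1)" if "1 \<le> i" "i < h" for i using c[of "i + 1"] that by simp
  have C: "ht i b' t = ht i b t - flips 1 h c (i - 1) t + 2 * flips 1 h c i t - flips 1 h c (i + 1) t"
    if "1 \<le> i" for i t using that by (simp add: b'(3) shift_pos)
  have next_le: "flips 1 h c (i + 1) t \<le> flips 1 h c i t" if "1 \<le> i" "i \<le> h" for i t
    using cm[of i] that by (auto simp: flips_def step_def)
  have next_0: "flips 1 h c (i + 1) (c i) = 0" if "1 \<le> i" "i \<le> h" for i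
    using cm[of i] that by (intro flips_0) auto
  have at0: "ht i b' (c i) = 0" if i: "2 \<le> i" "i \<le> h" for i
  proof -
    have "flips 1 h c (i - 1) (c i) = step (c (i - 1)) (c i)" using i by (auto simp: flips_def)
    moreover have "flips 1 h c i (c i) = 0" by (simp add: flips_def step_def)
    moreover have "step (c (i - 1)) (Suc (c i)) = 1" using c[OF i] by (simp add: step_def)
    ultimately show ?thesis using C[of i "c i"] st[of i] c[OF i] next_0[of i] i by simp
  qed
  have "0 \<le> ht i b' t" if i: "2 \<le> i" "i \<le> n" for i t
  proof (cases "i \<le> h")
    case True
    have f: "firstmin (\<lambda>t. ht i b t - step (c (i - 1)) t) (c i)" "ht i b (Suc (c i)) = 0" "c (i - 1) \<le> c i"
      using c[OF i(1) True] by auto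
    have p: "flips 1 h c (i - 1) t = step (c (i - 1)) t" using i True by (auto simp: flips_def)
    have q: "flips 1 h c i t = step (c i) t" using i True by (auto simp: flips_def)
    have x: "- 1 < ht i b t - step (c (i - 1)) t" if "t \<le> c i" for t
      using f that unfolding firstmin_def by (auto simp: step_def)
    have y: "- 1 \<le> ht i b t - step (c (i - 1)) t" if "c i < t" for t
      using f that unfolding firstmin_def by (auto simp: step_def)
    show ?thesis using C[of i t] i next_le[of i t] True p q x[of t] y[of t] flips_nonneg[of 1 h c "i + 1" t]
      by (cases "t \<le> c i") (auto simp: step_def)
  next
    case False
    show ?thesis
    proof (cases "i = h + 1")
      case True
      then show ?thesis using C[of i t] s b(2)[OF i, of t] i h by (auto simp: flips_def step_def)
    next
      case False
      then show ?thesis using C[of i t] b(2)[OF i, of t] i \<open>\<not> i \<le> h\<close> by (auto simp: flips_def)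
    qed
  qed
  moreover have "ht 1 b (Suc (c 1)) < ht 1 b' t" for t
  proof -
    have "flips 1 h c 1 t = step (c 1) t" "flips 1 h c 0 t = 0" using h by (auto simp: flips_def)
    moreover have "t \<le> c 1 \<Longrightarrow> ht 1 b (Suc (c 1)) < ht 1 b t" "c 1 < t \<Longrightarrow> ht 1 b (Suc (c 1)) \<le> ht 1 b t"
      using f1 by (simp_all add: firstmin_def)
    moreover have "flips 1 h c 2 t \<le> flips 1 h c 1 t" "0 \<le> flips 1 h c 2 t"
      using next_le[of 1 t] h by (simp_all add: flips_nonneg numeral_2_eq_2)
    ultimately show ?thesis using C[of 1 t] by (cases "t \<le> c 1") (simp_all add: step_def numeral_2_eq_2)
  qed
  moreover have "ht 1 b' (c 1) = ht 1 b (Suc (c 1)) + 1"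
    using C[of 1 "c 1"] st[of 1] next_0[of 1] h by (simp add: flips_def step_def)
  ultimately show ?thesis using that b' at0 by blast
qed

text \<open>The second descent stays strictly before the first: height \<open>i\<close> of
  \<open>b'\<close> is at its minimum at \<open>c i\<close>, so the position sought is found
  earlier. If it stopped at \<open>k < j\<close>, the zero of height \<open>k + 1\<close> at
  \<open>c (k + 1)\<close> would have prolonged it.\<close>

lemma descent_twice:
  assumes b: "b \<in> words n l" "\<And>i t. 2 \<le> i \<Longrightarrow> i \<le> n \<Longrightarrow> 0 \<le> ht i b t" and d: "descent n b j c"
    and b': "e_prod 1 j (Some b') = Some b" "b' \<in> words n l" "ht 1 b' (c 1) = -1"
      "\<And>i. 2 \<le> i \<Longrightarrow> i \<le> j \<Longrightarrow> ht i b' (c i) = 0"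
    and d': "descent n b' k c'" "ht 1 b' (Suc (c' 1)) = -1"
  shows "j \<le> k"
proof (rule ccontr)
  assume jk: "\<not> j \<le> k"
  have cm: "c i \<le> c (i + 1)" if "1 \<le> i" "i < j" for i
    using d that unfolding descent_def by (auto dest!: spec[of _ "i + 1"])
  have dk: "1 \<le> k" "k < n" "firstmin (ht 1 b') (c' 1)" "\<forall>t>c' k. 1 \<le> ht (k + 1) b' t"
    "\<And>i. 2 \<le> i \<Longrightarrow> i \<le> k \<Longrightarrow> firstmin (\<lambda>t. ht i b' t - step (c' (i - 1)) t) (c' i)"
    "\<And>i. 2 \<le> i \<Longrightarrow> i \<le> k \<Longrightarrow> ht i b' (Suc (c' i)) = 0 \<and> c' (i - 1) \<le> c' i"
    using d' d jk unfolding descent_def by auto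
  have "c' i < c i" if "1 \<le> i" "i \<le> k" for i
    using that
  proof (induction i rule: dec_induct)
    case base
    show ?case
    proof (rule ccontr)
      assume "\<not> ?case"
      then have "ht 1 b' (Suc (c' 1)) < ht 1 b' (c 1)" using dk(3) by (simp add: firstmin_def)
      then show False using d'(2) b'(3) by simp
    qed
  next
    case (step i)
    show ?case
    proof (rule ccontr)
      assume n: "\<not> c' (Suc i) < c (Suc i)"
      have i: "2 \<le> Suc i" "Suc i \<le> k" using step by auto
      have "ht (Suc i) b' (Suc (c' (Suc i))) - step (c' i) (Suc (c' (Suc i))) <
          ht (Suc i) b' (c (Suc i)) - step (c' i) (c (Suc i))"
        using dk(5)[OF i] n by (simp add: firstmin_def)
      moreover have "c' i < c (Suc i)" using step cm[of i] jk by simp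
      ultimately show False using dk(6)[OF i] b'(4)[OF i(1)] i jk by (simp add: step_def)
    qed
  qed
  then have "c' k < c (k + 1)" using cm[of k] dk(1) jk by fastforce
  then show False using dk(4) b'(4)[of "k + 1"] dk(1) jk by fastforce
qed

text \<open>If \<open>j \<le> h\<close>, height \<open>i\<close> of \<open>Y\<close> is still at its
  minimum 0 at \<open>Suc (c i)\<close> for \<open>2 \<le> i \<le> j\<close>, so the last minimum
  used by \<open>e_i\<close> lies beyond \<open>c (i - 1)\<close>. Then height 1 keeps the value -1
  at \<open>Suc (c 1)\<close> all the way to \<open>y\<close>.\<close>

lemma descent_less:
  assumes Y: "Y \<in> words n l" "\<And>i t. 2 \<le> i \<Longrightarrow> i \<le> n \<Longrightarrow> 0 \<le> ht i Y t"
    and d: "descent n Y h c" "ht 1 Y (Suc (c 1)) = -1"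
    and y: "e_prod 2 j (Some Y) = Some y" "\<And>t. 0 \<le> ht 1 y t" and j: "1 \<le> j" "j \<le> n"
  shows "h < j"
proof (rule ccontr)
  assume "\<not> h < j"
  then have jh: "j \<le> h" by simp
  obtain B where B: "\<And>i t. ht i y t = ht i Y t + shift (flips 2 j B) i t"
    "\<And>i. 2 \<le> i \<Longrightarrow> i \<le> j \<Longrightarrow> lastmin (\<lambda>t. ht i Y t + flips 2 j B (i + 1) t) (B i)"
    using e_prodD[OF Y(1) _ j(2) y(1)] by auto
  have c: "ht i Y (Suc (c i)) = 0 \<and> c (i - 1) \<le> c i" if "2 \<le> i" "i \<le> h" for i
    using d that by (auto simp: descent_def)
  have Bc: "c (i - 1) < B i" if "2 \<le> i" "i \<le> j" for i
    using that(2,1)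
  proof (induction i rule: inc_induct)
    case base
    have "ht j Y (Suc (c j)) = 0" "c (j - 1) \<le> c j" using c base jh by auto
    moreover have "ht j Y (B j) < ht j Y t" if "B j < t" for t
      using lastmin_less[OF B(2)[OF base order_refl] that] by (simp add: flips_def)
    ultimately have "\<not> B j < Suc (c j)" using Y(2)[OF base j(2), of "B j"] by force
    then show ?case using \<open>c (j - 1) \<le> c j\<close> by simp
  next
    case (step i)
    have 0: "ht i Y (Suc (c i)) = 0" "c (i - 1) \<le> c i" using c step jh by auto
    have "flips 2 j B (i + 1) (Suc (c i)) = 0" using step by (intro flips_0) auto
    then have "\<not> B i < Suc (c i)"
      using lastmin_less[OF B(2), of i "Suc (c i)"] step j 0(1) Y(2)[of i "B i"]
        flips_nonneg[of 2 j B "i + 1" "B i"] by auto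
    then show ?case using 0(2) by simp
  qed
  have "flips 2 j B 2 (Suc (c 1)) = 0" using Bc[of 2] by (intro flips_0) auto
  then have "ht 1 y (Suc (c 1)) = -1" using B(1)[of 1 "Suc (c 1)"] d(2) by (simp add: shift_pos flips_def numeral_2_eq_2)
  then show False using y(2)[of "Suc (c 1)"] by simp
qed

section \<open>Comparison of second chains of different lengths\<close>

context second_chain
begin

lemma turn_or_transversal: "(\<exists>m. turn m) \<or> (\<forall>i. 1 \<le> i \<and> i \<le> j \<longrightarrow> i < k \<and> p (i + 1) < q i)"
proof (rule disjCI)
  assume "\<not> (\<forall>i. 1 \<le> i \<and> i \<le> j \<longrightarrow> i < k \<and> p (i + 1) < q i)"
  then have ex: "\<exists>i. 1 \<le> i \<and> i \<le> j \<and> \<not> (i < k \<and> p (i + 1) < q i)" by blast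
  define m where "m = (LEAST i. 1 \<le> i \<and> i \<le> j \<and> \<not> (i < k \<and> p (i + 1) < q i))"
  have m: "1 \<le> m" "m \<le> j" "\<not> (m < k \<and> p (m + 1) < q m)"
    using LeastI_ex[OF ex] unfolding m_def by blast+
  have "p (i + 1) < q i" if "1 \<le> i" "i < m" for i
    using not_less_Least[of i "\<lambda>i. 1 \<le> i \<and> i \<le> j \<and> \<not> (i < k \<and> p (i + 1) < q i)"] that m(2)
    unfolding m_def by auto
  then have "turn m" using m j by (auto simp: turn_def)
  then show "\<exists>m. turn m" ..
qed

lemma turn_unique:
  assumes "turn m" "turn m'"
  shows "m = m'"
proof -
  have False if "turn m" "turn m'" "m < m'" for m m'
    using that j by (auto simp: turn_def)
  then show ?thesis using assms by (meson linorder_neqE_nat)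
qed

end

locale two_chains = second_chain n l v k w p j g q + other: second_chain n l v k w p j' g' q'
  for n l v k w p j g q j' g' q' +
  assumes jj: "j \<le> j'"
begin

text \<open>Beyond \<open>q i\<close> the sum in \<open>q_after\<close> is at least 2, while
  \<open>q' i\<close> satisfies \<open>q_one\<close>. Going down from \<open>j\<close>, the flip at
  \<open>q (i + 1)\<close> does not yet count at \<open>q' i\<close>, so \<open>q' i\<close> cannot
  lie beyond \<open>q i\<close>.\<close>

lemma q_antimono:
  assumes "1 \<le> i" "i \<le> j"
  shows "q' i \<le> q i"
  using assms(2,1)
proof (induction i rule: inc_induct)
  case base
  then show ?case using q_after[OF base order_refl, of "q' j"] other.q_one[OF base jj]
    by (cases "q j < q' j") (auto simp: flips_def)
next
  case (step i)
  have "Qf (i + 1) (q' i) = 0" using step other.q_le[of i] jj by (intro flips_0) auto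
  then show ?case using q_after[of i "q' i"] other.q_one[of i] step jj
    by (cases "q i < q' i") auto
qed

text \<open>At a turn, \<open>q m \<le> p (m + 1) < q' (m + 1)\<close> whenever the longer chain has
  index \<open>m + 1\<close>, so the flip at \<open>q' (m + 1)\<close> does not count at
  \<open>q m\<close> and both chains flip at \<open>q m\<close>. The agreement then passes down to
  smaller indices. So turns persist in longer chains.\<close>

lemma turn_common:
  assumes m: "turn m"
  shows "other.turn m" "1 \<le> i \<Longrightarrow> i \<le> m \<Longrightarrow> q i = q' i"
proof -
  have m1: "1 \<le> m" "m \<le> j" and A: "m = k \<or> q m \<le> p (m + 1)"
    and B: "\<And>i. 1 \<le> i \<Longrightarrow> i < m \<Longrightarrow> p (i + 1) < q i"
    using m by (auto simp: turn_def)
  have eq: "q i = q' i" if "1 \<le> i" "i \<le> m" for i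
    using that(2,1)
  proof (induction i rule: inc_induct)
    case base
    have "other.Qf (m + 1) (q m) = 0"
    proof (rule flips_0)
      assume "m + 1 \<le> j'"
      then show "q m \<le> q' (m + 1)" using other.p_less_q[of "m + 1"] A other.j by auto
    qed
    then have "q m \<le> q' m"
      using other.q_after[of m "q m"] q_one[of m] m1 jj by (cases "q' m < q m") auto
    then show ?case using q_antimono[of m] m1 by simp
  next
    case (step i)
    have "Qf (i + 1) (q i) = 0" using q_facts[of i] step m1 by simp
    then have "other.Qf (i + 1) (q i) = 0" using step m1 jj by (auto simp: flips_def)
    then have "q i \<le> q' i"
      using other.q_after[of i "q i"] q_one[of i] step m1 jj by (cases "q' i < q i") auto
    then show ?case using q_antimono[of i] step m1 by simp
  qed
  show "1 \<le> i \<Longrightarrow> i \<le> m \<Longrightarrow> q i = q' i" by (rule eq)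
  show "other.turn m" unfolding other.turn_def using m1 jj A B eq by auto
qed

text \<open>Provides the points that keep the descent in \<open>descent_ge\<close> going. Either the
  spliced flips of index \<open>i - 1\<close>, \<open>i\<close> and \<open>i + 1\<close> all precede
  \<open>q i\<close>, where height \<open>i\<close> of \<open>v\<close> is 0, or the longer chain
  also flips at \<open>q i\<close> and \<open>q_Suc\<close> gives the value one step later.\<close>

lemma descent_level:
  assumes B: "\<And>i. 1 \<le> i \<Longrightarrow> i \<le> j \<Longrightarrow> i < k \<and> p (i + 1) < q i" and m: "other.turn m"
    and i: "1 \<le> i" "i \<le> j"
  shows "\<exists>\<tau>. H i \<tau> + shift (other.Sf m) i \<tau> = (if i = 1 then -1 else 0) \<and>
    (\<tau> = q i \<and> (i \<le> m \<longrightarrow> q' i < q i) \<or> \<tau> = Suc (q i) \<and> i < m \<and> q i = q' i)"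
proof -
  have m1: "1 \<le> m" "m \<le> j'" and A: "m = k \<or> q' m \<le> p (m + 1)"
    and B': "\<And>i. 1 \<le> i \<Longrightarrow> i < m \<Longrightarrow> p (i + 1) < q' i"
    using m by (auto simp: other.turn_def)
  have ik: "i < k" "p (i + 1) < q i" using B[OF i] by auto
  have e: "H i t + shift (other.Sf m) i t =
      H i t + other.Sf m (i - 1) t - 2 * other.Sf m i t + other.Sf m (i + 1) t" for t
    using i by (simp add: shift_pos)
  have H0: "H i (q i) = 0"
    using q_one[OF i] flips_1[of 1 "i + 1" k p "q i"] ik by simp
  have S1: "other.Sf m i t = 1" if "other.spliced m i < t" for t using that i ik by (intro flips_1) auto
  have S2: "other.Sf m (i - 1) t = (if i = 1 then 0 else 1)" if "other.spliced m i < t" for t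
  proof (cases "i = 1")
    case False
    then have "1 \<le> i - 1" "i - 1 < k" using i ik by arith+
    then show ?thesis using False that other.splice_le[OF m, of "i - 1"] ik by (auto intro!: flips_1)
  qed (simp add: flips_def)
  have le: "other.spliced m i \<le> other.spliced m (i + 1)" using other.splice_le[OF m i(1) ik(1)] .
  show ?thesis
  proof (cases "other.spliced m (i + 1) < q i")
    case True
    then have lt: "other.spliced m i < q i" using le by simp
    have "other.Sf m (i + 1) (q i) = 1" using True ik by (intro flips_1) auto
    then have "H i (q i) + shift (other.Sf m) i (q i) = (if i = 1 then -1 else 0)"
      unfolding e unfolding H0 S1[OF lt] S2[OF lt] by simp
    moreover have "i \<le> m \<longrightarrow> q' i < q i" using lt by (auto simp: other.spliced_def)
    ultimately show ?thesis by blast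
  next
    case False
    then have im: "i < m" and qi: "q i \<le> q' (i + 1)" using ik by (auto simp: other.spliced_def split: if_splits)
    have Q0: "other.Qf (i + 1) (q i) = 0" using qi by (intro flips_0) auto
    have "\<not> q' i < q i"
      using other.q_after[of i "q i"] q_one[OF i] Q0 i jj by auto
    then have qq: "q i = q' i" using q_antimono[OF i] by simp
    have "Pf (i + 1) (Suc (q i)) = 1" using ik by (intro flips_1) auto
    then have "H i (Suc (q i)) + other.Sf m (i + 1) (Suc (q i)) = 1"
      using other.q_Suc[of i] i jj qq other.Sf[OF m1(2), of "i + 1" "Suc (q i)"] im by simp
    moreover have lt: "other.spliced m i < Suc (q i)" using qq im by (simp add: other.spliced_def)
    ultimately have "H i (Suc (q i)) + shift (other.Sf m) i (Suc (q i)) = (if i = 1 then -1 else 0)"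
      unfolding e S1[OF lt] S2[OF lt] by (cases "i = 1") simp_all
    then show ?thesis using im qq by blast
  qed
qed

text \<open>Induction on the level. Since \<open>c i\<close> precedes the point
  \<open>\<tau>\<close> of the next level, the zero at \<open>\<tau>\<close> prolongs the descent,
  and its next position again precedes \<open>\<tau>\<close>. The second alternative of the
  invariant accounts for \<open>\<tau> = Suc (q i)\<close>.\<close>

lemma descent_ge:
  assumes B: "\<And>i. 1 \<le> i \<Longrightarrow> i \<le> j \<Longrightarrow> i < k \<and> p (i + 1) < q i" and m: "other.turn m"
    and Y: "\<And>i t. ht i Y t = H i t + shift (other.Sf m) i t"
    and d: "descent n Y h c" "ht 1 Y (Suc (c 1)) = -1"
  shows "j \<le> h"
proof -
  have m1: "m \<le> j'" using m by (auto simp: other.turn_def)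
  have h: "1 \<le> h" "firstmin (ht 1 Y) (c 1)" "h < n \<Longrightarrow> \<forall>t>c h. 1 \<le> ht (h + 1) Y t"
    and c: "\<And>i. 2 \<le> i \<Longrightarrow> i \<le> h \<Longrightarrow> firstmin (\<lambda>t. ht i Y t - step (c (i - 1)) t) (c i) \<and>
        ht i Y (Suc (c i)) = 0 \<and> c (i - 1) \<le> c i"
    using d(1) unfolding descent_def by blast+
  have level: "\<exists>\<tau>. ht i Y \<tau> = (if i = 1 then -1 else 0) \<and>
    (\<tau> = q i \<and> (i \<le> m \<longrightarrow> q' i < q i) \<or> \<tau> = Suc (q i) \<and> i < m \<and> q i = q' i)" if "1 \<le> i" "i \<le> j" for i
    unfolding Y using descent_level[OF B m that] by blast
  have "i \<le> h \<and> (c i < q i \<or> c i \<le> q i \<and> q i = q' i \<and> i < m)" if "1 \<le> i" "i \<le> j" for i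
    using that
  proof (induction i rule: dec_induct)
    case base
    obtain \<tau> where \<tau>: "ht 1 Y \<tau> = -1" "\<tau> = q 1 \<or> \<tau> = Suc (q 1) \<and> 1 < m \<and> q 1 = q' 1"
      using level[of 1] j by auto
    have "\<not> \<tau> \<le> c 1" using h(2) \<tau>(1) d(2) unfolding firstmin_def by auto
    then show ?case using \<tau>(2) h(1) by auto
  next
    case (step i)
    have IH: "i \<le> h" "c i < q i \<or> c i \<le> q i \<and> q i = q' i \<and> i < m" using step by auto
    have ij: "1 \<le> i + 1" "i + 1 \<le> j" using step by auto
    obtain \<tau> where \<tau>: "ht (i + 1) Y \<tau> = 0"
      "\<tau> = q (i + 1) \<and> (i + 1 \<le> m \<longrightarrow> q' (i + 1) < q (i + 1)) \<or>
       \<tau> = Suc (q (i + 1)) \<and> i + 1 < m \<and> q (i + 1) = q' (i + 1)"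
      using level[OF ij] step by auto
    have qq: "q i \<le> q (i + 1)" using q_le[of i] step by simp
    have qq': "q' i \<le> q' (i + 1)" using other.q_le[of i] step jj by simp
    have ct: "c i < \<tau>" using IH(2) \<tau>(2) qq qq' by auto
    have "h \<noteq> i"
    proof
      assume "h = i"
      then show False using h(3) ct \<tau>(1) ij j k by force
    qed
    then have ih: "i + 1 \<le> h" using IH by simp
    have f: "firstmin (\<lambda>t. ht (i + 1) Y t - step (c i) t) (c (i + 1))"
      "ht (i + 1) Y (Suc (c (i + 1))) = 0" "c i \<le> c (i + 1)"
      using c[of "i + 1"] step ih by auto
    have "\<not> \<tau> \<le> c (i + 1)"
    proof
      assume "\<tau> \<le> c (i + 1)"
      then have "ht (i + 1) Y (Suc (c (i + 1))) - step (c i) (Suc (c (i + 1))) < ht (i + 1) Y \<tau> - step (c i) \<tau>"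
        using f(1) unfolding firstmin_def by blast
      then show False using f(2,3) \<tau>(1) ct by (simp add: step_def)
    qed
    then show ?case using ih \<tau>(2) by auto
  qed
  from this[of j] show ?thesis using j by simp
qed

end

lemma shift_cong: "(\<And>i. 1 \<le> i \<Longrightarrow> P i = P' i) \<Longrightarrow> shift (flips 1 k P) j t = shift (flips 1 k P') j t"
proof -
  assume "\<And>i. 1 \<le> i \<Longrightarrow> P i = P' i"
  then have "flips 1 k P = flips 1 k P'" by (auto simp: flips_def fun_eq_iff)
  then show ?thesis by simp
qed

lemma (in two_chains) splice_common:
  assumes "turn m"
  shows "shift (Sf m) i t = shift (other.Sf m) i t"
  using turn_common(2)[OF assms] by (intro shift_cong) (simp add: spliced_def other.spliced_def)

section \<open>The dichotomy behind C1 and C2, and axiom C0\<close>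

lemma lowest_iff: "lowest n v \<longleftrightarrow> (\<forall>i t. 1 \<le> i \<and> i \<le> n \<longrightarrow> 0 \<le> ht i v t)"
  by (auto simp: lowest_def f_op_None_iff)

lemma first_chain_exists:
  assumes "v \<in> words n l" "lowest n v" "1 \<le> k" "k \<le> n" "e_prod 1 k (Some v) = Some w"
  shows "\<exists>p. first_chain n l v k w p"
proof -
  obtain p where "w \<in> words n l" "\<And>j t. ht j w t = ht j v t + shift (flips 1 k p) j t"
    "\<And>i. 1 \<le> i \<Longrightarrow> i \<le> k \<Longrightarrow> lastmin (\<lambda>t. ht i v t + flips 1 k p (i + 1) t) (p i) \<and>
        ht i v (Suc (p i)) + flips 1 k p (i + 1) (Suc (p i)) = ht i v (p i) + flips 1 k p (i + 1) (p i) + 1"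
    using e_prodD[OF assms(1) order_refl assms(4,5)] by blast
  then have "first_chain n l v k w p" using assms by unfold_locales (auto simp: lowest_iff)
  then show ?thesis by blast
qed

lemma (in first_chain) second_chain_exists:
  assumes "1 \<le> j" "j \<le> k" "e_prod 1 j (Some w) = Some g"
  shows "\<exists>q. second_chain n l v k w p j g q"
proof -
  have "j \<le> n" using assms k by simp
  then obtain q where "g \<in> words n l" "\<And>i t. ht i g t = ht i w t + shift (flips 1 j q) i t"
    "\<And>i. 1 \<le> i \<Longrightarrow> i \<le> j \<Longrightarrow> lastmin (\<lambda>t. ht i w t + flips 1 j q (i + 1) t) (q i) \<and>
        ht i w (Suc (q i)) + flips 1 j q (i + 1) (Suc (q i)) = ht i w (q i) + flips 1 j q (i + 1) (q i) + 1"
    using e_prodD[OF w_words order_refl _ assms(3)] by blast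
  then have "second_chain n l v k w p j g q" using assms by unfold_locales auto
  then show ?thesis by blast
qed

text \<open>If height 1 of the spliced word is nonnegative, the word is itself lowest and
  \<open>h = 0\<close>; otherwise its depth is 1 and a single descent reaches
  \<open>v'\<close>.\<close>

lemma (in second_chain) descent_turn:
  assumes o: odd_free and m: "turn m"
  shows "\<exists>h v' Y. h < k \<and> v' \<in> words n l \<and> lowest n v' \<and> h < j \<and>
    e_prod 1 h (Some v') = Some Y \<and> (\<forall>i t. ht i Y t = H i t + shift (Sf m) i t) \<and>
    (h = 0 \<and> (\<forall>t. 0 \<le> ht 1 Y t) \<or> (\<exists>c. descent n Y h c \<and> ht 1 Y (Suc (c 1)) = -1))"
proof -
  obtain y where y: "f_neg g = Some y" using f_neg_g o by blast
  obtain Y where Y: "Y \<in> words n l" "e_prod 2 j (Some Y) = Some y"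
    "\<And>i t. ht i Y t = H i t + shift (Sf m) i t"
    using f_neg_g_turn[OF y m] by blast
  have Y2: "0 \<le> ht i Y t" if "2 \<le> i" "i \<le> n" for i t
    unfolding Y(3) using splice_nonneg[OF m, of i t] that by simp
  have Y1: "- 1 \<le> ht 1 Y t" for t
    unfolding Y(3) using splice_nonneg[OF m, of 1 t] k by simp
  have n: "1 \<le> n" using k by simp
  show ?thesis
  proof (cases "\<forall>t. 0 \<le> ht 1 Y t")
    case True
    have "0 \<le> ht i Y t" if "1 \<le> i" "i \<le> n" for i t
      using True Y2[of i t] that by (cases "i = 1") auto
    then have "lowest n Y" by (simp add: lowest_iff)
    moreover have "e_prod 1 0 (Some Y) = Some Y" by (simp add: e_prod_empty)
    ultimately show ?thesis using Y True j k by (intro exI[of _ 0] exI[of _ Y]) auto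
  next
    case False
    then obtain t where "ht 1 Y t < 0" by (meson not_le)
    then have "ht 1 Y t = -1" using Y1[of t] by linarith
    then obtain h c where d: "descent n Y h c" "ht 1 Y (Suc (c 1)) = -1"
      using descent_exists[of n Y 1] Y1 Y2 n by auto
    obtain v' where v': "v' \<in> words n l" "e_prod 1 h (Some v') = Some Y"
      "\<And>i t. 2 \<le> i \<Longrightarrow> i \<le> n \<Longrightarrow> 0 \<le> ht i v' t" "\<And>t. ht 1 Y (Suc (c 1)) < ht 1 v' t"
      by (rule descent_run[OF Y(1) Y2 d(1)]) auto
    have "0 \<le> ht i v' t" if "1 \<le> i" "i \<le> n" for i t
    proof (cases "i = 1")
      case True
      then show ?thesis using v'(4)[of t] d(2) by simp
    qed (use v'(3)[of i t] that in simp)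
    then have "lowest n v'" by (simp add: lowest_iff)
    moreover have "h < j"
      using descent_less[OF Y(1) Y2 d Y(2) ht_1_f_neg_g[OF y]] j k by simp
    ultimately show ?thesis using v' d Y(3) j by (intro exI[of _ h] exI[of _ v'] exI[of _ Y]) auto
  qed
qed

lemma (in two_chains) transversal_le_descent:
  assumes B: "\<forall>i. 1 \<le> i \<and> i \<le> j \<longrightarrow> i < k \<and> p (i + 1) < q i" and m: "other.turn m"
    and Y: "\<And>i t. ht i Y t = H i t + shift (other.Sf m) i t"
    and d: "h = 0 \<and> (\<forall>t. 0 \<le> ht 1 Y t) \<or> (\<exists>c. descent n Y h c \<and> ht 1 Y (Suc (c 1)) = -1)"
  shows "j \<le> h"
  using d
proof
  assume "h = 0 \<and> (\<forall>t. 0 \<le> ht 1 Y t)"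
  moreover obtain \<tau> where "ht 1 Y \<tau> = -1"
    using descent_level[of m 1] B m j Y by auto
  ultimately show ?thesis by (metis neg_0_le_iff_le not_one_le_zero)
next
  assume "\<exists>c. descent n Y h c \<and> ht 1 Y (Suc (c 1)) = -1"
  then show ?thesis using descent_ge[of m Y h] B m Y by blast
qed

lemma e_prod_None [simp]: "e_prod a c None = None"
proof -
  have "foldr (\<lambda>i y. Option.bind y (e_op i)) xs None = None" for xs by (induction xs) auto
  then show ?thesis by (simp add: e_prod_def)
qed

text \<open>Any two lengths are comparable, so \<open>turn_common\<close> applies in one direction.
  Hence one \<open>Y\<close>, one \<open>h\<close> and one \<open>v'\<close> serve for all
  \<open>j\<close>.\<close>

lemma splice_shift_unique:
  assumes a: "second_chain n l v k w p j g q" and b: "second_chain n l v k w p j' g' q'"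
    and m: "second_chain.turn k p j q m" and m': "second_chain.turn k p j' q' m'"
  shows "shift (flips 1 k (second_chain.spliced p q m)) i t = shift (flips 1 k (second_chain.spliced p q' m')) i t"
proof -
  have *: "shift (flips 1 k (second_chain.spliced p q m)) i t = shift (flips 1 k (second_chain.spliced p q' m')) i t"
    if a: "second_chain n l v k w p j g q" and b: "second_chain n l v k w p j' g' q'"
    and m: "second_chain.turn k p j q m" and m': "second_chain.turn k p j' q' m'"
    and "j \<le> j'" for j g q m j' g' q' m'
  proof -
    interpret two_chains n l v k w p j g q j' g' q'
      using a b \<open>j \<le> j'\<close> by (simp add: two_chains_def two_chains_axioms_def)
    have "m = m'" using turn_common(1)[OF m] other.turn_unique m' by blast
    then show ?thesis using splice_common[OF m] by simp
  qed
  show ?thesis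
  proof (cases "j \<le> j'")
    case True
    then show ?thesis using *[OF a b m m'] by simp
  next
    case False
    then show ?thesis using *[OF b a m' m] by simp
  qed
qed

text \<open>The content of C1 and C2 without the component graph. If no chain turns, or
  \<open>f_neg\<close> kills every \<open>g\<close>, the first alternative holds. Otherwise
  \<open>descent_less\<close> puts the turning lengths above \<open>h\<close> and
  \<open>descent_ge\<close> puts the transversal ones at or below it. The witness \<open>j\<close>
  above \<open>h\<close> will produce the moving edge.\<close>

lemma dichotomy:
  assumes v: "v \<in> words n l" "lowest n v" and k: "1 \<le> k" "k \<le> n"
  shows "(\<forall>j g y. 1 \<le> j \<and> j \<le> k \<and> g_elt v j k = Some g \<and> f_neg g = Some y \<longrightarrow>
        e_prod 2 k (e_prod 1 j (Some v)) = Some y) \<or>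
     (\<exists>h v'. h < k \<and> v' \<in> words n l \<and> lowest n v' \<and>
        (\<exists>j g y. h < j \<and> j \<le> k \<and> g_elt v j k = Some g \<and> f_neg g = Some y) \<and>
        (\<forall>j g. 1 \<le> j \<and> j \<le> k \<and> g_elt v j k = Some g \<longrightarrow>
           (\<exists>y. f_neg g = Some y \<and>
              (h < j \<longrightarrow> e_prod 2 j (e_prod 1 h (Some v')) = Some y) \<and>
              (j \<le> h \<longrightarrow> e_prod 2 k (e_prod 1 j (Some v)) = Some y))))"
    (is "?alpha \<or> ?beta")
proof (cases "e_prod 1 k (Some v)")
  case None
  then show ?thesis by (simp add: g_elt_def)
next
  case (Some w)
  then obtain p where "first_chain n l v k w p" using first_chain_exists v k by blast
  then interpret first_chain n l v k w p .
  have chain: "\<exists>q. second_chain n l v k w p j g q" if "1 \<le> j" "j \<le> k" "g_elt v j k = Some g" for j g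
    using second_chain_exists that Some by (simp add: g_elt_def)
  show ?thesis
  proof (cases "odd_free \<and> (\<exists>j g q m. second_chain n l v k w p j g q \<and> second_chain.turn k p j q m)")
    case False
    have ?alpha
    proof (intro allI impI, elim conjE)
      fix j g y assume j: "1 \<le> j" "j \<le> k" "g_elt v j k = Some g" and y: "f_neg g = Some y"
      obtain q where q: "second_chain n l v k w p j g q" using chain j by blast
      then interpret second_chain n l v k w p j g q .
      have odd_free using f_neg_g y by auto
      then have "\<not> turn m" for m using False q by blast
      then show "e_prod 2 k (e_prod 1 j (Some v)) = Some y"
        using turn_or_transversal f_neg_g_transversal[OF y] by blast
    qed
    then show ?thesis ..
  next
    case True
    then obtain j0 g0 q0 m0 where c0: "second_chain n l v k w p j0 g0 q0"
      and m0: "second_chain.turn k p j0 q0 m0" and o: odd_free by blast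
    interpret c0: second_chain n l v k w p j0 g0 q0 by (rule c0)
    obtain h v' Y where v': "h < k" "v' \<in> words n l" "lowest n v'" "h < j0" "e_prod 1 h (Some v') = Some Y"
      and Y: "\<And>i t. ht i Y t = H i t + shift (c0.Sf m0) i t"
      and d: "h = 0 \<and> (\<forall>t. 0 \<le> ht 1 Y t) \<or> (\<exists>c. descent n Y h c \<and> ht 1 Y (Suc (c 1)) = -1)"
      using c0.descent_turn[OF o m0] by blast
    have Yw: "Y \<in> words n l" using e_prodD[OF v'(2) order_refl _ v'(5)] v'(1) k by simp
    have Y2: "0 \<le> ht i Y t" if "2 \<le> i" "i \<le> n" for i t
      unfolding Y using c0.splice_nonneg[OF m0, of i t] that by simp
    have "\<exists>y. f_neg g = Some y \<and> (h < j \<longrightarrow> e_prod 2 j (e_prod 1 h (Some v')) = Some y) \<and>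
              (j \<le> h \<longrightarrow> e_prod 2 k (e_prod 1 j (Some v)) = Some y)"
      if j: "1 \<le> j" "j \<le> k" "g_elt v j k = Some g" for j g
    proof -
      obtain q where q: "second_chain n l v k w p j g q" using chain j by blast
      then interpret second_chain n l v k w p j g q .
      obtain y where y: "f_neg g = Some y" using f_neg_g o by blast
      show ?thesis
      proof (cases "\<exists>m. turn m")
        case True
        then obtain m where m: "turn m" by blast
        obtain Y' where Y': "Y' \<in> words n l" "e_prod 2 j (Some Y') = Some y"
          "\<And>i t. ht i Y' t = H i t + shift (Sf m) i t" using f_neg_g_turn[OF y m] by blast
        have "Y' = Y"
          using splice_shift_unique[OF q c0 m m0] by (intro words_eqI[OF Y'(1) Yw]) (simp add: Y' Y)
        then have e: "e_prod 2 j (Some Y) = Some y" using Y' by simp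
        have "h < j"
          using d
        proof
          assume "\<exists>c. descent n Y h c \<and> ht 1 Y (Suc (c 1)) = -1"
          then show ?thesis using descent_less[OF Yw Y2 _ _ e ht_1_f_neg_g[OF y]] j k by auto
        qed (use j in simp)
        then show ?thesis using y e v'(5) by simp
      next
        case False
        then have B: "\<forall>i. 1 \<le> i \<and> i \<le> j \<longrightarrow> i < k \<and> p (i + 1) < q i" using turn_or_transversal by blast
        \<comment> \<open>A transversal chain cannot be longer than one with a turn, since turns
          persist.\<close>
        have "j \<le> j0"
        proof (rule ccontr)
          assume "\<not> j \<le> j0"
          then interpret t: two_chains n l v k w p j0 g0 q0 j g q
            using q c0 by (simp add: two_chains_def two_chains_axioms_def)
          show False using t.turn_common(1)[OF m0] False by blast
        qed
        then interpret t: two_chains n l v k w p j g q j0 g0 q0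
          using q c0 by (simp add: two_chains_def two_chains_axioms_def)
        have "j \<le> h" using t.transversal_le_descent[OF B m0 Y d] .
        then show ?thesis using y f_neg_g_transversal[OF y] B by simp
      qed
    qed
    moreover have "\<exists>y. f_neg g0 = Some y" using c0.f_neg_g o by blast
    moreover have "g_elt v j0 k = Some g0" using c0.g Some by (simp add: g_elt_def)
    ultimately have ?beta using v' c0.j by blast
    then show ?thesis ..
  qed
qed

text \<open>Axiom C0: \<open>f_neg\<close> is nonzero on \<open>w\<close> and on \<open>g\<close>
  under the same condition \<open>odd_free\<close>.\<close>

lemma phi_neg_g_elt:
  assumes v: "v \<in> words n l" "lowest n v" and jk: "1 \<le> j" "j \<le> k" "k \<le> n"
    and ge: "g_elt v j k = Some g" "phi_neg g = 0"
  shows "\<exists>w. e_prod 1 k (Some v) = Some w \<and> phi_neg w = 0"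
proof (cases "e_prod 1 k (Some v)")
  case None
  then show ?thesis using ge by (simp add: g_elt_def)
next
  case (Some w)
  then obtain p where "first_chain n l v k w p" using first_chain_exists[of v n l k] v jk by auto
  then interpret first_chain n l v k w p .
  obtain q where "second_chain n l v k w p j g q"
    using second_chain_exists[of j g] jk ge Some by (auto simp: g_elt_def)
  then interpret second_chain n l v k w p j g q .
  have "f_neg w = None" using ge(2) f_neg_w f_neg_g unfolding phi_neg_eq_0_iff by blast
  then show ?thesis using Some by (simp add: phi_neg_eq_0_iff)
qed

section \<open>Type A components\<close>

definition raising :: "nat \<Rightarrow> nat \<Rightarrow> (nat list \<times> nat list) set" where
  "raising n l = {(b, c). b \<in> words n l \<and> c \<in> words n l \<and> (\<exists>i\<in>{1..n}. e_op i b = Some c)}"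

text \<open>Sequences of flips act here on abstract families of height functions, so that the local
  relations can be proved for functions and transferred to words by
  \<open>raisable_run\<close>.\<close>

fun raised :: "(nat \<times> nat) list \<Rightarrow> (nat \<Rightarrow> nat \<Rightarrow> int) \<Rightarrow> nat \<Rightarrow> nat \<Rightarrow> int" where
  "raised [] F = F"
| "raised ((i, p) # xs) F = raised xs (\<lambda>j t. F j t + cartan i j * step p t)"

fun raisable :: "(nat \<times> nat) list \<Rightarrow> (nat \<Rightarrow> nat \<Rightarrow> int) \<Rightarrow> bool" where
  "raisable [] F \<longleftrightarrow> True"
| "raisable ((i, p) # xs) F \<longleftrightarrow> lastmin (F i) p \<and> raisable xs (\<lambda>j t. F j t + cartan i j * step p t)"

lemma raisable_run:
  assumes "b \<in> words n l" "\<forall>x\<in>set xs. 1 \<le> fst x \<and> fst x \<le> n" "raisable xs (\<lambda>j t. ht j b t)"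
  shows "\<exists>c. (b, c) \<in> (raising n l)\<^sup>* \<and> c \<in> words n l \<and> (\<lambda>j t. ht j c t) = raised xs (\<lambda>j t. ht j b t)"
  using assms
proof (induction xs arbitrary: b)
  case (Cons x xs)
  obtain i p where x: "x = (i, p)" by (cases x)
  have i: "1 \<le> i" "i \<le> n" "lastmin (ht i b) p" using Cons.prems x by auto
  obtain c where c: "e_op i b = Some c" "c \<in> words n l"
    "\<And>j t. ht j c t = ht j b t + cartan i j * step p t"
    by (rule e_opI[OF i(3) Cons.prems(1) i(1,2)]) blast
  have "raisable xs (\<lambda>j t. ht j c t)" using Cons.prems(3) x by (simp add: c(3))
  then obtain d where d: "(c, d) \<in> (raising n l)\<^sup>*" "d \<in> words n l"
    "(\<lambda>j t. ht j d t) = raised xs (\<lambda>j t. ht j c t)"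
    using Cons.IH[OF c(2)] Cons.prems(2) by auto
  have "(b, c) \<in> raising n l" using c Cons.prems(1) i by (auto simp: raising_def)
  moreover have "raised (x # xs) (\<lambda>j t. ht j b t) = raised xs (\<lambda>j t. ht j c t)" by (simp add: x c(3))
  ultimately show ?case using d by (metis converse_rtrancl_into_rtrancl)
qed auto

lemma last_exists:
  fixes P :: "nat \<Rightarrow> bool"
  assumes "P t0" "t0 \<le> B"
  obtains t where "P t" "t0 \<le> t" "t \<le> B" "\<And>u. t < u \<Longrightarrow> u \<le> B \<Longrightarrow> \<not> P u"
proof -
  let ?t = "GREATEST t. t \<le> B \<and> P t"
  have "?t \<le> B \<and> P ?t" by (rule GreatestI_nat[of _ t0 B]) (use assms in auto)
  moreover have "u \<le> ?t" if "u \<le> B" "P u" for u by (rule Greatest_le_nat[of _ u B]) (use that in auto)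
  ultimately show ?thesis using that[of ?t] assms by (meson leD)
qed

text \<open>
  The local relations of Stembridge: two raising operators with adjacent indices either commute or
  satisfy a relation of degree four.
\<close>

lemma diamond_less:
  assumes adj: "i' = i + 1 \<or> i = i' + 1"
    and a: "lastmin (F i) a" "F i (Suc a) = F i a + 1" and b: "lastmin (F i') b" and ab: "a < b"
  obtains xs ys where "set (map fst xs) \<subseteq> {i, i'}" "set (map fst ys) \<subseteq> {i, i'}"
    "raisable ((i, a) # xs) F" "raisable ((i', b) # ys) F"
    "raised ((i, a) # xs) F = raised ((i', b) # ys) F"
proof -
  have c: "cartan i i = -2" "cartan i' i' = -2" "cartan i i' = 1" "cartan i' i = 1"
    using adj by (auto simp: cartan_def)
  define f where "f = F i"
  define g where "g = F i'"
  have f: "f a \<le> f t" "a < t \<Longrightarrow> f a + 1 \<le> f t" for t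
    using lastmin_le[OF a(1), of t] lastmin_less[OF a(1), of t] by (auto simp: f_def)
  have g: "g b \<le> g t" "b < t \<Longrightarrow> g b + 1 \<le> g t" for t
    using lastmin_le[OF b, of t] lastmin_less[OF b, of t] by (auto simp: g_def)
  have lf: "lastmin (\<lambda>t. f t + step b t) a"
    using f ab by (intro lastminI) (auto simp: step_def add1_zle_eq intro: le_less_trans)
  \<comment> \<open>If no value of \<open>g\<close> up to \<open>a\<close> ties with the minimum
    \<open>g b\<close>, the flip at \<open>a\<close> cannot move the last minimum \<open>b\<close>,
    and the operators commute.\<close>
  show ?thesis
  proof (cases "\<forall>t\<le>a. g b + 1 \<le> g t")
    case True
    have "lastmin (\<lambda>t. g t + step a t) b"
      using g True ab by (intro lastminI) (force simp: step_def)+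
    then show ?thesis using a(1) b lf
      by (intro that[of "[(i', b)]" "[(i, a)]"]) (auto simp: c f_def g_def fun_eq_iff)
  next
    case False
    then obtain t0 where "t0 \<le> a" "\<not> g b + 1 \<le> g t0" by blast
    then have "g t0 = g b" "t0 \<le> a" using g(1)[of t0] by auto
    \<comment> \<open>The last tie up to \<open>a\<close>: after the flip at \<open>a\<close>, which
      lifts \<open>g\<close> beyond \<open>a\<close>, it becomes the last minimum of
      \<open>g\<close>. Similarly \<open>a'\<close> below, the last point up to \<open>b\<close>
      where \<open>f\<close> is one above its minimum, is the place of the second flip of index
      \<open>i\<close>.\<close>
    then obtain b' where b': "g b' = g b" "b' \<le> a" "\<And>u. b' < u \<Longrightarrow> u \<le> a \<Longrightarrow> g u \<noteq> g b"
      using last_exists[of "\<lambda>t. g t = g b" t0 a] by metis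
    have "f (Suc a) = f a + 1" "Suc a \<le> b" using a(2) ab by (auto simp: f_def)
    then obtain a' where a': "f a' = f a + 1" "a < a'" "a' \<le> b" "\<And>u. a' < u \<Longrightarrow> u \<le> b \<Longrightarrow> f u \<noteq> f a + 1"
      using last_exists[of "\<lambda>t. f t = f a + 1" "Suc a" b] by (metis Suc_le_eq)
    have g': "g b + 1 \<le> g u" if "b' < u" "u \<le> a" for u using b'(3)[OF that] g(1)[of u] by linarith
    have f': "f a + 2 \<le> f u" if "a' < u" "u \<le> b" for u using a'(4)[OF that] f(2)[of u] a'(2) that by linarith
    have l1: "lastmin (\<lambda>t. g t + step a t) b'"
    proof (rule lastminI)
      fix t assume "b' < t"
      then show "g b' + step a b' < g t + step a t"
        using b' g'[of t] g(1)[of t] by (cases "t \<le> a") (auto simp: step_def)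
    qed (use b' g(1) in \<open>auto simp: step_def\<close>)
    have l2: "lastmin (\<lambda>t. g t + step a t - 2 * step b' t) b"
    proof (rule lastminI)
      fix t
      show "g b + step a b - 2 * step b' b \<le> g t + step a t - 2 * step b' t"
        using b' ab g'[of t] g(1)[of t] by (cases "t \<le> b'"; cases "t \<le> a") (auto simp: step_def)
      show "g b + step a b - 2 * step b' b < g t + step a t - 2 * step b' t" if "b < t"
        using that b' ab g(2)[of t] by (auto simp: step_def)
    qed
    have l3: "lastmin (\<lambda>t. f t - 2 * step a t + step b' t + step b t) a'"
    proof (rule lastminI)
      fix t
      show "f a' - 2 * step a a' + step b' a' + step b a' \<le> f t - 2 * step a t + step b' t + step b t" if "t \<le> a'"
        using that a' b' f(1)[of t] f(2)[of t] by (cases "t \<le> a") (auto simp: step_def)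
      show "f a' - 2 * step a a' + step b' a' + step b a' < f t - 2 * step a t + step b' t + step b t" if "a' < t"
        using that a' b' f(2)[of t] f'[of t] by (cases "t \<le> b") (auto simp: step_def)
    qed
    have l4: "lastmin (\<lambda>t. f t + step b t - 2 * step a t) a'"
    proof (rule lastminI)
      fix t
      show "f a' + step b a' - 2 * step a a' \<le> f t + step b t - 2 * step a t" if "t \<le> a'"
        using that a' f(1)[of t] f(2)[of t] by (cases "t \<le> a") (auto simp: step_def)
      show "f a' + step b a' - 2 * step a a' < f t + step b t - 2 * step a t" if "a' < t"
        using that a' f(2)[of t] f'[of t] by (cases "t \<le> b") (auto simp: step_def)
    qed
    have l5: "lastmin (\<lambda>t. g t - 2 * step b t + step a t + step a' t) b'"
    proof (rule lastminI)
      fix t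
      show "g b' - 2 * step b b' + step a b' + step a' b' \<le> g t - 2 * step b t + step a t + step a' t" if "t \<le> b'"
        using that a' b' ab g(1)[of t] by (auto simp: step_def)
      show "g b' - 2 * step b b' + step a b' + step a' b' < g t - 2 * step b t + step a t + step a' t" if "b' < t"
        using that a' b' ab g'[of t] g[of t] by (cases "t \<le> a"; cases "t \<le> b") (auto simp: step_def)
    qed
    \<comment> \<open>The relation of degree four: both sequences flip index \<open>i\<close> at
      \<open>a\<close> and \<open>a'\<close> and index \<open>i'\<close> at \<open>b\<close> and
      \<open>b'\<close>, in the orders \<open>i, i', i', i\<close> and
      \<open>i', i, i, i'\<close>.\<close>
    show ?thesis
    proof (rule that[of "[(i', b'), (i', b), (i, a')]" "[(i, a), (i, a'), (i', b')]"])
      show "raisable ((i, a) # [(i', b'), (i', b), (i, a')]) F"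
        using a(1) l1 l2 l3 by (simp add: c f_def g_def algebra_simps)
      show "raisable ((i', b) # [(i, a), (i, a'), (i', b')]) F"
        using b lf l4 l5 by (simp add: c f_def g_def algebra_simps)
    qed (auto simp: fun_eq_iff)
  qed
qed

lemma raising_local_confluence:
  assumes c: "(b, c) \<in> raising n l" and d: "(b, d) \<in> raising n l"
  shows "\<exists>u. (c, u) \<in> (raising n l)\<^sup>* \<and> (d, u) \<in> (raising n l)\<^sup>*"
proof -
  let ?F = "\<lambda>j t. ht j b t"
  have b: "b \<in> words n l" using c by (simp add: raising_def)
  obtain i where i: "1 \<le> i" "i \<le> n" "e_op i b = Some c" using c by (auto simp: raising_def)
  obtain i' where i': "1 \<le> i'" "i' \<le> n" "e_op i' b = Some d" using d by (auto simp: raising_def)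
  obtain p where p: "lastmin (ht i b) p" "c \<in> words n l" "\<And>j t. ht j c t = ht j b t + cartan i j * step p t"
    by (rule e_opD[OF i(3) b i(1,2)]) blast
  obtain q where q: "lastmin (ht i' b) q" "d \<in> words n l" "\<And>j t. ht j d t = ht j b t + cartan i' j * step q t"
    by (rule e_opD[OF i'(3) b i'(1,2)]) blast
  have join: ?thesis
    if xs: "set (map fst xs) \<subseteq> {i, i'}" "set (map fst ys) \<subseteq> {i, i'}"
      "raisable ((i, p) # xs) ?F" "raisable ((i', q) # ys) ?F"
      "raised ((i, p) # xs) ?F = raised ((i', q) # ys) ?F" for xs ys
  proof -
    have "\<exists>u. (c, u) \<in> (raising n l)\<^sup>* \<and> u \<in> words n l \<and> (\<lambda>j t. ht j u t) = raised xs (\<lambda>j t. ht j c t)"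
      using xs i i' by (intro raisable_run[OF p(2)]) (auto simp: p(3))
    then obtain u where u: "(c, u) \<in> (raising n l)\<^sup>*" "u \<in> words n l"
      "(\<lambda>j t. ht j u t) = raised xs (\<lambda>j t. ht j c t)" by blast
    have "\<exists>u. (d, u) \<in> (raising n l)\<^sup>* \<and> u \<in> words n l \<and> (\<lambda>j t. ht j u t) = raised ys (\<lambda>j t. ht j d t)"
      using xs i i' by (intro raisable_run[OF q(2)]) (auto simp: q(3))
    then obtain u' where u': "(d, u') \<in> (raising n l)\<^sup>*" "u' \<in> words n l"
      "(\<lambda>j t. ht j u' t) = raised ys (\<lambda>j t. ht j d t)" by blast
    have "(\<lambda>j t. ht j u t) = (\<lambda>j t. ht j u' t)" using u(3) u'(3) xs(5) by (simp add: p(3) q(3))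
    then have "u = u'" using u(2) u'(2) by (intro words_eqI) (auto simp: fun_eq_iff)
    then show ?thesis using u(1) u'(1) by blast
  qed
  consider "i = i'" | "i' = i + 1 \<or> i = i' + 1" | "i \<noteq> i'" "i' \<noteq> i + 1" "i \<noteq> i' + 1" by blast
  then show ?thesis
  proof cases
    case 1
    then show ?thesis using i i' by auto
  next
    case 2
    have "p \<noteq> q" using lastmin_ht(2)[OF p(1)] lastmin_ht(2)[OF q(1)] 2 by auto
    then consider "p < q" | "q < p" by linarith
    then show ?thesis
    proof cases
      case 1
      show ?thesis
        by (rule diamond_less[of i' i ?F p q, OF 2 p(1) lastmin_ht(3)[OF p(1)] q(1) 1]) (rule join)
    next
      case q: 2
      have adj: "i = i' + 1 \<or> i' = i + 1" using \<open>i' = i + 1 \<or> i = i' + 1\<close> by blast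
      show ?thesis
      proof (rule diamond_less[of i i' ?F q p, OF adj _ lastmin_ht(3) _ q])
        fix xs ys assume xs: "set (map fst xs) \<subseteq> {i', i}" "set (map fst ys) \<subseteq> {i', i}"
          "raisable ((i', q) # xs) ?F" "raisable ((i, p) # ys) ?F"
          "raised ((i', q) # xs) ?F = raised ((i, p) # ys) ?F"
        show ?thesis by (rule join[of ys xs]) (use xs in auto)
      qed fact+
    qed
  next
    case 3
    then have "cartan i i' = 0" "cartan i' i = 0" by (auto simp: cartan_def)
    then show ?thesis using p(1) q(1)
      by (intro join[of "[(i', q)]" "[(i, p)]"]) (auto simp: fun_eq_iff)
  qed
qed

section \<open>Confluence and uniqueness of highest weight elements\<close>

text \<open>Newman's lemma: termination and local confluence give confluence, and then zigzags can
  be closed step by step.\<close>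

lemma newman:
  assumes wf: "wf (R\<inverse>)"
    and loc: "\<And>x y z. (x, y) \<in> R \<Longrightarrow> (x, z) \<in> R \<Longrightarrow> \<exists>u. (y, u) \<in> R\<^sup>* \<and> (z, u) \<in> R\<^sup>*"
    and xy: "(x, y) \<in> (R \<union> R\<inverse>)\<^sup>*"
  shows "\<exists>u. (x, u) \<in> R\<^sup>* \<and> (y, u) \<in> R\<^sup>*"
proof -
  have conf: "\<exists>u. (y, u) \<in> R\<^sup>* \<and> (z, u) \<in> R\<^sup>*" if "(x, y) \<in> R\<^sup>*" "(x, z) \<in> R\<^sup>*" for x y z
    using that
  proof (induction x arbitrary: y z rule: wf_induct_rule[OF wf])
    case (1 x)
    show ?case
    proof (cases "x = y \<or> x = z")
      case True
      then show ?thesis using 1 by blast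
    next
      case False
      then obtain y1 z1 where y1: "(x, y1) \<in> R" "(y1, y) \<in> R\<^sup>*" and z1: "(x, z1) \<in> R" "(z1, z) \<in> R\<^sup>*"
        using 1(2,3) by (metis converse_rtranclE)
      obtain u where u: "(y1, u) \<in> R\<^sup>*" "(z1, u) \<in> R\<^sup>*" using loc[OF y1(1) z1(1)] by blast
      obtain w where w: "(y, w) \<in> R\<^sup>*" "(u, w) \<in> R\<^sup>*" using 1(1)[of y1] y1 u(1) by blast
      have "(z1, w) \<in> R\<^sup>*" using u(2) w(2) by (rule rtrancl_trans)
      then obtain w' where "(w, w') \<in> R\<^sup>*" "(z, w') \<in> R\<^sup>*" using 1(1)[of z1] z1 by blast
      then show ?thesis using w(1) by (meson rtrancl_trans)
    qed
  qed
  show ?thesis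
    using xy
  proof (induction rule: rtrancl_induct)
    case (step y z)
    then obtain u where u: "(x, u) \<in> R\<^sup>*" "(y, u) \<in> R\<^sup>*" by blast
    from step(2) show ?case
    proof
      assume "(y, z) \<in> R"
      then obtain w where "(u, w) \<in> R\<^sup>*" "(z, w) \<in> R\<^sup>*" using conf[OF u(2), of z] by blast
      then show ?thesis using u by (meson rtrancl_trans)
    next
      assume "(y, z) \<in> R\<inverse>"
      then have "(z, u) \<in> R\<^sup>*" using u(2) by (meson converseD converse_rtrancl_into_rtrancl)
      then show ?thesis using u by blast
    qed
  qed blast
qed

text \<open>Termination: a flip decreases one letter by 1.\<close>

lemma raising_sum_list: "(b, c) \<in> raising n l \<Longrightarrow> sum_list c < sum_list b"
proof -
  assume "(b, c) \<in> raising n l"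
  then obtain i where "e_op i b = Some c" by (auto simp: raising_def)
  then obtain p where p: "lastmin (ht i b) p" "c = b[p := i]" using e_op_iff by blast
  note h = lastmin_ht(1,2)[OF p(1)]
  have "b ! p \<le> sum_list b" using h(1) by (simp add: member_le_sum_list)
  then show "sum_list c < sum_list b" using p(2) h by (simp add: sum_list_update)
qed

lemma wf_raising: "wf ((raising n l)\<inverse>)"
  by (rule wf_subset[OF wf_measure[of sum_list]]) (auto dest: raising_sum_list)

lemma highest_iff:
  assumes "b \<in> words n l"
  shows "highest n b \<longleftrightarrow> (\<forall>c. (b, c) \<notin> raising n l)"
proof
  assume no: "\<forall>c. (b, c) \<notin> raising n l"
  have "e_op i b = None" if i: "i \<in> {1..n}" for i
  proof (rule ccontr)
    assume "e_op i b \<noteq> None"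
    then obtain c where c: "e_op i b = Some c" by blast
    have "c \<in> words n l" by (rule e_opD[OF c assms]) (use i in auto)
    then show False using no c i assms by (auto simp: raising_def)
  qed
  then show "highest n b" by (simp add: highest_def)
qed (auto simp: highest_def raising_def)

abbreviation linked :: "nat \<Rightarrow> nat \<Rightarrow> (nat list \<times> nat list) set" where
  "linked n l \<equiv> (raising n l \<union> (raising n l)\<inverse>)\<^sup>*"

lemma typeA_edges_eq: "typeA_edges n l = (raising n l)\<inverse>"
proof -
  have "(b, c) \<in> typeA_edges n l \<longleftrightarrow> (c, b) \<in> raising n l" for b c
  proof
    assume "(b, c) \<in> typeA_edges n l"
    then obtain i where b: "b \<in> words n l" and i: "i \<in> {1..n}" "f_op i b = Some c"
      by (auto simp: typeA_edges_def)
    have "c \<in> words n l" by (rule f_opD[OF i(2) b]) (use i in auto)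
    then show "(c, b) \<in> raising n l" using b i e_op_iff_f_op by (auto simp: raising_def)
  next
    assume "(c, b) \<in> raising n l"
    then show "(b, c) \<in> typeA_edges n l" using e_op_iff_f_op by (fastforce simp: raising_def typeA_edges_def)
  qed
  then show ?thesis by auto
qed

lemma typeA_comp_iff: "c \<in> typeA_comp n l b \<longleftrightarrow> (b, c) \<in> linked n l"
  by (simp add: typeA_comp_def connected_comp_def typeA_edges_eq Un_commute)

lemma linked_sym: "(b, c) \<in> linked n l \<Longrightarrow> (c, b) \<in> linked n l"
  using sym_rtrancl[OF sym_Un_converse] by (rule symD)

lemma linked_words: "(b, c) \<in> linked n l \<Longrightarrow> b \<in> words n l \<Longrightarrow> c \<in> words n l"
  by (induction rule: rtrancl_induct) (auto simp: raising_def)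

lemma raising_linked: "(b, c) \<in> (raising n l)\<^sup>* \<Longrightarrow> (b, c) \<in> linked n l"
  by (rule rtrancl_mono[THEN subsetD]) auto

lemma linked_join: "(b, c) \<in> linked n l \<Longrightarrow> \<exists>u. (b, u) \<in> (raising n l)\<^sup>* \<and> (c, u) \<in> (raising n l)\<^sup>*"
proof (rule newman[OF wf_raising])
  show "\<exists>u. (y, u) \<in> (raising n l)\<^sup>* \<and> (z, u) \<in> (raising n l)\<^sup>*"
    if "(x, y) \<in> raising n l" "(x, z) \<in> raising n l" for x y z
    using that by (rule raising_local_confluence)
qed

lemma linked_highest:
  assumes "(b, u) \<in> linked n l" "u \<in> words n l" "highest n u"
  shows "(b, u) \<in> (raising n l)\<^sup>*"
proof -
  obtain x where "(b, x) \<in> (raising n l)\<^sup>*" "(u, x) \<in> (raising n l)\<^sup>*"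
    using linked_join[OF assms(1)] by blast
  then show ?thesis using assms(2,3) highest_iff by (metis converse_rtranclE)
qed

lemma highest_unique:
  assumes "(u, u') \<in> linked n l" "u \<in> words n l" "highest n u" "highest n u'"
  shows "u = u'"
  using linked_highest[OF assms(1) linked_words[OF assms(1,2)] assms(4)] assms(2,3) highest_iff
  by (metis converse_rtranclE)

lemma highest_exists:
  assumes "b \<in> words n l"
  shows "\<exists>u. (b, u) \<in> (raising n l)\<^sup>* \<and> highest n u"
  using assms
proof (induction b rule: wf_induct_rule[OF wf_raising[of n l]])
  case (1 b)
  show ?case
  proof (cases "highest n b")
    case False
    then obtain c where c: "(b, c) \<in> raising n l" using highest_iff 1(2) by blast
    then have "c \<in> words n l" by (simp add: raising_def)
    then show ?thesis using 1(1)[of c] c by (meson converseI converse_rtrancl_into_rtrancl)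
  qed auto
qed

lemma up_eqI:
  assumes "b \<in> words n l" "(b, u) \<in> linked n l" "highest n u"
  shows "up n l b = u"
  unfolding up_def typeA_comp_iff
proof (rule the_equality)
  fix u' assume u': "(b, u') \<in> linked n l \<and> highest n u'"
  then have "(u', u) \<in> linked n l" using linked_sym assms(2) by (meson rtrancl_trans)
  then show "u' = u" using highest_unique u' assms linked_words by blast
qed (use assms in auto)

lemma up_linked:
  assumes "b \<in> words n l"
  shows "(b, up n l b) \<in> linked n l" "highest n (up n l b)" "up n l b \<in> words n l"
proof -
  obtain u where u: "(b, u) \<in> linked n l" "highest n u"
    using highest_exists[OF assms] raising_linked by blast
  moreover have "up n l b = u" using up_eqI assms u by blast
  ultimately show "(b, up n l b) \<in> linked n l" "highest n (up n l b)" "up n l b \<in> words n l"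
    using linked_words assms by auto
qed

subsection \<open>The duality exchanging highest and lowest weight elements\<close>

text \<open>The reverse complement. It turns \<open>e_i\<close> into \<open>f_(n+1-i)\<close>, so
  the results on highest weight elements carry over to lowest weight elements.\<close>

definition dual :: "nat \<Rightarrow> nat list \<Rightarrow> nat list" where
  "dual n b = rev (map (\<lambda>x. n + 2 - x) b)"

lemma dual_words: "b \<in> words n l \<Longrightarrow> dual n b \<in> words n l"
  by (force simp: words_def dual_def)

lemma dual_dual: "b \<in> words n l \<Longrightarrow> dual n (dual n b) = b"
proof -
  assume "b \<in> words n l"
  then have "map (\<lambda>x. n + 2 - (n + 2 - x)) b = b" by (intro map_idI) (force simp: words_def)
  then show ?thesis by (simp add: dual_def rev_map o_def)
qed

lemma count_list_map_diff:
  fixes n a :: nat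
  shows "set b \<subseteq> {1..n+1} \<Longrightarrow> 1 \<le> a \<Longrightarrow> a \<le> n + 1 \<Longrightarrow>
     count_list (map (\<lambda>x. n + 2 - x) b) a = count_list b (n + 2 - a)"
  by (induction b) auto

text \<open>A prefix of the dual comes from a suffix of \<open>b\<close>, whose content is the total
  content minus that of a prefix.\<close>

lemma ht_dual:
  assumes b: "b \<in> words n l" and i: "1 \<le> i" "i \<le> n"
  shows "ht i (dual n b) t = ht (n + 1 - i) b (l - t) - ht (n + 1 - i) b l"
proof -
  have l: "length b = l" and s: "set b \<subseteq> {1..n+1}" using b by (auto simp: words_def)
  have "count_list (take t (dual n b)) a = count_list (drop (l - t) b) (n + 2 - a)"
    if "1 \<le> a" "a \<le> n + 1" for a
  proof -
    have "take t (dual n b) = rev (map (\<lambda>x. n + 2 - x) (drop (l - t) b))"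
      by (simp add: dual_def take_rev drop_map l)
    then show ?thesis using count_list_map_diff[of "drop (l - t) b" n a] that s set_drop_subset[of "l - t" b]
      by (simp add: count_list_rev)
  qed
  moreover have "count_list b a = count_list (take (l - t) b) a + count_list (drop (l - t) b) a" for a
    by (metis append_take_drop_id count_list_append)
  ultimately show ?thesis using i l by (simp add: ht_def Suc_diff_le)
qed

lemma raising_dual:
  assumes "(b, c) \<in> raising n l"
  shows "(dual n c, dual n b) \<in> raising n l"
proof -
  obtain i where b: "b \<in> words n l" "c \<in> words n l" and i: "1 \<le> i" "i \<le> n" "e_op i b = Some c"
    using assms by (auto simp: raising_def)
  obtain p where p: "lastmin (ht i b) p" "c = b[p := i]" using i(3) e_op_iff by blast
  define i' where "i' = n + 1 - i"
  have i': "1 \<le> i'" "i' \<le> n" "n + 1 - i' = i" "i' + 1 = n + 2 - i" using i by (auto simp: i'_def)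
  have l: "length b = l" using b by (simp add: words_def)
  have pl: "p < l" using lastmin_ht(1)[OF p(1)] l by simp
  define p' where "p' = l - 1 - p"
  have ht: "ht i' (dual n b) t = ht i b (l - t) - ht i b l" for t
    using ht_dual[OF b(1) i'(1,2), of t] i'(3) by simp
  have "l - Suc p' = p" using pl by (simp add: p'_def)
  then have "firstmin (ht i' (dual n b)) p'"
    using p(1) pl by (intro firstminI) (auto simp: ht lastmin_def p'_def)
  moreover have "dual n c = (dual n b)[p' := i' + 1]"
    using pl l i'(4) by (simp add: dual_def p(2) map_update rev_update p'_def)
  ultimately have "f_op i' (dual n b) = Some (dual n c)" using f_op_iff by blast
  then have "e_op i' (dual n c) = Some (dual n b)" using e_op_iff_f_op dual_words b by blast
  then show ?thesis using dual_words b i' by (auto simp: raising_def)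
qed

lemma raising_rtrancl_dual: "(b, c) \<in> (raising n l)\<^sup>* \<Longrightarrow> (dual n c, dual n b) \<in> (raising n l)\<^sup>*"
  by (induction rule: rtrancl_induct) (auto dest: raising_dual intro: converse_rtrancl_into_rtrancl)

lemma linked_dual: "(b, c) \<in> linked n l \<Longrightarrow> (dual n b, dual n c) \<in> linked n l"
proof (induction rule: rtrancl_induct)
  case (step y z)
  then have "(dual n y, dual n z) \<in> raising n l \<union> (raising n l)\<inverse>" using raising_dual by blast
  then show ?case using step.IH by (meson rtrancl.rtrancl_into_rtrancl)
qed simp

lemma lowest_dual:
  assumes v: "v \<in> words n l" "lowest n v"
  shows "highest n (dual n v)"
proof -
  have "(dual n v, c) \<notin> raising n l" for c
  proof
    assume "(dual n v, c) \<in> raising n l"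
    then have "(dual n c, v) \<in> raising n l" using raising_dual dual_dual v by metis
    then obtain i where "i \<in> {1..n}" "e_op i (dual n c) = Some v" "dual n c \<in> words n l"
      by (auto simp: raising_def)
    then show False using v e_op_iff_f_op[of "dual n c" n l v i] by (simp add: lowest_def)
  qed
  then show ?thesis using highest_iff dual_words v by blast
qed

lemma linked_lowest:
  assumes "(v, b) \<in> linked n l" "v \<in> words n l" "lowest n v"
  shows "(v, b) \<in> (raising n l)\<^sup>*"
proof -
  have "(dual n b, dual n v) \<in> linked n l" using linked_dual linked_sym assms by blast
  then have "(dual n b, dual n v) \<in> (raising n l)\<^sup>*"
    using linked_highest lowest_dual dual_words assms by blast
  then have "(dual n (dual n v), dual n (dual n b)) \<in> (raising n l)\<^sup>*" by (rule raising_rtrancl_dual)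
  then show ?thesis using dual_dual linked_words assms by metis
qed

lemma lowest_unique:
  assumes "(v, v') \<in> linked n l" "v \<in> words n l" "lowest n v" "lowest n v'"
  shows "v = v'"
proof -
  have v': "v' \<in> words n l" using linked_words assms by blast
  then have "dual n v = dual n v'"
    using highest_unique linked_dual lowest_dual dual_words assms by blast
  then show ?thesis using dual_dual assms v' by metis
qed

lemma lowest_of_up:
  assumes "v \<in> words n l" "lowest n v"
  shows "lowest_of n l (up n l v) = v"
  unfolding lowest_of_def
proof (rule the_equality)
  fix v' assume v': "v' \<in> words n l \<and> lowest n v' \<and> up n l v' = up n l v"
  then have "(v', up n l v) \<in> linked n l" using up_linked(1) by metis
  then have "(v', v) \<in> linked n l" using up_linked(1)[OF assms(1)] linked_sym by (meson rtrancl_trans)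
  then show "v' = v" using lowest_unique v' assms by blast
qed (use assms in simp)

section \<open>Weights\<close>

lemma count_list_update:
  "p < length b \<Longrightarrow>
     int (count_list (b[p := x]) a) = int (count_list b a) + (if x = a then 1 else 0) - (if b ! p = a then 1 else 0)"
proof (induction b arbitrary: p)
  case (Cons y b)
  show ?case
  proof (cases p)
    case (Suc p')
    then have "int (count_list (b[p' := x]) a) =
        int (count_list b a) + (if x = a then 1 else 0) - (if b ! p' = a then 1 else 0)"
      using Cons by simp
    then show ?thesis using Suc by (cases "y = a"; cases "x = a"; cases "b ! p' = a") simp_all
  qed simp
qed simp

lemma wt_update:
  assumes "p < length b" "b ! p = y"
  shows "wt (b[p := x]) a = wt b a + eps x a - eps y a"
  using count_list_update[OF assms(1), of x a] assms(2) by (auto simp: wt_def eps_def)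

lemma wt_e_op: "e_op i b = Some c \<Longrightarrow> wt c a = wt b a + eps i a - eps (i + 1) a"
  using lastmin_ht[of i b] wt_update[of _ b "i + 1" i a] by (auto simp: e_op_iff)

lemma wt_f_op: "f_op i b = Some c \<Longrightarrow> wt c a = wt b a + eps (i + 1) a - eps i a"
  using firstmin_ht[of i b] wt_update[of _ b i "i + 1" a] by (auto simp: f_op_iff)

lemma wt_f_neg: "f_neg b = Some c \<Longrightarrow> wt c a = wt b a + eps 2 a - eps 1 a"
  using wt_update[of _ b 1 2 a] by (auto simp: f_neg_iff_nth)

lemma wt_e_prod:
  assumes "a \<le> Suc c" "e_prod a c (Some b) = Some d"
  shows "wt d x = wt b x + eps a x - eps (c + 1) x"
  using assms
proof (induction "Suc c - a" arbitrary: a d)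
  case 0
  then show ?case by (auto simp: e_prod_empty)
next
  case (Suc m)
  then have ac: "a \<le> c" by simp
  then obtain d0 where d0: "e_prod (Suc a) c (Some b) = Some d0" "e_op a d0 = Some d"
    using Suc.prems(2) by (auto simp: e_prod_step bind_eq_Some_conv)
  then show ?case using Suc.hyps(1)[of "Suc a" d0] Suc.hyps(2) ac wt_e_op[OF d0(2), of x] by simp
qed

lemma ht_length: "ht i b (length b) = wt b (i + 1) - wt b i"
  by (simp add: ht_def wt_def)

text \<open>Each \<open>f_i\<close> raises the minimum of height \<open>i\<close> by 1, so a value
  at most \<open>- int s\<close> permits \<open>s\<close> applications.\<close>

lemma f_op_iterate:
  assumes "b \<in> words n l" "1 \<le> i" "i \<le> n" "\<exists>t. ht i b t \<le> - int s"
  shows "\<exists>c. (b, c) \<in> linked n l \<and> (\<forall>a. wt c a = wt b a + int s * (eps (i + 1) a - eps i a))"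
  using assms(1,4)
proof (induction s arbitrary: b)
  case (Suc s)
  then obtain t where t: "ht i b t \<le> - int (Suc s)" by blast
  then have "f_op i b \<noteq> None" unfolding f_op_None_iff by (auto simp: not_le intro: exI[of _ t])
  then obtain c where c: "f_op i b = Some c" by blast
  obtain p where p: "firstmin (ht i b) p" "c \<in> words n l" "\<And>j t. ht j c t = ht j b t - cartan i j * step p t"
    by (rule f_opD[OF c Suc.prems(1) assms(2,3)]) blast
  have "ht i b (Suc p) \<le> ht i b t" using p(1) by (cases "t \<le> p") (auto simp: firstmin_def)
  then have "ht i c p \<le> - int s" using firstmin_ht(3)[OF p(1)] t by (simp add: p(3) step_def)
  then obtain d where d: "(c, d) \<in> linked n l" "\<And>a. wt d a = wt c a + int s * (eps (i + 1) a - eps i a)"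
    using Suc.IH[OF p(2)] by blast
  have "(c, b) \<in> raising n l"
    using c p(2) Suc.prems(1) assms(2,3) e_op_iff_f_op[OF p(2) Suc.prems(1)] by (auto simp: raising_def)
  then have "(b, d) \<in> linked n l" using d(1) by (meson UnI2 converseI converse_rtrancl_into_rtrancl)
  then show ?case using d(2) wt_f_op[OF c] by (intro exI[of _ d]) (auto simp: algebra_simps)
qed auto

lemma e_op_iterate:
  assumes "b \<in> words n l" "1 \<le> i" "i \<le> n" "\<exists>t. int s \<le> ht i b l - ht i b t"
  shows "\<exists>c. (b, c) \<in> linked n l \<and> (\<forall>a. wt c a = wt b a + int s * (eps i a - eps (i + 1) a))"
  using assms(1,4)
proof (induction s arbitrary: b)
  case (Suc s)
  then obtain t where t: "int (Suc s) \<le> ht i b l - ht i b t" by blast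
  have l: "length b = l" using Suc.prems(1) by (simp add: words_def)
  then have "e_op i b \<noteq> None" using t unfolding e_op_None_iff by (auto simp: not_le intro: exI[of _ t])
  then obtain c where c: "e_op i b = Some c" by blast
  obtain p where p: "lastmin (ht i b) p" "c \<in> words n l" "\<And>j t. ht j c t = ht j b t + cartan i j * step p t"
    by (rule e_opD[OF c Suc.prems(1) assms(2,3)]) blast
  have "int s \<le> ht i c l - ht i c (Suc p)"
    using lastmin_ht[OF p(1)] lastmin_le[OF p(1), of t] t l by (simp add: p(3) step_def)
  then obtain d where d: "(c, d) \<in> linked n l" "\<And>a. wt d a = wt c a + int s * (eps i a - eps (i + 1) a)"
    using Suc.IH[OF p(2)] by blast
  have "(b, c) \<in> raising n l" using c p(2) Suc.prems(1) assms(2,3) by (auto simp: raising_def)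
  then have "(b, d) \<in> linked n l" using d(1) by (meson UnI1 converse_rtrancl_into_rtrancl)
  then show ?case using d(2) wt_e_op[OF c] by (intro exI[of _ d]) (auto simp: algebra_simps)
qed auto

text \<open>Reflection of the \<open>i\<close>-string. The final height is the difference of the two
  multiplicities, so \<open>f_i\<close> or \<open>e_i\<close> can be applied as often as exchanging
  them requires.\<close>

lemma weight_swap:
  assumes "b \<in> words n l" "1 \<le> i" "i \<le> n"
  shows "\<exists>c. (b, c) \<in> linked n l \<and>
    (\<forall>a. wt c a = wt b (if a = i then i + 1 else if a = i + 1 then i else a))"
proof -
  have e: "ht i b l = wt b (i + 1) - wt b i" using ht_length[of i b] assms(1) by (simp add: words_def)
  show ?thesis
  proof (cases "wt b (i + 1) \<le> wt b i")
    case True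
    then have s: "int (nat (wt b i - wt b (i + 1))) = wt b i - wt b (i + 1)" by simp
    have "\<exists>t. ht i b t \<le> - int (nat (wt b i - wt b (i + 1)))" unfolding s using e by (intro exI[of _ l]) simp
    from f_op_iterate[OF assms this] show ?thesis unfolding s by (auto simp: eps_def)
  next
    case False
    then have s: "int (nat (wt b (i + 1) - wt b i)) = wt b (i + 1) - wt b i" by simp
    have "\<exists>t. int (nat (wt b (i + 1) - wt b i)) \<le> ht i b l - ht i b t" unfolding s using e
      by (intro exI[of _ 0]) simp
    from e_op_iterate[OF assms this] show ?thesis unfolding s by (auto simp: eps_def)
  qed
qed

lemma rev_closed_adjacent_swaps:
  assumes swap: "\<And>xs x y ys. xs @ x # y # ys \<in> X \<Longrightarrow> xs @ y # x # ys \<in> X" and "zs \<in> X"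
  shows "rev zs \<in> X"
proof -
  have move: "us @ xs @ [x] \<in> X" if "us @ x # xs \<in> X" for us x xs
    using that
  proof (induction xs arbitrary: us)
    case (Cons y xs)
    then show ?case using Cons.IH[of "us @ [y]"] swap[of us x y xs] by simp
  qed simp
  have "us @ rev xs \<in> X" if "us @ xs \<in> X" for us xs
    using that
  proof (induction xs arbitrary: us)
    case (Cons x xs)
    then have "(us @ [x]) @ rev xs \<in> X" by (intro Cons.IH) simp
    then show ?case using move[of us x "rev xs"] by simp
  qed simp
  from this[of "[]" zs] show ?thesis using assms(2) by simp
qed

text \<open>The attained weights, encoded as lists \<open>wl\<close>, are closed under adjacent
  exchanges, and these generate the reversal.\<close>

lemma weight_reverse:
  assumes b: "b \<in> words n l"
  shows "\<exists>c. (b, c) \<in> linked n l \<and> (\<forall>a\<in>{1..n+1}. wt c a = wt b (n + 2 - a))"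
proof -
  define wl where "wl b = map (\<lambda>k. wt b (k + 1)) [0..<n+1]" for b
  define X where "X = {wl c |c. (b, c) \<in> linked n l}"
  have swap: "xs @ y # x # ys \<in> X" if X: "xs @ x # y # ys \<in> X" for xs x y ys
  proof -
    obtain c where c: "(b, c) \<in> linked n l" "wl c = xs @ x # y # ys" using X by (fastforce simp: X_def)
    define i where "i = length xs + 1"
    have len: "length xs + 2 + length ys = n + 1"
      using arg_cong[OF c(2), of length] by (simp add: wl_def)
    then have i: "1 \<le> i" "i \<le> n" by (simp_all add: i_def)
    obtain d where d: "(c, d) \<in> linked n l"
      "\<And>a. wt d a = wt c (if a = i then i + 1 else if a = i + 1 then i else a)"
      using weight_swap[OF linked_words[OF c(1) b] i] by blast
    have nth: "wt c (k + 1) = (xs @ x # y # ys) ! k" if "k < n + 1" for k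
      using that unfolding c(2)[symmetric] wl_def by (subst nth_map) (simp_all del: upt_Suc)
    have "wl d = xs @ y # x # ys"
    proof (rule nth_equalityI)
      fix k assume "k < length (wl d)"
      then have k: "k < n + 1" by (simp add: wl_def)
      then have "wl d ! k = wt d (k + 1)" by (simp add: wl_def del: upt_Suc)
      also have "\<dots> = (xs @ y # x # ys) ! k"
        using d(2)[of "k + 1"] nth[of k] nth[of "length xs"] nth[of "length xs + 1"] k len
        by (auto simp: i_def nth_append nth_Cons split: nat.split)
      finally show "wl d ! k = (xs @ y # x # ys) ! k" .
    qed (use len in \<open>simp add: wl_def\<close>)
    moreover have "(b, d) \<in> linked n l" using c(1) d(1) by (rule rtrancl_trans)
    ultimately show ?thesis unfolding X_def by (metis (mono_tags, lifting) mem_Collect_eq)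
  qed
  have "wl b \<in> X" by (auto simp: X_def)
  then have "rev (wl b) \<in> X" using rev_closed_adjacent_swaps swap by blast
  then obtain c where c: "(b, c) \<in> linked n l" "wl c = rev (wl b)" by (fastforce simp: X_def)
  have "wt c a = wt b (n + 2 - a)" if "a \<in> {1..n+1}" for a
  proof -
    have "wl c ! (a - 1) = wt c a" "rev (wl b) ! (a - 1) = wt b (n + 2 - a)"
      using that by (auto simp: wl_def rev_nth Suc_diff_le simp del: upt_Suc)
    then show ?thesis using c(2) by simp
  qed
  then show ?thesis using c(1) by blast
qed

text \<open>An \<open>e_i\<close> moves one unit from \<open>i + 1\<close> to \<open>i\<close>, so
  only the partial sum up to \<open>i\<close> grows: raising goes up in dominance order.\<close>

lemma raising_prefix_weight:
  assumes "(b, c) \<in> (raising n l)\<^sup>*"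
  shows "(\<Sum>x\<in>{1..a}. wt b x) \<le> (\<Sum>x\<in>{1..a}. wt c x)"
    and "(\<Sum>x\<in>{1..n+1}. wt b x) = (\<Sum>x\<in>{1..n+1}. wt c x)"
proof -
  have *: "(\<Sum>x\<in>{1..a}. wt c x) = (\<Sum>x\<in>{1..a}. wt b x) + (if a = i then 1 else 0)"
    if "e_op i b = Some c" "1 \<le> i" for b c i a
  proof -
    have "(\<Sum>x\<in>{1..a}. wt c x) = (\<Sum>x\<in>{1..a}. wt b x) + (\<Sum>x\<in>{1..a}. eps i x) - (\<Sum>x\<in>{1..a}. eps (i + 1) x)"
      by (simp add: wt_e_op[OF that(1)] sum.distrib sum_subtractf)
    then show ?thesis using that(2) by (auto simp: eps_def)
  qed
  show "(\<Sum>x\<in>{1..a}. wt b x) \<le> (\<Sum>x\<in>{1..a}. wt c x)"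
    using assms
  proof (induction rule: rtrancl_induct)
    case (step y z)
    then obtain i where "i \<in> {1..n}" "e_op i y = Some z" by (auto simp: raising_def)
    then show ?case using step.IH *[of i y z a] by auto
  qed simp
  show "(\<Sum>x\<in>{1..n+1}. wt b x) = (\<Sum>x\<in>{1..n+1}. wt c x)"
    using assms
  proof (induction rule: rtrancl_induct)
    case (step y z)
    then obtain i where "i \<in> {1..n}" "e_op i y = Some z" by (auto simp: raising_def)
    then show ?case using step.IH *[of i y z "n + 1"] by auto
  qed simp
qed

lemma sum_reverse:
  fixes f :: "nat \<Rightarrow> int"
  assumes "a \<le> n + 1"
  shows "(\<Sum>x\<in>{1..a}. f (n + 2 - x)) = (\<Sum>x\<in>{1..n+1}. f x) - (\<Sum>x\<in>{1..n+1-a}. f x)"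
proof -
  have "(\<Sum>x\<in>{1..a}. f (n + 2 - x)) = (\<Sum>x\<in>{n+2-a..n+1}. f x)"
    by (rule sum.reindex_bij_witness[of _ "\<lambda>x. n + 2 - x" "\<lambda>x. n + 2 - x"]) (use assms in auto)
  moreover have "{1..n+1} = {1..n+1-a} \<union> {n+2-a..n+1}" using assms by auto
  then have "(\<Sum>x\<in>{1..n+1}. f x) = (\<Sum>x\<in>{1..n+1-a}. f x) + (\<Sum>x\<in>{n+2-a..n+1}. f x)"
    by (simp only:) (rule sum.union_disjoint, auto)
  ultimately show ?thesis by simp
qed

text \<open>
  The weights of a component are closed under permutations, and in dominance order they lie between
  the weights of the lowest and of the highest weight element.
\<close>

lemma wt_up_lowest:
  assumes v: "v \<in> words n l" "lowest n v" and a: "a \<in> {1..n+1}"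
  shows "wt (up n l v) a = wt v (n + 2 - a)"
proof -
  define u where "u = up n l v"
  have u: "(v, u) \<in> linked n l" "highest n u" "u \<in> words n l" using up_linked[OF v(1)] by (auto simp: u_def)
  obtain b where b: "(v, b) \<in> linked n l" "\<And>a. a \<in> {1..n+1} \<Longrightarrow> wt b a = wt v (n + 2 - a)"
    using weight_reverse[OF v(1)] by blast
  obtain c where c: "(u, c) \<in> linked n l" "\<And>a. a \<in> {1..n+1} \<Longrightarrow> wt c a = wt u (n + 2 - a)"
    using weight_reverse[OF u(3)] by blast
  have "(b, u) \<in> linked n l" using b(1) u(1) linked_sym by (meson rtrancl_trans)
  then have bu: "(b, u) \<in> (raising n l)\<^sup>*" using linked_highest u by blast
  have "(v, c) \<in> linked n l" using u(1) c(1) by (rule rtrancl_trans)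
  then have vc: "(v, c) \<in> (raising n l)\<^sup>*" using linked_lowest v by blast
  have vu: "(v, u) \<in> (raising n l)\<^sup>*" using linked_lowest u v by blast
  define S where "S w a = (\<Sum>x\<in>{1..a}. wt w x)" for w a
  have T: "S v (n + 1) = S u (n + 1)" using raising_prefix_weight(2)[OF vu] by (simp add: S_def)
  have Sb: "S b a = S v (n + 1) - S v (n + 1 - a)" if "a \<le> n + 1" for a
    using sum_reverse[OF that, of "wt v"] b(2) that by (simp add: S_def)
  have Sc: "S c a = S u (n + 1) - S u (n + 1 - a)" if "a \<le> n + 1" for a
    using sum_reverse[OF that, of "wt u"] c(2) that by (simp add: S_def)
  \<comment> \<open>The word \<open>b\<close> carries the reversed weight of \<open>v\<close> and
    lies below \<open>u\<close>; the word \<open>c\<close> carries the reversed weight of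
    \<open>u\<close> and lies above \<open>v\<close>. Passing to complementary sums, these are
    opposite inequalities.\<close>
  have eq: "S u a = S b a" if "a \<le> n + 1" for a
  proof (rule antisym)
    have "S v (n + 1 - a) \<le> S c (n + 1 - a)" using raising_prefix_weight(1)[OF vc] by (simp add: S_def)
    then show "S u a \<le> S b a" using Sb[OF that] Sc[of "n + 1 - a"] T that by simp
    show "S b a \<le> S u a" using raising_prefix_weight(1)[OF bu] by (simp add: S_def)
  qed
  obtain a' where a': "a = Suc a'" using a by (cases a) auto
  have "wt u a = wt b a" using eq[of a] eq[of a'] a a' by (simp add: S_def)
  then show ?thesis using b(2)[OF a] by (simp add: u_def)
qed

section \<open>Edges of the component graph\<close>

lemma f_op_raising:
  assumes "f_op i b = Some c" "b \<in> words n l" "1 \<le> i" "i \<le> n"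
  shows "(c, b) \<in> raising n l"
proof -
  have "c \<in> words n l" by (rule f_opD[OF assms])
  then show ?thesis using assms e_op_iff_f_op by (auto simp: raising_def)
qed

text \<open>For \<open>i \<le> 2\<close> the letter changed by \<open>f_i\<close> lies strictly
  after the letter \<open>s\<close> changed by \<open>f_neg\<close>, so the operators commute; for
  larger \<open>i\<close> neither affects the heights deciding the other. For \<open>i = 1\<close>,
  \<open>f_neg\<close> adds 2 to height 1 beyond \<open>s\<close>, and the bound -2 keeps its
  minimum negative.\<close>

lemma f_op_f_neg:
  assumes b: "b1 \<in> words n l" "f_neg b1 = Some b2" and i: "1 \<le> i" "i \<le> n"
    and low: "i \<noteq> 1 \<and> (\<exists>t. ht i b1 t < 0) \<or> i = 1 \<and> (\<exists>t. ht 1 b1 t < -2)"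
  shows "\<exists>c1 c2. f_op i b1 = Some c1 \<and> f_op i b2 = Some c2 \<and> f_neg c1 = Some c2 \<and>
    c1 \<in> words n l \<and> b2 \<in> words n l"
proof -
  have n: "n \<ge> 1" using i by simp
  obtain s where s: "\<And>t. t \<le> s \<Longrightarrow> ht 0 b1 t = 0 \<and> ht 1 b1 t = 0" "ht 0 b1 (Suc s) = 1"
    and b2: "b2 \<in> words n l" "\<And>j t. ht j b2 t = ht j b1 t - cartan 1 j * step s t"
    by (rule f_neg_D[OF b(2,1) n]) blast
  have s1: "b1 ! s = 1" "s < length b1"
    using s(1)[of s] s(2) by (auto simp: ht_Suc split: if_splits)
  have ht2: "t \<le> Suc s \<Longrightarrow> 0 \<le> ht 2 b1 t" for t
  proof (induction t)
    case (Suc t)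
    have "b1 ! t \<noteq> 2" if "t < length b1"
    proof (cases "t = s")
      case False
      then have "ht 1 b1 (Suc t) = ht 1 b1 t" using s(1)[of t] s(1)[of "Suc t"] Suc.prems by simp
      then show ?thesis using that by (auto simp: ht_Suc)
    qed (use s1 in simp)
    then show ?case using Suc by (auto simp: ht_Suc)
  qed simp
  obtain t0 where t0: "ht i b1 t0 < (if i = 1 then -2 else 0)" using low by auto
  then have "ht i b1 t0 < 0" by (auto split: if_splits)
  then have "f_op i b1 \<noteq> None" unfolding f_op_None_iff by (auto simp: not_le)
  then obtain c1 where c1: "f_op i b1 = Some c1" by blast
  obtain p where p: "firstmin (ht i b1) p" and c1w: "c1 \<in> words n l"
    and ht_c1: "\<And>j t. ht j c1 t = ht j b1 t - cartan i j * step p t"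
    by (rule f_opD[OF c1 b(1) i]) blast
  have less: "t \<le> p \<Longrightarrow> ht i b1 (Suc p) < ht i b1 t" and le: "p < t \<Longrightarrow> ht i b1 (Suc p) \<le> ht i b1 t" for t
    using p by (auto simp: firstmin_def)
  have m: "ht i b1 (Suc p) < (if i = 1 then -2 else 0)"
    using less[of t0] le[of t0] t0 by linarith
  have ps: "s < p" if i2: "i \<le> 2"
  proof -
    consider "i = 1" | "i = 2" using i2 i by linarith
    then have "\<not> Suc p \<le> Suc s"
    proof cases
      case 1
      have "- 1 \<le> ht 1 b1 (Suc s)" using s(1)[of s] by (auto simp: ht_Suc)
      then show ?thesis using 1 m s(1)[of "Suc p"] by (auto simp: le_Suc_eq)
    next
      case 2
      then show ?thesis using m ht2[of "Suc p"] by auto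
    qed
    then show ?thesis by simp
  qed
  have "firstmin (ht i b2) p"
  proof -
    consider "i = 1" | "i = 2" | "i > 2" using i by linarith
    then show ?thesis
    proof cases
      case 1
      have "ht 1 b2 t = ht 1 b1 t + 2 * step s t" for t by (simp add: b2(2) cartan_def)
      moreover have "ht 1 b1 t = 0" if "t \<le> s" for t using s(1) that by simp
      ultimately show ?thesis using less le m ps 1
        by (intro firstminI) (auto simp: step_def)
    next
      case 2
      have e: "ht i b2 t = ht i b1 t - step s t" for t using 2 by (simp add: b2(2) cartan_def)
      have m: "ht i b1 (Suc p) < 0" "s < p" using m ps 2 by auto
      have ht2': "0 \<le> ht i b1 t" if "t \<le> s" for t using ht2 that 2 by simp
      show ?thesis
      proof (rule firstminI)
        fix t
        show "ht i b2 (Suc p) < ht i b2 t" if "t \<le> p"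
          using less[OF that] ht2'[of t] m by (cases "t \<le> s") (auto simp: e step_def)
        show "ht i b2 (Suc p) \<le> ht i b2 t" if "p < t"
          using le[OF that] m that by (simp add: e step_def)
      qed
    next
      case 3
      then have "ht i b2 = ht i b1" by (auto simp: fun_eq_iff b2(2) cartan_def)
      then show ?thesis using p by simp
    qed
  qed
  then obtain c2 where c2: "f_op i b2 = Some c2" "c2 \<in> words n l"
    "\<And>j t. ht j c2 t = ht j b2 t - cartan i j * step p t"
    by (rule f_opI[OF _ b2(1) i]) blast
  have 0: "cartan i 0 * step p t = 0 \<and> cartan i 1 * step p t = 0" if "t \<le> Suc s" for t
    using ps that by (cases "i \<le> 2") (auto simp: cartan_def step_def)
  obtain d where d: "f_neg c1 = Some d" "d \<in> words n l" "\<And>j t. ht j d t = ht j c1 t - cartan 1 j * step s t"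
    by (rule f_neg_I[OF c1w n, of s]) (use s 0 in \<open>auto simp: ht_c1\<close>)
  have "d = c2" using d c2 by (intro words_eqI[of d n l c2]) (auto simp: ht_c1 b2(2))
  then show ?thesis using c1 c2 d b2(1) c1w by blast
qed

text \<open>Both ends of the edge are lowered together by \<open>f_op_f_neg\<close> for as long as
  it applies. Lowering is raising of the dual word, so the letter sum of the dual decreases.\<close>

lemma f_neg_reduce:
  assumes "b1 \<in> words n l" "f_neg b1 = Some b2" and n: "1 \<le> n"
  shows "\<exists>c1 c2. (b1, c1) \<in> linked n l \<and> (b2, c2) \<in> linked n l \<and> f_neg c1 = Some c2 \<and> c1 \<in> words n l \<and>
    (\<forall>i t. 2 \<le> i \<and> i \<le> n \<longrightarrow> 0 \<le> ht i c1 t) \<and> (\<forall>t. -2 \<le> ht 1 c1 t)"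
  using assms(1,2)
proof (induction "sum_list (dual n b1)" arbitrary: b1 b2 rule: less_induct)
  case less
  show ?case
  proof (cases "(\<forall>i t. 2 \<le> i \<and> i \<le> n \<longrightarrow> 0 \<le> ht i b1 t) \<and> (\<forall>t. -2 \<le> ht 1 b1 t)")
    case True
    then show ?thesis using less.prems by blast
  next
    case bad: False
    have "\<exists>i. 1 \<le> i \<and> i \<le> n \<and> (i \<noteq> 1 \<and> (\<exists>t. ht i b1 t < 0) \<or> i = 1 \<and> (\<exists>t. ht 1 b1 t < -2))"
    proof (cases "\<forall>t. -2 \<le> ht 1 b1 t")
      case True
      then obtain i t where "2 \<le> i" "i \<le> n" "ht i b1 t < 0" using bad by (auto simp: not_le)
      then show ?thesis by (intro exI[of _ i]) auto
    next
      case False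
      then show ?thesis using n by (intro exI[of _ 1]) (auto simp: not_le)
    qed
    then obtain i where i: "1 \<le> i" "i \<le> n"
      "i \<noteq> 1 \<and> (\<exists>t. ht i b1 t < 0) \<or> i = 1 \<and> (\<exists>t. ht 1 b1 t < -2)" by blast
    obtain c1 c2 where c: "f_op i b1 = Some c1" "f_op i b2 = Some c2" "f_neg c1 = Some c2"
      "c1 \<in> words n l" "b2 \<in> words n l"
      using f_op_f_neg[OF less.prems i] by blast
    have r: "(c1, b1) \<in> raising n l" "(c2, b2) \<in> raising n l"
      using f_op_raising c less.prems i by blast+
    have "sum_list (dual n c1) < sum_list (dual n b1)" using raising_sum_list raising_dual r(1) by blast
    then obtain d1 d2 where "(c1, d1) \<in> linked n l" "(c2, d2) \<in> linked n l" "f_neg d1 = Some d2"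
      "d1 \<in> words n l" "\<forall>i t. 2 \<le> i \<and> i \<le> n \<longrightarrow> 0 \<le> ht i d1 t" "\<forall>t. -2 \<le> ht 1 d1 t"
      using less.hyps[OF _ c(4,3)] by blast
    moreover have "(b1, c1) \<in> linked n l" "(b2, c2) \<in> linked n l" using r by auto
    ultimately show ?thesis by (meson rtrancl_trans)
  qed
qed

lemma e_prod_linked:
  assumes "b \<in> words n l" "1 \<le> a" "c \<le> n" "e_prod a c (Some b) = Some d"
  shows "(b, d) \<in> linked n l"
  using assms(2,4)
proof (induction "Suc c - a" arbitrary: a d)
  case 0
  then show ?case by (simp add: e_prod_empty)
next
  case (Suc m)
  then have ac: "a \<le> c" by simp
  then obtain d0 where d0: "e_prod (Suc a) c (Some b) = Some d0" "e_op a d0 = Some d"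
    using Suc.prems(2) by (auto simp: e_prod_step bind_eq_Some_conv)
  have l: "(b, d0) \<in> linked n l" using Suc.hyps(1)[of "Suc a" d0] Suc.hyps(2) d0 by simp
  have w: "d0 \<in> words n l" using linked_words l assms(1) by blast
  have "d \<in> words n l" by (rule e_opD[OF d0(2) w]) (use ac Suc.prems assms(3) in auto)
  then have "(d0, d) \<in> raising n l" using w d0(2) ac Suc.prems assms(3) by (auto simp: raising_def)
  then show ?case using l by (meson UnI1 rtrancl.rtrancl_into_rtrancl)
qed

text \<open>A reduced edge starts at depth 1 or 2 in height 1. At depth 1, \<open>f_neg\<close>
  coincides with \<open>f_1\<close> and stays in the component. At depth 2, two descents lead to a
  lowest \<open>v\<close> and exhibit the start as some \<open>g\<close>;
  \<open>descent_twice\<close> gives \<open>j \<le> k\<close>.\<close>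

lemma f_neg_component:
  assumes b1: "b1 \<in> words n l" "f_neg b1 = Some b2" and n: "1 \<le> n"
  shows "(b1, b2) \<in> linked n l \<or> (\<exists>v j k g y. v \<in> words n l \<and> lowest n v \<and> 1 \<le> j \<and> j \<le> k \<and> k \<le> n \<and>
    g_elt v j k = Some g \<and> f_neg g = Some y \<and> (v, b1) \<in> linked n l \<and> (y, b2) \<in> linked n l)"
proof -
  obtain c1 c2 where l: "(b1, c1) \<in> linked n l" "(b2, c2) \<in> linked n l" and c: "f_neg c1 = Some c2" "c1 \<in> words n l"
    and low: "\<And>i t. 2 \<le> i \<Longrightarrow> i \<le> n \<Longrightarrow> 0 \<le> ht i c1 t" "\<And>t. -2 \<le> ht 1 c1 t"
    using f_neg_reduce[OF b1 n] by blast
  obtain s where s: "\<And>t. t \<le> s \<Longrightarrow> ht 0 c1 t = 0 \<and> ht 1 c1 t = 0" "ht 0 c1 (Suc s) = 1"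
    and c2: "c2 \<in> words n l" "\<And>j t. ht j c2 t = ht j c1 t - cartan 1 j * step s t"
    by (rule f_neg_D[OF c n]) blast
  have s1: "ht 1 c1 (Suc s) = -1"
    using s(1)[of s] s(2) by (auto simp: ht_Suc split: if_splits)
  show ?thesis
  proof (cases "\<forall>t. -1 \<le> ht 1 c1 t")
    case True
    then have "firstmin (ht 1 c1) s" using s s1 by (intro firstminI) auto
    then obtain d where d: "f_op 1 c1 = Some d" "d \<in> words n l" "\<And>j t. ht j d t = ht j c1 t - cartan 1 j * step s t"
      by (rule f_opI[OF _ c(2) order_refl n]) blast
    have "d = c2" using c2 d by (intro words_eqI[of d n l c2]) auto
    then have "(c2, c1) \<in> linked n l" using f_op_raising[OF d(1) c(2) order_refl n] by auto
    then have "(b1, b2) \<in> linked n l" using l linked_sym by (meson rtrancl_trans)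
    then show ?thesis ..
  next
    case False
    then obtain t where "ht 1 c1 t < -1" by (auto simp: not_le)
    then have "ht 1 c1 t = -2" using low(2)[of t] by linarith
    then obtain j q where d: "descent n c1 j q" "ht 1 c1 (Suc (q 1)) = -2"
      using descent_exists[of n c1 2] low n by auto
    obtain w where w: "w \<in> words n l" "e_prod 1 j (Some w) = Some c1"
      "\<And>i t. 2 \<le> i \<Longrightarrow> i \<le> n \<Longrightarrow> 0 \<le> ht i w t" "\<And>t. ht 1 c1 (Suc (q 1)) < ht 1 w t"
      "\<And>i. 2 \<le> i \<Longrightarrow> i \<le> j \<Longrightarrow> ht i w (q i) = 0" "ht 1 w (q 1) = ht 1 c1 (Suc (q 1)) + 1"
      by (rule descent_run[OF c(2) low(1) d(1)]) blast+
    have w6: "ht 1 w (q 1) = -1" using w(6) d(2) by simp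
    have "-1 \<le> ht 1 w t" for t using w(4)[of t] d(2) by linarith
    then obtain k p where d': "descent n w k p" "ht 1 w (Suc (p 1)) = -1"
      using descent_exists[of n w 1] w(3) w6 n by auto
    obtain v where v: "v \<in> words n l" "e_prod 1 k (Some v) = Some w"
      "\<And>i t. 2 \<le> i \<Longrightarrow> i \<le> n \<Longrightarrow> 0 \<le> ht i v t" "\<And>t. ht 1 w (Suc (p 1)) < ht 1 v t"
      by (rule descent_run[OF w(1,3) d'(1)]) blast+
    have "j \<le> k"
      by (rule descent_twice[OF c(2) low(1) d(1) w(2,1) w6 w(5) d'])
    moreover have "0 \<le> ht i v t" if "1 \<le> i" "i \<le> n" for i t
      using v(3)[of i t] v(4)[of t] that d'(2) by (cases "i = 1") auto
    then have "lowest n v" by (simp add: lowest_iff)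
    moreover have "g_elt v j k = Some c1" using v w by (simp add: g_elt_def)
    moreover have jk: "1 \<le> j" "j \<le> n" "k \<le> n" using d d' by (auto simp: descent_def)
    moreover have "(v, b1) \<in> linked n l"
      using e_prod_linked[OF v(1) order_refl _ v(2)] e_prod_linked[OF w(1) order_refl _ w(2)] jk l linked_sym
      by (meson rtrancl_trans)
    moreover have "(c2, b2) \<in> linked n l" using l linked_sym by blast
    ultimately show ?thesis using v(1) c(1) by blast
  qed
qed

section \<open>Moving edges and the connectivity axioms\<close>

text \<open>By \<open>f_neg_component\<close> the edge can be taken to start in some
  \<open>g\<close> with indices \<open>j1\<close> and \<open>k1\<close>. The first alternative of
  \<open>dichotomy\<close> would keep its end in the component of \<open>v\<close>, so the second
  holds, with some \<open>h1\<close> and \<open>v'\<close>. Comparing weights forces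
  \<open>k1 = k\<close> and \<open>h1 = h\<close>.\<close>

lemma moving_edge_consequence:
  assumes n: "1 \<le> n" and v: "v \<in> words n l" "lowest n v" and hk: "k \<le> n" "h < k"
    and edge: "moving_edge n l C (up n l v) k h u'" and C: "C \<subseteq> words n l"
    and j: "1 \<le> j" "j \<le> k" "g_elt v j k = Some g"
  shows "\<exists>y. f_neg g = Some y \<and>
    (h < j \<longrightarrow> e_prod 2 j (e_prod 1 h (Some (lowest_of n l u'))) = Some y) \<and>
    (j \<le> h \<longrightarrow> e_prod 2 k (e_prod 1 j (Some v)) = Some y)"
proof -
  let ?u = "up n l v"
  have u': "u' \<in> words n l" "highest n u'" using edge C by (auto simp: moving_edge_def)
  have wt_u': "\<And>a. a \<in> {1..n+1} \<Longrightarrow> wt u' a = wt ?u a - eps (n + 1 - k) a + eps (n + 1 - h) a"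
    using edge by (auto simp: moving_edge_def)
  obtain b1 b2 where b: "(?u, b1) \<in> linked n l" "(u', b2) \<in> linked n l" "f_neg b1 = Some b2"
    using edge by (auto simp: moving_edge_def comp_graph_edges_def typeA_comp_iff)
  have u: "(v, ?u) \<in> linked n l" "?u \<in> words n l" "highest n ?u" using up_linked v by auto
  have b1: "b1 \<in> words n l" using linked_words[OF b(1) u(2)] .
  \<comment> \<open>As \<open>h < k\<close>, the two rows differ, so \<open>u'\<close> and the
    highest weight element of \<open>v\<close> have different weights and lie in different
    components.\<close>
  have "wt u' (n + 1 - h) \<noteq> wt ?u (n + 1 - h)"
    using wt_u'[of "n + 1 - h"] hk by (auto simp: eps_def)
  then have not_linked: "(v, b2) \<notin> linked n l"
    using b(2) u u' highest_unique linked_sym by (metis (no_types, lifting) rtrancl_trans)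
  have "(b1, b2) \<notin> linked n l" using not_linked u(1) b(1) by (meson rtrancl_trans)
  then obtain v1 j1 k1 g1 y1 where v1: "v1 \<in> words n l" "lowest n v1" "1 \<le> j1" "j1 \<le> k1" "k1 \<le> n"
    "g_elt v1 j1 k1 = Some g1" "f_neg g1 = Some y1" "(v1, b1) \<in> linked n l" "(y1, b2) \<in> linked n l"
    using f_neg_component[OF b1 b(3) n] by blast
  have "(v1, v) \<in> linked n l" using v1(8) b(1) u(1) linked_sym by (meson rtrancl_trans)
  then have [simp]: "v1 = v" using lowest_unique v1 v by blast
  have k1: "1 \<le> k1" using v1 by simp
  have not_k: "e_prod 2 k1 (e_prod 1 j1 (Some v)) \<noteq> Some y1"
  proof
    assume e: "e_prod 2 k1 (e_prod 1 j1 (Some v)) = Some y1"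
    then obtain x where x: "e_prod 1 j1 (Some v) = Some x" by (cases "e_prod 1 j1 (Some v)") auto
    have "(v, x) \<in> linked n l" using e_prod_linked[OF v(1) order_refl _ x] v1 by simp
    moreover have "(x, y1) \<in> linked n l"
      using e_prod_linked[of x n l 2 k1 y1] linked_words[OF calculation v(1)] e x v1 by simp
    ultimately show False using not_linked v1(9) by (meson rtrancl_trans)
  qed
  obtain h1 v' where h1: "h1 < k1" "v' \<in> words n l" "lowest n v'"
    and beta: "\<And>j g. 1 \<le> j \<Longrightarrow> j \<le> k1 \<Longrightarrow> g_elt v j k1 = Some g \<Longrightarrow>
      (\<exists>y. f_neg g = Some y \<and> (h1 < j \<longrightarrow> e_prod 2 j (e_prod 1 h1 (Some v')) = Some y) \<and>
          (j \<le> h1 \<longrightarrow> e_prod 2 k1 (e_prod 1 j (Some v)) = Some y))"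
    using dichotomy[OF v k1 v1(5)]
  proof (elim disjE exE conjE, goal_cases)
    case 1
    have "g_elt v j1 k1 = Some g1" using v1(6) by simp
    then show ?case using 1(2) v1(3,4,7) not_k by blast
  next
    case (2 h v' j g y)
    show ?case by (rule 2(1)[OF 2(2-4)]) (use 2(5-) in auto)
  qed
  have hj: "h1 < j1" and e: "e_prod 2 j1 (e_prod 1 h1 (Some v')) = Some y1"
    using beta[of j1 g1] v1 not_k by (cases "h1 < j1"; auto)+
  obtain x where x: "e_prod 1 h1 (Some v') = Some x" using e by (cases "e_prod 1 h1 (Some v')") auto
  have lx: "(v', x) \<in> linked n l" using e_prod_linked[OF h1(2) order_refl _ x] h1 v1 by simp
  have ly: "(x, y1) \<in> linked n l"
    using e_prod_linked[of x n l 2 j1 y1] linked_words[OF lx h1(2)] e x v1 by simp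
  have "(v', u') \<in> linked n l" using lx ly v1(9) b(2) linked_sym by (meson rtrancl_trans)
  then have up_v': "up n l v' = u'" using up_eqI h1(2) u'(2) by blast
  obtain z where z: "e_prod 1 k1 (Some v) = Some z" "e_prod 1 j1 (Some z) = Some g1"
    using v1(6) by (cases "e_prod 1 k1 (Some v)") (auto simp: g_elt_def)
  \<comment> \<open>\<open>v\<close> and \<open>v'\<close> are compared along their ways to
    \<open>y1\<close>, where the common terms cancel. For \<open>h1 = 0\<close> or
    \<open>j1 = 1\<close> the product is empty and the two terms of \<open>wt_e_prod\<close> cancel
    each other.\<close>
  have wt_v': "wt v' a = wt v a + eps (h1 + 1) a - eps (k1 + 1) a" for a
    using wt_e_prod[OF _ z(1), of a] wt_e_prod[OF _ z(2), of a] wt_f_neg[OF v1(7), of a]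
      wt_e_prod[OF _ x, of a] wt_e_prod[of 2 j1 x y1 a] e x v1(3) by simp
  have eq: "eps (n + 1 - h) a - eps (n + 1 - k) a = eps (h1 + 1) (n + 2 - a) - eps (k1 + 1) (n + 2 - a)"
    if "a \<in> {1..n+1}" for a
    using wt_up_lowest[OF v that] wt_up_lowest[OF h1(2,3) that] wt_u'[OF that] wt_v'[of "n + 2 - a"] up_v' by simp
  have ne: "n + 1 - h \<noteq> n + 1 - k" using hk by arith
  have mem: "n + 1 - h \<in> {1..n+1}" "n + 1 - k \<in> {1..n+1}" using hk by auto
  \<comment> \<open>The left side of \<open>eq\<close> is 1 at row \<open>n + 1 - h\<close> and -1
    at row \<open>n + 1 - k\<close>, which locates both indices.\<close>
  have "h1 = h" using eq[OF mem(1)] ne hk h1(1) by (auto simp: eps_def split: if_splits)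
  moreover have "k1 = k" using eq[OF mem(2)] ne hk h1(1) by (auto simp: eps_def split: if_splits)
  moreover have "lowest_of n l u' = v'" using lowest_of_up[OF h1(2,3)] up_v' by simp
  ultimately show ?thesis using beta[of j g] j by simp
qed

text \<open>The identity for \<open>y\<close> is itself an odd edge from the component of
  \<open>v\<close> to that of \<open>v'\<close>; \<open>wt_up_lowest\<close> turns the weight
  difference of the lowest elements into the required one of the highest elements.\<close>

lemma moving_edge_exists:
  assumes v: "v \<in> C" "v \<in> words n l" "lowest n v" and v': "v' \<in> words n l" "lowest n v'"
    and C: "\<And>b c. b \<in> C \<Longrightarrow> (b, c) \<in> linked n l \<Longrightarrow> c \<in> C"
      "\<And>b c. b \<in> C \<Longrightarrow> f_neg b = Some c \<Longrightarrow> c \<in> C"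
    and hk: "h < k" "k \<le> n"
    and j: "h < j" "j \<le> k" "g_elt v j k = Some g" "f_neg g = Some y" "e_prod 2 j (e_prod 1 h (Some v')) = Some y"
  shows "moving_edge n l C (up n l v) k h (up n l v')"
proof -
  obtain w where w: "e_prod 1 k (Some v) = Some w" "e_prod 1 j (Some w) = Some g"
    using j(3) by (cases "e_prod 1 k (Some v)") (auto simp: g_elt_def)
  obtain x where x: "e_prod 1 h (Some v') = Some x" "e_prod 2 j (Some x) = Some y"
    using j(5) by (cases "e_prod 1 h (Some v')") auto
  have lw: "(v, w) \<in> linked n l" using e_prod_linked[OF v(2) order_refl hk(2) w(1)] .
  have lg: "(v, g) \<in> linked n l"
    using e_prod_linked[OF linked_words[OF lw v(2)] order_refl _ w(2)] lw j hk by (meson le_trans rtrancl_trans)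
  have lx: "(v', x) \<in> linked n l" using e_prod_linked[OF v'(1) order_refl _ x(1)] hk by simp
  have ly: "(v', y) \<in> linked n l"
    using e_prod_linked[OF linked_words[OF lx v'(1)] _ _ x(2)] lx j hk by (meson le_trans one_le_numeral rtrancl_trans)
  have yC: "y \<in> C" using C v(1) lg j(4) by blast
  have v'C: "v' \<in> C" using C(1)[OF yC] ly linked_sym by blast
  note u = up_linked[OF v(2)] and u' = up_linked[OF v'(1)]
  have vert: "typeA_comp n l b \<in> comp_graph_vertices n l C" if "b \<in> C" "b \<in> words n l" for b
    using that C(1) by (auto simp: comp_graph_vertices_def typeA_comp_iff)
  have "g \<in> typeA_comp n l (up n l v)" "y \<in> typeA_comp n l (up n l v')"
    unfolding typeA_comp_iff using lg ly u(1) u'(1) linked_sym by (meson rtrancl_trans)+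
  then have "(typeA_comp n l (up n l v), typeA_comp n l (up n l v')) \<in> comp_graph_edges n l C"
    using vert C(1) v(1) v'C u u' j(4) unfolding comp_graph_edges_def by blast
  moreover have wt_v': "wt v' a = wt v a + eps (h + 1) a - eps (k + 1) a" for a
    using wt_e_prod[OF _ w(1), of a] wt_e_prod[OF _ w(2), of a] wt_f_neg[OF j(4), of a]
      wt_e_prod[OF _ x(1), of a] wt_e_prod[OF _ x(2), of a] j(1) by simp
  have "wt (up n l v') a = wt (up n l v) a - eps (n + 1 - k) a + eps (n + 1 - h) a" if "a \<in> {1..n+1}" for a
    using wt_up_lowest[OF v(2,3) that] wt_up_lowest[OF v' that] wt_v'[of "n + 2 - a"] that hk
    by (auto simp: eps_def)
  ultimately show ?thesis using C(1)[OF v'C] u' by (simp add: moving_edge_def)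
qed

lemma queer_component_closed:
  assumes "C \<in> queer_components n l" "1 \<le> n"
  shows "C \<subseteq> words n l" "b \<in> C \<Longrightarrow> (b, c) \<in> linked n l \<Longrightarrow> c \<in> C"
    "b \<in> C \<Longrightarrow> f_neg b = Some c \<Longrightarrow> c \<in> C"
proof -
  let ?E = "queer_edges n l \<union> (queer_edges n l)\<inverse>"
  obtain b0 where b0: "b0 \<in> words n l" "C = ?E\<^sup>* `` {b0}"
    using assms(1) by (auto simp: queer_components_def connected_comp_def)
  have E: "queer_edges n l = (raising n l)\<inverse> \<union> {(b, c). b \<in> words n l \<and> f_neg b = Some c}"
    by (simp add: queer_edges_def typeA_edges_eq)
  have fw: "c \<in> words n l" if "f_neg b = Some c" "b \<in> words n l" for b c
    by (rule f_neg_D[OF that assms(2)])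
  have "x \<in> words n l" if "(b0, x) \<in> ?E\<^sup>*" for x
    using that
  proof (induction rule: rtrancl_induct)
    case (step y z)
    then show ?case using fw by (auto simp: E raising_def)
  qed (rule b0(1))
  then show sub: "C \<subseteq> words n l" using b0 by auto
  have "linked n l \<subseteq> ?E\<^sup>*" by (rule rtrancl_mono) (auto simp: E)
  then show "b \<in> C \<Longrightarrow> (b, c) \<in> linked n l \<Longrightarrow> c \<in> C"
    unfolding b0(2) by (auto intro: rtrancl_trans)
  show "c \<in> C" if "b \<in> C" "f_neg b = Some c"
  proof -
    have "(b, c) \<in> ?E" using that sub by (auto simp: E)
    then show ?thesis using that(1) unfolding b0(2) by (auto intro: rtrancl_into_rtrancl)
  qed
qed

theorem theorem4p6:
  fixes n l :: nat and C :: "nat list set"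
  assumes "n \<ge> 1" and "l \<ge> 1"
    and "C \<in> queer_components n l"
  shows "axiom_C0 n C \<and> axiom_C1 n l C \<and> axiom_C2 n l C"
proof (intro conjI)
  note C = queer_component_closed[OF assms(3,1)]
  have vw: "v \<in> words n l" if "v \<in> C" for v using C(1) that by blast
  note conseq = moving_edge_consequence[OF assms(1) vw _ _ _ _ C(1)]
  show "axiom_C0 n C"
    unfolding axiom_C0_def using phi_neg_g_elt vw by blast
  show "axiom_C1 n l C"
    unfolding axiom_C1_def
  proof (intro ballI allI impI, elim conjE)
    fix v k h u' j g
    assume "v \<in> C" "lowest n v" "k \<le> n" "h < k" "moving_edge n l C (up n l v) k h u'"
      "h < j" "j \<le> k" "g_elt v j k = Some g"
    then show "f_neg g \<noteq> None \<and> f_neg g = e_prod 2 j (e_prod 1 h (Some (lowest_of n l u')))"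
      using conseq[of v k h u' j g] by auto
  qed
  show "axiom_C2 n l C"
    unfolding axiom_C2_def
  proof (intro ballI allI impI conjI)
    fix v k h u' j g
    assume "v \<in> C" "lowest n v" "1 \<le> k \<and> k \<le> n" "h < k \<and> moving_edge n l C (up n l v) k h u'"
      "1 \<le> j \<and> j \<le> h \<and> g_elt v j k = Some g \<and> f_neg g \<noteq> None"
    then show "f_neg g = e_prod 2 k (e_prod 1 j (Some v))"
      using conseq[of v k h u' j g] by auto
  next
    fix v k j g
    assume v: "v \<in> C" "lowest n v" and k: "1 \<le> k \<and> k \<le> n"
      and none: "\<nexists>h u'. h < k \<and> moving_edge n l C (up n l v) k h u'"
      and j: "1 \<le> j \<and> j \<le> k \<and> g_elt v j k = Some g \<and> f_neg g \<noteq> None"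
    show "f_neg g = e_prod 2 k (e_prod 1 j (Some v))"
      using dichotomy[OF vw[OF v(1)] v(2) k[THEN conjunct1] k[THEN conjunct2]]
    proof (elim disjE exE conjE)
      \<comment> \<open>In the second alternative of \<open>dichotomy\<close> the witness
        \<open>j0\<close> yields a moving edge, against the assumption of case (b).\<close>
      fix h v' j0 g0 y0
      assume h: "h < k" "v' \<in> words n l" "lowest n v'" and j0: "h < j0" "j0 \<le> k" "g_elt v j0 k = Some g0"
        "f_neg g0 = Some y0"
        and beta: "\<forall>j g. 1 \<le> j \<and> j \<le> k \<and> g_elt v j k = Some g \<longrightarrow>
           (\<exists>y. f_neg g = Some y \<and>
              (h < j \<longrightarrow> e_prod 2 j (e_prod 1 h (Some v')) = Some y) \<and>
              (j \<le> h \<longrightarrow> e_prod 2 k (e_prod 1 j (Some v)) = Some y))"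
      have "1 \<le> j0" using j0(1) by simp
      then have e: "e_prod 2 j0 (e_prod 1 h (Some v')) = Some y0" using beta j0 by fastforce
      have "moving_edge n l C (up n l v) k h (up n l v')"
        by (rule moving_edge_exists[OF v(1) vw[OF v(1)] v(2) h(2,3) _ _ h(1) k[THEN conjunct2] j0 e])
          (fact C)+
      then show ?thesis using none h(1) by blast
    qed (use j in auto)
  qed
qed

end
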